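(* Fix $1<p<\infty$ and let $\mathbb B_p^n=\{x\in\mathbb R^n:|x_1|^p+\cdots+|x_n|^p\le 1\}$. The following assertions hold as $n\to\infty$. (i) (Bulk regime.) Let $j(n)\in\{0,\dots,n\}$ be such that $\alpha(n):=j(n)/n\to\alpha\in(0,1)$ as $n\to\infty$. For $\beta\in(0,1)$ let $\theta_{p,\beta}\in(0,\infty)$ be the unique maximizer of the function $\Psi_{p,\beta}$ (defined in the context). Then $$ V_{j(n)}(\mathbb B_p^n)\sim\frac{p(p-1)^{n-j(n)-1}\,n\binom{n-1}{j(n)}}{2\pi^{(n-j(n))/2}\,\Gamma\!\left(\frac{j(n)+p}{p}\right)}\,\frac{\mathcal K_p(\theta_{p,\alpha})}{\theta_{p,\alpha}\,\mathcal J_p(\theta_{p,\alpha})}\,e^{\,n\Psi_{p,\alpha(n)}(\theta_{p,\alpha(n)})}\sqrt{\frac{2\pi}{n\,|\Psi_{p,\alpha}''(\theta_{p,\alpha})|}} . $$ (ii) (Left-edge regime.) Let $j\in\mathbb N\cup\{0\}$ be fixed. Then $$ V_j(\mathbb B_p^n)\sim\frac1{j!}\left((2\sqrt\pi)^{1/p}\left(\frac{\Gamma\!\left(\frac1{2p-2}\right)}{p-1}\right)^{1-1/p}\right)^{j}n^{\,j(1-1/p)} . $$ (iii) (Right-edge regime.) Let $m\in\mathbb N$ be fixed. Then $$ V_{n-m}(\mathbb B_p^n)\sim\frac{\Gamma\!\left(\frac m2\right)}{2\,\Gamma(m)}\left(\frac{p(p-1)\Gamma\!\left(1-\frac1p\right)}{\pi\,\Gamma\!\left(\frac1p\right)}\right)^{m/2}\frac{\left(\frac2p\Gamma\!\left(\frac1p\right)\right)^n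 n^{m/2}}{\Gamma\!\left(\frac{n+p-m}{p}\right)} . $$
   Context: Notation: $x_n\sim y_n$ means $x_n/y_n\to 1$ as $n\to\infty$; $\mathbb N=\{1,2,\dots\}$. For a convex body $K\subset\mathbb R^n$, the intrinsic volumes $V_0(K),\dots,V_n(K)$ are defined by the Steiner formula $\mathrm{Vol}_n(K+t\mathbb B_2^n)=\sum_{j=0}^n\kappa_{n-j}V_j(K)t^{n-j}$, $t\ge 0$, where $\mathbb B_2^n$ is the Euclidean unit ball and $\kappa_m=\mathrm{Vol}_m(\mathbb B_2^m)$. For $\theta\ge 0$: $\mathcal I_p(\theta)=\int_{\mathbb R}e^{-|x|^p-\theta|x|^{2p-2}}dx$, $\mathcal J_p(\theta)=\int_{\mathbb R}|x|^{p-2}e^{-|x|^p-\theta|x|^{2p-2}}dx$, $\mathcal K_p(\theta)=\int_{\mathbb R}|x|^{2p-2}e^{-|x|^p-\theta|x|^{2p-2}}dx$. For $\beta\in(0,1)$ the phase function $\Psi_{p,\beta}:(0,\infty)\to\mathbb R$ is $$\Psi_{p,\beta}(\theta)=\frac{1-\beta}{2}\log\theta+\beta\log\mathcal I_p(\theta)+(1-\beta)\log\mathcal J_p(\theta).$$ It has a unique global maximizer $\theta_{p,\beta}\in(0,\infty)$, which is the unique solution in $(0,\infty)$ of $\theta\,\mathcal J_p(\theta)/\mathcal I_p(\theta)=\frac{(1-\beta)p}{2(p-1)\beta}$, and $\Psi_{p,\beta}''(\theta_{p,\beta})<0$. In (i), $\alpha(n)\in(0,1)$ for all sufficiently large $n$,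 so $\theta_{p,\alpha(n)}$ is defined for such $n$. *)

theory Defs
  imports "HOL-Analysis.Analysis" "HOL-Library.Landau_Symbols"
begin

text \<open>
  The dimension varies, so \<open>\<real>\<^sup>n\<close> is the carrier \<open>{..<n} \<rightarrow>\<^sub>E UNIV\<close> of the product measure
  \<open>\<Pi>\<^sub>M i\<in>{..<n}. lborel\<close>: functions on \<open>nat\<close> that are \<open>undefined\<close> outside \<open>{..<n}\<close>.
\<close>

definition euclidean_volume :: "nat \<Rightarrow> (nat \<Rightarrow> real) set \<Rightarrow> real" where
  "euclidean_volume n K = measure (\<Pi>\<^sub>M i\<in>{..<n}. lborel) K"

definition lp_ball :: "real \<Rightarrow> nat \<Rightarrow> (nat \<Rightarrow> real) set" where
  "lp_ball p n = {x \<in> {..<n} \<rightarrow>\<^sub>E UNIV. (\<Sum>i<n. \<bar>x i\<bar> powr p) \<le> 1}"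

definition parallel_body :: "nat \<Rightarrow> (nat \<Rightarrow> real) set \<Rightarrow> real \<Rightarrow> (nat \<Rightarrow> real) set" where
  "parallel_body n K t = {(\<lambda>i\<in>{..<n}. x i + t * y i) | x y. x \<in> K \<and> y \<in> lp_ball 2 n}"

text \<open>
  The intrinsic volumes are the coefficients in the Steiner formula, which determines them
  for \<open>j \<le> n\<close>; extending by \<open>0\<close> for \<open>j > n\<close> makes the whole sequence unique.
\<close>

definition intrinsic_volume :: "nat \<Rightarrow> (nat \<Rightarrow> real) set \<Rightarrow> nat \<Rightarrow> real" where
  "intrinsic_volume n K = (THE V. (\<forall>j>n. V j = 0) \<and>
     (\<forall>t\<ge>0. euclidean_volume n (parallel_body n K t) =
        (\<Sum>j\<le>n. euclidean_volume (n - j) (lp_ball 2 (n - j)) * V j * t ^ (n - j))))"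

definition I_int :: "real \<Rightarrow> real \<Rightarrow> real" where
  "I_int p \<theta> = (\<integral>x. exp (- (\<bar>x\<bar> powr p) - \<theta> * \<bar>x\<bar> powr (2 * p - 2)) \<partial>lborel)"

definition J_int :: "real \<Rightarrow> real \<Rightarrow> real" where
  "J_int p \<theta> = (\<integral>x. \<bar>x\<bar> powr (p - 2) *
     exp (- (\<bar>x\<bar> powr p) - \<theta> * \<bar>x\<bar> powr (2 * p - 2)) \<partial>lborel)"

definition K_int :: "real \<Rightarrow> real \<Rightarrow> real" where
  "K_int p \<theta> = (\<integral>x. \<bar>x\<bar> powr (2 * p - 2) *
     exp (- (\<bar>x\<bar> powr p) - \<theta> * \<bar>x\<bar> powr (2 * p - 2)) \<partial>lborel)"

definition phase :: "real \<Rightarrow> real \<Rightarrow> real \<Rightarrow> real" where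
  "phase p \<beta> \<theta> = (1 - \<beta>) / 2 * ln \<theta> + \<beta> * ln (I_int p \<theta>) + (1 - \<beta>) * ln (J_int p \<theta>)"

definition phase_maximizer :: "real \<Rightarrow> real \<Rightarrow> real" where
  "phase_maximizer p \<beta> = (THE \<theta>. is_arg_max (phase p \<beta>) (\<lambda>\<theta>. \<theta> > 0) \<theta>)"

end

theory Submission
  imports Defs "HOL-Real_Asymp.Real_Asymp"
begin

text \<open>
  For a ball \<open>R B\<^sub>p\<close> of radius \<open>R\<close>, the points whose nearest point on the boundary is \<open>u\<close> are
  \<open>\<Phi>\<^sub>s u\<close>, \<open>s \<ge> 0\<close>, where \<open>\<Phi>\<^sub>s\<close> acts on each coordinate by \<open>u \<mapsto> u + s sgn u \<bar>u\<bar>\<^sup>p\<^sup>-\<^sup>1\<close>.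
  Integrating the volume of the shell between \<open>R B\<^sub>p\<close> and its parallel body over \<open>R\<^sup>p\<close>, and
  replacing \<open>R\<^sup>p\<close> by the parameter \<open>s\<close> for every fixed outer point, makes both changes of
  variables one-dimensional. The result is a polynomial in the distance whose coefficients are
  integrals of \<open>\<theta>\<^sup>m\<^sup>/\<^sup>2\<^sup>-\<^sup>1 K J\<^sup>m\<^sup>-\<^sup>1 I\<^sup>n\<^sup>-\<^sup>m\<close>; differentiating in the upper limit of \<open>R\<^sup>p\<close> recovers the
  Steiner formula for the unit ball. The asymptotics of these integrals come from Laplace's method
  in the bulk and from a Watson-type lemma at the two edges: at \<open>\<theta> = 0\<close> for the right edge, and,
  after exchanging the roles of the exponents \<open>p\<close> and \<open>2p - 2\<close> by scaling, again at \<open>0\<close> for the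
  left edge.
\<close>

section \<open>Change of variables and the normal map\<close>

text \<open>At a point u the outer normal of the sphere through u has coordinates sgn(u_i)
  |u_i|^(p-1), whatever the radius. One and the same map \<Phi>_s therefore serves all spheres at
  once, and for fixed s it is a coordinatewise bijection of the whole space: no surface measure and
  no matrix Jacobian occur. Its Jacobian is the product of the factors 1 + s (p-1) |u_k|^(p-2),
  while the s-derivative of R^p at a fixed outer point is a sum over i whose terms have exactly
  these factors as denominators. Each term loses its denominator, which is why a polynomial in s
  results. R^p rather than R is averaged because it is additive over the coordinates. The distance
  travelled is s times the root of the sum of |u_k|^(2p-2); this is the origin of the second
  exponent, and a Gamma integral in \<theta> turns its negative power into an exponential, so that
  the coordinates separate. The \<theta>-integrals are finite because they are coefficients of a
  finite volume.\<close>

lemma nn_integral_change_of_variables_real: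
  fixes g g' :: "real \<Rightarrow> real" and f :: "real \<Rightarrow> ennreal"
  assumes S [measurable]: "S \<in> sets borel" and gS [measurable]: "g ` S \<in> sets borel"
    and der: "\<And>x. x \<in> S \<Longrightarrow> (g has_field_derivative g' x) (at x)"
    and inj: "inj_on g S"
    and [measurable]: "g \<in> borel_measurable borel" "g' \<in> borel_measurable borel"
      "f \<in> borel_measurable borel"
  shows "(\<integral>\<^sup>+y\<in>g ` S. f y \<partial>lborel) = (\<integral>\<^sup>+x\<in>S. ennreal \<bar>g' x\<bar> * f (g x) \<partial>lborel)"
proof -
  \<comment> \<open>Both sides are integrals against measures: Lebesgue measure on the image, and
    the push-forward under \<open>g\<close> of the density |g'| on \<open>S\<close>. It suffices to
    identify these two measures.\<close>
  define M1 where "M1 = density lborel (indicator (g ` S) :: real \<Rightarrow> ennreal)"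
  define M2 where "M2 = distr (density lborel (\<lambda>x. ennreal \<bar>g' x\<bar> * indicator S x)) borel g"
  have m1: "emeasure M1 A = emeasure lborel (A \<inter> g ` S)" if [measurable]: "A \<in> sets borel" for A
    unfolding M1_def by (simp add: emeasure_density Int_commute flip: indicator_inter_arith)
  have m2: "emeasure M2 A = (\<integral>\<^sup>+x. ennreal (indicator S x * (\<bar>g' x\<bar> * indicator A (g x))) \<partial>lborel)"
    if [measurable]: "A \<in> sets borel" for A
  proof -
    have [measurable]: "g -` A \<in> sets borel"
      using measurable_sets_borel[of g borel A] by simp
    show ?thesis
      unfolding M2_def by (simp add: emeasure_distr emeasure_density)
        (auto intro!: nn_integral_cong simp: indicator_def ennreal_mult)
  qed
  \<comment> \<open>Boundedness makes the indicator of \<open>A\<close> absolutely integrable on the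
    image, as the change of variables for real-valued integrals requires. General sets follow by
    exhaustion with intervals.\<close>
  have bdd: "emeasure M1 A = emeasure M2 A" if A [measurable]: "A \<in> sets borel" and "bounded A" for A
  proof -
    let ?B = "A \<inter> g ` S"
    have fin: "emeasure lborel ?B < \<infinity>"
      using emeasure_bounded_finite[of ?B] \<open>bounded A\<close> by (auto simp: bounded_Int)
    then have lm: "?B \<in> lmeasurable" by (intro fmeasurableI) auto
    have "set_integrable lebesgue ?B (\<lambda>_. 1 :: real)"
      using lm by (simp add: lmeasurable_iff_integrable_on absolutely_integrable_on_def)
    then have ai: "(indicator A :: real \<Rightarrow> real) absolutely_integrable_on g ` S"
      by (simp add: set_integrable_def indicator_inter_arith mult.commute)
    have int: "integral (g ` S) (indicator A :: real \<Rightarrow> real) = measure lborel ?B"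
    proof -
      have "integral (g ` S) (\<lambda>x. if x \<in> A then 1 else 0 :: real) = measure lborel ?B"
        using lm lmeasure_integral[of ?B] integral_restrict_Int[of "g ` S" A "\<lambda>_. 1::real"]
        by (simp add: Int_commute)
      moreover have "(\<lambda>x. if x \<in> A then 1 else 0 :: real) = indicator A"
        by (auto simp: indicator_def)
      ultimately show ?thesis by simp
    qed
    have "(\<lambda>x. \<bar>g' x\<bar> * indicator A (g x)) absolutely_integrable_on S \<and>
        integral S (\<lambda>x. \<bar>g' x\<bar> * indicator A (g x)) = measure lborel ?B"
      using has_absolute_integral_change_of_variables_1'[of S g g' "indicator A" "measure lborel ?B"]
        der inj ai int by (auto intro: has_field_derivative_at_within)
    then have "((\<lambda>x. \<bar>g' x\<bar> * indicator A (g x)) has_integral measure lborel ?B) S"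
      using absolutely_integrable_on_def has_integral_iff set_lebesgue_integral_eq_integral(1) by blast
    from nn_integral_has_integral_lebesgue[OF _ this]
    have "emeasure M2 A = ennreal (measure lborel ?B)"
      by (subst m2) auto
    also have "\<dots> = emeasure lborel ?B"
      using fin by (subst emeasure_eq_ennreal_measure) auto
    finally show ?thesis by (simp add: m1)
  qed
  have eq: "M1 = M2"
  proof (rule measure_eqI)
    show "sets M1 = sets M2" by (simp add: M1_def M2_def)
    fix A assume "A \<in> sets M1"
    then have A [measurable]: "A \<in> sets borel" by (simp add: M1_def)
    let ?A = "\<lambda>k::nat. A \<inter> {- real k..real k}"
    have U: "(\<Union>k. ?A k) = A"
    proof (intro equalityI subsetI)
      fix x assume "x \<in> A"
      obtain k :: nat where "\<bar>x\<bar> \<le> real k" using real_arch_simple by blast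
      with \<open>x \<in> A\<close> have "x \<in> ?A k" by (auto simp: abs_le_iff)
      then show "x \<in> (\<Union>k. ?A k)" by blast
    qed auto
    have inc: "incseq ?A" by (intro incseq_SucI) auto
    have r1: "range ?A \<subseteq> sets M1" and r2: "range ?A \<subseteq> sets M2"
      by (auto simp: M1_def M2_def)
    have "emeasure M1 A = (SUP k. emeasure M1 (?A k))"
      using SUP_emeasure_incseq[OF r1 inc] unfolding U by (rule sym)
    also have "\<dots> = (SUP k. emeasure M2 (?A k))"
      by (intro SUP_cong refl bdd) (auto simp: bounded_Int)
    also have "\<dots> = emeasure M2 A"
      using SUP_emeasure_incseq[OF r2 inc] unfolding U .
    finally show "emeasure M1 A = emeasure M2 A" .
  qed
  have "(\<integral>\<^sup>+y\<in>g ` S. f y \<partial>lborel) = (\<integral>\<^sup>+y. f y \<partial>M1)"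
    unfolding M1_def by (subst nn_integral_density) (auto simp: mult.commute)
  also have "\<dots> = (\<integral>\<^sup>+x\<in>S. ennreal \<bar>g' x\<bar> * f (g x) \<partial>lborel)"
    unfolding eq unfolding M2_def
    by (subst nn_integral_distr, simp, simp, subst nn_integral_density) (auto simp: mult_ac)
  finally show ?thesis .
qed

text \<open>Tonelli peels off one coordinate at a time, and the densities multiply. The
  one-dimensional formula is assumed for all measurable functions because the sections of
  \<open>f\<close> vary with the other coordinates.\<close>

lemma nn_integral_PiM_componentwise_substitution:
  fixes g :: "real \<Rightarrow> real" and D :: "real \<Rightarrow> ennreal"
  assumes [measurable]: "g \<in> borel_measurable borel" "D \<in> borel_measurable borel"
    and sub: "\<And>f :: real \<Rightarrow> ennreal. f \<in> borel_measurable borel \<Longrightarrow>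
        (\<integral>\<^sup>+x. f x \<partial>lborel) = (\<integral>\<^sup>+u. D u * f (g u) \<partial>lborel)"
    and "finite I" and "f \<in> borel_measurable (PiM I (\<lambda>_. lborel))"
  shows "(\<integral>\<^sup>+x. f x \<partial>PiM I (\<lambda>_. lborel)) =
    (\<integral>\<^sup>+u. (\<Prod>i\<in>I. D (u i)) * f (\<lambda>i\<in>I. g (u i)) \<partial>PiM I (\<lambda>_. lborel))"
  using \<open>finite I\<close> assms(5)
proof (induction I arbitrary: f)
  case empty
  then show ?case by (simp add: PiM_empty nn_integral_count_space_finite restrict_def)
next
  case (insert k I f)
  interpret product_sigma_finite "\<lambda>_. lborel :: real measure" by standard
  note [measurable] = insert.prems
  note fin = \<open>finite I\<close>
  have "(\<integral>\<^sup>+x. f x \<partial>PiM (insert k I) (\<lambda>_. lborel)) =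
      (\<integral>\<^sup>+x. (\<integral>\<^sup>+y. f (x(k := y)) \<partial>lborel) \<partial>PiM I (\<lambda>_. lborel))"
    by (rule product_nn_integral_insert) (use insert in auto)
  also have "\<dots> = (\<integral>\<^sup>+x. (\<integral>\<^sup>+y. D y * f (x(k := g y)) \<partial>lborel) \<partial>PiM I (\<lambda>_. lborel))"
    by (intro nn_integral_cong sub) measurable
  also have "\<dots> = (\<integral>\<^sup>+u. (\<Prod>i\<in>I. D (u i)) *
      (\<integral>\<^sup>+y. D y * f ((\<lambda>i\<in>I. g (u i))(k := g y)) \<partial>lborel) \<partial>PiM I (\<lambda>_. lborel))"
    by (rule insert.IH) measurable
  also have "\<dots> = (\<integral>\<^sup>+u. (\<integral>\<^sup>+y. (\<Prod>i\<in>insert k I. D ((u(k := y)) i)) *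
      f (\<lambda>i\<in>insert k I. g ((u(k := y)) i)) \<partial>lborel) \<partial>PiM I (\<lambda>_. lborel))"
  proof (intro nn_integral_cong)
    fix u assume u: "u \<in> space (PiM I (\<lambda>_. lborel :: real measure))"
    note [measurable] = u
    have *: "(\<lambda>i\<in>I. g (u i))(k := g y) = (\<lambda>i\<in>insert k I. g ((u(k := y)) i))" for y
      using insert.hyps by (auto simp: fun_eq_iff restrict_def)
    have **: "(\<Prod>i\<in>insert k I. D ((u(k := y)) i)) = (\<Prod>i\<in>I. D (u i)) * D y" for y
      using insert.hyps by (subst prod.insert) (auto simp: mult.commute intro!: prod.cong arg_cong2[of _ _ _ _ "(*)"])
    have mu: "(\<lambda>y. f ((\<lambda>i\<in>I. g (u i))(k := g y))) \<in> borel_measurable lborel"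
      by measurable
    show "(\<Prod>i\<in>I. D (u i)) * (\<integral>\<^sup>+y. D y * f ((\<lambda>i\<in>I. g (u i))(k := g y)) \<partial>lborel) =
      (\<integral>\<^sup>+y. (\<Prod>i\<in>insert k I. D ((u(k := y)) i)) *
        f (\<lambda>i\<in>insert k I. g ((u(k := y)) i)) \<partial>lborel)"
      using mu unfolding *[symmetric] ** by (simp add: mult.assoc nn_integral_cmult)
  qed
  also have "\<dots> = (\<integral>\<^sup>+u. (\<Prod>i\<in>insert k I. D (u i)) * f (\<lambda>i\<in>insert k I. g (u i))
      \<partial>PiM (insert k I) (\<lambda>_. lborel))"
    by (rule product_nn_integral_insert[symmetric]) (use insert in auto)
  finally show ?case .
qed


text \<open>
  For a point \<open>u\<close> on an \<open>\<ell>\<^sub>p\<close> sphere, \<open>i \<mapsto> phi p s (u i)\<close> runs through the outer normal ray at \<open>u\<close> as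
  \<open>s \<ge> 0\<close> varies. Only \<open>\<bar>s\<bar>\<close> enters, so that \<open>phi p s\<close> is a bijection for every real \<open>s\<close> and its
  inverse is measurable jointly in \<open>s\<close> and the point.
\<close>

definition phi :: "real \<Rightarrow> real \<Rightarrow> real \<Rightarrow> real" where
  "phi p s u = u + \<bar>s\<bar> * (sgn u * \<bar>u\<bar> powr (p - 1))"

definition psi :: "real \<Rightarrow> real \<Rightarrow> real \<Rightarrow> real" where
  "psi p s = inv (phi p s)"

text \<open>The derivative of \<open>phi p s\<close> away from 0. At 0 the \<open>powr\<close> term
  is 0 by convention, so the value there is 1 even for p < 2, where the true slope is infinite if s
  \<noteq> 0.\<close>

definition dphi :: "real \<Rightarrow> real \<Rightarrow> real \<Rightarrow> real" where
  "dphi p s u = 1 + \<bar>s\<bar> * (p - 1) * \<bar>u\<bar> powr (p - 2)"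

lemma phi_0 [simp]: "phi p s 0 = 0"
  and phi_minus: "phi p s (- u) = - phi p s u"
  by (simp_all add: phi_def sgn_minus algebra_simps)

lemma abs_phi: "\<bar>phi p s u\<bar> = \<bar>u\<bar> + \<bar>s\<bar> * \<bar>u\<bar> powr (p - 1)"
proof -
  have "phi p s u = sgn u * (\<bar>u\<bar> + \<bar>s\<bar> * \<bar>u\<bar> powr (p - 1))"
    by (cases u "0 :: real" rule: linorder_cases) (auto simp: phi_def algebra_simps)
  then show ?thesis by (cases "u = 0") (auto simp: abs_mult abs_sgn_eq)
qed

lemma dphi_pos: "p > 1 \<Longrightarrow> dphi p s u > 0"
  unfolding dphi_def by (intro add_pos_nonneg) auto

lemma phi_strict_mono:
  assumes p: "p > 1" shows "strict_mono (phi p s)"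
proof (rule strict_monoI)
  fix x y :: real assume "x < y"
  have mono: "\<bar>s\<bar> * (sgn x * \<bar>x\<bar> powr (p - 1)) \<le> \<bar>s\<bar> * (sgn y * \<bar>y\<bar> powr (p - 1))"
  proof (intro mult_left_mono)
    consider "0 \<le> x" | "x < 0" "0 \<le> y" | "y < 0" by linarith
    then show "sgn x * \<bar>x\<bar> powr (p - 1) \<le> sgn y * \<bar>y\<bar> powr (p - 1)"
    proof cases
      case 1
      then show ?thesis using \<open>x < y\<close> p by (auto simp: sgn_if intro!: powr_mono2)
    next
      case 2
      then show ?thesis by (auto simp: sgn_if intro: order_trans[of _ 0])
    next
      case 3
      then show ?thesis using \<open>x < y\<close> p by (auto simp: sgn_if intro!: powr_mono2)
    qed
  qed simp
  then show "phi p s x < phi p s y" using \<open>x < y\<close> by (simp add: phi_def)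
qed

lemma continuous_on_phi:
  assumes p: "p > 1" shows "continuous_on A (phi p s)"
proof -
  \<comment> \<open>Positive and negative parts replace \<open>sgn\<close>, whose jump at 0 blocks a
    termwise continuity argument.\<close>
  have eq: "phi p s = (\<lambda>u. u + \<bar>s\<bar> * (max u 0 powr (p - 1) - max (- u) 0 powr (p - 1)))"
    by (auto simp: phi_def fun_eq_iff sgn_if max_def)
  show ?thesis
    unfolding eq using p by (intro continuous_intros continuous_on_powr') auto
qed

lemma bij_phi:
  assumes p: "p > 1" shows "bij (phi p s)"
proof (rule bijI)
  show "inj (phi p s)" using phi_strict_mono[OF p] by (rule strict_mono_imp_inj_on)
  have pos: "\<exists>u. phi p s u = x" if "0 \<le> x" for x
  proof -
    have "x \<le> phi p s x" using that by (simp add: phi_def sgn_if)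
    then have "\<exists>u\<ge>0. u \<le> x \<and> phi p s u = x"
      using that by (intro IVT' continuous_on_phi p) auto
    then show ?thesis by blast
  qed
  show "surj (phi p s)"
    unfolding surj_def
  proof
    fix x show "\<exists>u. x = phi p s u"
    proof (cases "0 \<le> x")
      case False
      then obtain u where "phi p s u = - x" using pos[of "- x"] by auto
      then have "x = phi p s (- u)" by (simp add: phi_minus)
      then show ?thesis by blast
    qed (use pos in metis)
  qed
qed

lemma phi_psi [simp]: "p > 1 \<Longrightarrow> phi p s (psi p s x) = x"
  unfolding psi_def by (simp add: bij_phi bij_is_surj surj_f_inv_f)

lemma psi_phi [simp]: "p > 1 \<Longrightarrow> psi p s (phi p s u) = u"
  unfolding psi_def by (simp add: bij_phi bij_is_inj)

lemma psi_abs: "psi p \<bar>s\<bar> = psi p s"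
  unfolding psi_def phi_def by simp

lemma psi_le_iff: "p > 1 \<Longrightarrow> psi p s x \<le> c \<longleftrightarrow> x \<le> phi p s c"
  using strict_mono_less_eq[OF phi_strict_mono, of p s "psi p s x" c] by simp

lemma phi_eq_0_iff: "p > 1 \<Longrightarrow> phi p s u = 0 \<longleftrightarrow> u = 0"
  by (metis phi_0 psi_phi)

lemma psi_0 [simp]: "p > 1 \<Longrightarrow> psi p s 0 = 0"
  by (metis phi_0 psi_phi)

lemma psi_eq_0_iff: "p > 1 \<Longrightarrow> psi p s x = 0 \<longleftrightarrow> x = 0"
  by (metis phi_psi psi_0 phi_0)

lemma phi_0_left [simp]: "phi p 0 u = u"
  by (simp add: phi_def)

lemma psi_0_left [simp]: "p > 1 \<Longrightarrow> psi p 0 x = x"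
  by (metis phi_0_left psi_phi)

lemma abs_psi_eq: "p > 1 \<Longrightarrow> \<bar>psi p s x\<bar> + \<bar>s\<bar> * \<bar>psi p s x\<bar> powr (p - 1) = \<bar>x\<bar>"
  by (metis abs_phi phi_psi)

lemma diff_psi_eq: "p > 1 \<Longrightarrow> x - psi p s x = \<bar>s\<bar> * (sgn (psi p s x) * \<bar>psi p s x\<bar> powr (p - 1))"
  by (metis add_diff_cancel_left' phi_def phi_psi)

lemma measurable_phi [measurable]: "phi p s \<in> borel_measurable borel"
  unfolding phi_def by measurable

lemma measurable_dphi [measurable]: "dphi p s \<in> borel_measurable borel"
  unfolding dphi_def by measurable

text \<open>\<open>phi p s\<close> is increasing, so a sublevel set of its inverse is an explicit
  condition on \<open>f\<close> and \<open>g\<close>.\<close>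

lemma measurable_psi2:
  assumes p: "p > 1" and [measurable]: "f \<in> borel_measurable M" "g \<in> borel_measurable M"
  shows "(\<lambda>x. psi p (f x) (g x)) \<in> borel_measurable M"
proof (rule borel_measurableI_le)
  fix c
  \<comment> \<open>Applied with k = sgn c |c|^(p-1), which gives \<open>phi p (f x) c\<close> on
    the right.\<close>
  have "{x \<in> space M. g x \<le> c + \<bar>f x\<bar> * k} \<in> sets M" for k :: real
    by measurable
  then show "{x \<in> space M. psi p (f x) (g x) \<le> c} \<in> sets M"
    unfolding psi_le_iff[OF p] phi_def .
qed

text \<open>The null point 0, fixed by the map, is removed on both sides, because for p < 2 and s
  \<noteq> 0 the map is not differentiable there.\<close>

lemma nn_integral_phi_substitution:
  fixes f :: "real \<Rightarrow> ennreal"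
  assumes p: "p > 1" and [measurable]: "f \<in> borel_measurable borel"
  shows "(\<integral>\<^sup>+x. f x \<partial>lborel) = (\<integral>\<^sup>+u. ennreal (dphi p s u) * f (phi p s u) \<partial>lborel)"
proof -
  have img: "phi p s ` (- {0}) = - {0}"
  proof (intro set_eqI iffI)
    fix y assume "y \<in> - {0 :: real}"
    then have "psi p s y \<in> - {0}" using psi_eq_0_iff[OF p] by simp
    then have "phi p s (psi p s y) \<in> phi p s ` (- {0})" by (rule imageI)
    then show "y \<in> phi p s ` (- {0})" using p by simp
  qed (use phi_eq_0_iff[OF p] in auto)
  have der: "(phi p s has_field_derivative dphi p s x) (at x)" if "x \<noteq> 0" for x
  proof (cases "x > 0")
    case True
    have "((\<lambda>u. u + \<bar>s\<bar> * u powr (p - 1)) has_field_derivative dphi p s x) (at x)"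
      using True by (auto intro!: derivative_eq_intros simp: dphi_def)
    then show ?thesis
      by (rule has_field_derivative_transform_within_open[of _ _ _ "{0<..}"])
        (use True in \<open>auto simp: phi_def\<close>)
  next
    case False
    then have "x < 0" using that by simp
    have "((\<lambda>u. u - \<bar>s\<bar> * (- u) powr (p - 1)) has_field_derivative dphi p s x) (at x)"
      using \<open>x < 0\<close> by (auto intro!: derivative_eq_intros simp: dphi_def)
    then show ?thesis
      by (rule has_field_derivative_transform_within_open[of _ _ _ "{..<0}"])
        (use \<open>x < 0\<close> in \<open>auto simp: phi_def\<close>)
  qed
  have inj: "inj_on (phi p s) (- {0})"
    using bij_phi[OF p, of s] by (auto simp: bij_def intro: inj_on_subset)
  have ae: "AE x in lborel. x \<noteq> (0::real)" by (rule AE_lborel_singleton)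
  have "(\<integral>\<^sup>+x. f x \<partial>lborel) = (\<integral>\<^sup>+x\<in>phi p s ` (- {0}). f x \<partial>lborel)"
    unfolding img using ae by (auto intro!: nn_integral_cong_AE elim!: eventually_mono)
  also have "\<dots> = (\<integral>\<^sup>+u\<in>- {0}. ennreal \<bar>dphi p s u\<bar> * f (phi p s u) \<partial>lborel)"
    by (rule nn_integral_change_of_variables_real) (use der inj img in auto)
  also have "\<dots> = (\<integral>\<^sup>+u. ennreal (dphi p s u) * f (phi p s u) \<partial>lborel)"
    using ae by (auto intro!: nn_integral_cong_AE elim!: eventually_mono simp: abs_of_pos[OF dphi_pos[OF p]])
  finally show ?thesis .
qed

section \<open>The normal map as a function of its parameter\<close>

lemma powr_inverse_cancel: "0 < (a::real) \<Longrightarrow> a powr (1 - p) * a powr (p - 1) = 1"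
  by (simp add: powr_add[symmetric])

text \<open>In |psi| + s |psi|^(p-1) = |x| the left side increases with s and with |psi|, so a
  larger s forces a smaller |psi|.\<close>

lemma abs_psi_antimono:
  assumes p: "p > 1" and s: "0 \<le> s" "s \<le> s'"
  shows "\<bar>psi p s' x\<bar> \<le> \<bar>psi p s x\<bar>"
proof (rule ccontr)
  assume "\<not> ?thesis"
  then have less: "\<bar>psi p s x\<bar> < \<bar>psi p s' x\<bar>" by simp
  then have "s * \<bar>psi p s x\<bar> powr (p - 1) \<le> s' * \<bar>psi p s' x\<bar> powr (p - 1)"
    using p s by (intro mult_mono powr_mono2) auto
  with less have "\<bar>psi p s x\<bar> + \<bar>s\<bar> * \<bar>psi p s x\<bar> powr (p - 1) <
      \<bar>psi p s' x\<bar> + \<bar>s'\<bar> * \<bar>psi p s' x\<bar> powr (p - 1)"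
    using s by simp
  then show False using p by (simp add: abs_psi_eq)
qed

lemma abs_psi_strict_antimono:
  assumes p: "p > 1" and s: "0 \<le> s" "s < s'" and x: "x \<noteq> 0"
  shows "\<bar>psi p s' x\<bar> < \<bar>psi p s x\<bar>"
proof (rule ccontr)
  assume "\<not> ?thesis"
  then have le: "\<bar>psi p s x\<bar> \<le> \<bar>psi p s' x\<bar>" by simp
  have "s * \<bar>psi p s x\<bar> powr (p - 1) < s' * \<bar>psi p s' x\<bar> powr (p - 1)"
  proof (rule mult_less_le_imp_less)
    show "0 < \<bar>psi p s x\<bar> powr (p - 1)" using x p by (simp add: psi_eq_0_iff)
  qed (use p s le in \<open>auto intro!: powr_mono2\<close>)
  with le have "\<bar>psi p s x\<bar> + \<bar>s\<bar> * \<bar>psi p s x\<bar> powr (p - 1) <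
      \<bar>psi p s' x\<bar> + \<bar>s'\<bar> * \<bar>psi p s' x\<bar> powr (p - 1)"
    using s by simp
  then show False using p by (simp add: abs_psi_eq)
qed

lemma abs_psi_le: "p > 1 \<Longrightarrow> \<bar>psi p s x\<bar> \<le> \<bar>x\<bar>"
  using abs_psi_antimono[of p 0 "\<bar>s\<bar>" x] by (simp add: psi_abs)

lemma abs_diff_psi: "p > 1 \<Longrightarrow> \<bar>x - psi p s x\<bar> = \<bar>s\<bar> * \<bar>psi p s x\<bar> powr (p - 1)"
  by (cases "psi p s x = 0") (auto simp: diff_psi_eq abs_mult abs_sgn_eq psi_eq_0_iff)

lemma abs_diff_psi': "p > 1 \<Longrightarrow> \<bar>x - psi p s x\<bar> = \<bar>x\<bar> - \<bar>psi p s x\<bar>"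
  using abs_psi_eq[of p s x] by (simp add: abs_diff_psi)

text \<open>Subtract the defining equations at s and s', then replace |psi| at s by the smaller
  value at s'. The Lipschitz bound yields the continuity in s on which the inverse function rule
  below relies.\<close>

lemma abs_psi_diff_le:
  assumes p: "p > 1" and s: "0 \<le> s" "s \<le> s'"
  shows "\<bar>psi p s x\<bar> - \<bar>psi p s' x\<bar> \<le> (s' - s) * \<bar>x\<bar> powr (p - 1)"
proof -
  have "\<bar>psi p s x\<bar> - \<bar>psi p s' x\<bar> =
      s' * \<bar>psi p s' x\<bar> powr (p - 1) - s * \<bar>psi p s x\<bar> powr (p - 1)"
    using abs_psi_eq[OF p, of s x] abs_psi_eq[OF p, of s' x] s by simp
  also have "\<dots> \<le> s' * \<bar>psi p s' x\<bar> powr (p - 1) - s * \<bar>psi p s' x\<bar> powr (p - 1)"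
    using s p by (intro diff_left_mono mult_left_mono powr_mono2 abs_psi_antimono) auto
  also have "\<dots> = (s' - s) * \<bar>psi p s' x\<bar> powr (p - 1)" by (simp add: algebra_simps)
  also have "\<dots> \<le> (s' - s) * \<bar>x\<bar> powr (p - 1)"
    using s p by (intro mult_left_mono powr_mono2 abs_psi_le) auto
  finally show ?thesis .
qed

lemma continuous_on_abs_psi:
  assumes p: "p > 1" shows "continuous_on {0..} (\<lambda>s. \<bar>psi p s x\<bar>)"
proof (rule lipschitz_on_continuous_on)
  show "(\<bar>x\<bar> powr (p - 1))-lipschitz_on {0..} (\<lambda>s. \<bar>psi p s x\<bar>)"
  proof (rule lipschitz_onI)
    fix s s' :: real assume s: "s \<in> {0..}" "s' \<in> {0..}"
    show "dist \<bar>psi p s x\<bar> \<bar>psi p s' x\<bar> \<le> \<bar>x\<bar> powr (p - 1) * dist s s'"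
    proof (cases "s \<le> s'")
      case True
      then show ?thesis using abs_psi_diff_le[OF p, of s s' x] abs_psi_antimono[OF p, of s s' x] s
        by (simp add: dist_real_def mult.commute)
    next
      case False
      then show ?thesis using abs_psi_diff_le[OF p, of s' s x] abs_psi_antimono[OF p, of s' s x] s
        by (simp add: dist_real_def mult.commute)
    qed
  qed simp
qed

lemma tendsto_abs_psi_at_top:
  assumes p: "p > 1" shows "((\<lambda>s. \<bar>psi p s x\<bar>) \<longlongrightarrow> 0) at_top"
proof (rule tendsto_sandwich[where f = "\<lambda>_. 0"])
  show "((\<lambda>s. (\<bar>x\<bar> / s) powr (1 / (p - 1))) \<longlongrightarrow> 0) at_top"
  proof -
    have "((\<lambda>s. \<bar>x\<bar> / s) \<longlongrightarrow> 0) at_top"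
      by (intro tendsto_divide_0[OF tendsto_const] filterlim_at_top_imp_at_infinity filterlim_ident)
    then have "((\<lambda>s. (\<bar>x\<bar> / s) powr (1 / (p - 1))) \<longlongrightarrow> 0 powr (1 / (p - 1))) at_top"
    proof (rule tendsto_powr')
      have "\<forall>\<^sub>F s in at_top. 0 \<le> \<bar>x\<bar> / s"
        using eventually_ge_at_top[of "0::real"] by eventually_elim simp
      then show "0 \<noteq> (0::real) \<or> 0 < 1 / (p - 1) \<and> (\<forall>\<^sub>F s in at_top. 0 \<le> \<bar>x\<bar> / s)"
        using p by simp
    qed auto
    then show ?thesis by simp
  qed
  show "\<forall>\<^sub>F s in at_top. \<bar>psi p s x\<bar> \<le> (\<bar>x\<bar> / s) powr (1 / (p - 1))"
    using eventually_gt_at_top[of "0::real"]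
  proof eventually_elim
    case (elim s)
    have "s * \<bar>psi p s x\<bar> powr (p - 1) \<le> \<bar>x\<bar>"
      using abs_psi_eq[OF p, of s x] elim by simp
    then have "\<bar>psi p s x\<bar> powr (p - 1) \<le> \<bar>x\<bar> / s"
      using elim by (simp add: field_simps)
    then have "(\<bar>psi p s x\<bar> powr (p - 1)) powr (1 / (p - 1)) \<le> (\<bar>x\<bar> / s) powr (1 / (p - 1))"
      using p by (intro powr_mono2) auto
    then show ?case using p by (simp add: powr_powr)
  qed
qed auto

text \<open>The rate at which |psi p s x|^p falls in s, expressed by the foot u = psi p s x:
  differentiating |u| + s |u|^(p-1) = |x| gives d|u|/ds = -|u|^(p-1) / dphi. The denominator is the
  Jacobian factor of the same coordinate.\<close>

definition drho :: "real \<Rightarrow> real \<Rightarrow> real \<Rightarrow> real" where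
  "drho p s u = p * \<bar>u\<bar> powr (2 * p - 2) / dphi p s u"

lemma drho_nonneg: "p > 1 \<Longrightarrow> 0 \<le> drho p s u"
  unfolding drho_def using dphi_pos[of p s u] by simp

lemma has_field_derivative_abs_psi_powr:
  assumes p: "p > 1" and s: "s > 0"
  shows "((\<lambda>s. \<bar>psi p s x\<bar> powr p) has_field_derivative - drho p s (psi p s x)) (at s)"
proof (cases "x = 0")
  case True
  then show ?thesis using p by (simp add: drho_def)
next
  case False
  define w where "w = (\<lambda>s. \<bar>psi p s x\<bar>)"
  have wpos: "w t > 0" for t using False p by (simp add: w_def psi_eq_0_iff)
  have weq: "w t + \<bar>t\<bar> * w t powr (p - 1) = \<bar>x\<bar>" for t
    using abs_psi_eq[OF p] by (simp add: w_def)
  define D where "D = - (w s powr (1 - p)) * dphi p s (psi p s x)"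
  have Dne: "D \<noteq> 0" using wpos[of s] dphi_pos[OF p, of s "psi p s x"] by (simp add: D_def)
  have xw: "\<bar>x\<bar> - w s = s * w s powr (p - 1)" using weq[of s] s by simp
  have e1: "w s powr (p - 1) * w s powr (- p) = w s powr (1 - p) * w s powr (p - 2)"
    by (simp add: powr_add[symmetric])
  \<comment> \<open>The defining equation can be solved for the parameter: s = (|x| - w) w^(1-p).
    Differentiating in w and inverting gives dw/ds.\<close>
  have "((\<lambda>u. (\<bar>x\<bar> - u) * u powr (1 - p)) has_field_derivative
      (- (w s powr (1 - p)) + (\<bar>x\<bar> - w s) * ((1 - p) * w s powr (- p)))) (at (w s))"
    using wpos[of s] by (auto intro!: derivative_eq_intros simp: algebra_simps)
  moreover have "- (w s powr (1 - p)) + (\<bar>x\<bar> - w s) * ((1 - p) * w s powr (- p)) = D"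
  proof -
    have "(\<bar>x\<bar> - w s) * ((1 - p) * w s powr (- p)) = s * (1 - p) * (w s powr (p - 1) * w s powr (- p))"
      by (simp add: xw)
    also have "\<dots> = s * (1 - p) * (w s powr (1 - p) * w s powr (p - 2))" by (simp only: e1)
    finally show ?thesis using s by (simp add: D_def dphi_def w_def algebra_simps)
  qed
  ultimately have der: "((\<lambda>u. (\<bar>x\<bar> - u) * u powr (1 - p)) has_field_derivative D) (at (w s))" by simp
  have "(w has_field_derivative inverse D) (at s)"
  proof (rule DERIV_inverse_function[where a = 0 and b = "s + 1"])
    show "isCont w s"
      using continuous_on_interior[OF continuous_on_abs_psi[OF p, of x], of s] s by (simp add: w_def)
    fix y :: real assume "0 < y"
    then have "\<bar>x\<bar> - w y = y * w y powr (p - 1)" using weq[of y] by simp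
    then show "(\<bar>x\<bar> - w y) * w y powr (1 - p) = y"
      using powr_inverse_cancel[OF wpos[of y], of p] by (simp add: mult_ac)
  qed (use der Dne s in auto)
  then have "((\<lambda>s. w s powr p) has_field_derivative p * w s powr (p - 1) * inverse D) (at s)"
    using wpos[of s] by (auto intro!: derivative_eq_intros)
  moreover have "p * w s powr (p - 1) * inverse D = - drho p s (psi p s x)"
  proof -
    have "w s powr (2 * p - 2) * w s powr (1 - p) = w s powr (p - 1)"
      by (simp add: powr_add[symmetric])
    moreover have ww: "\<bar>psi p s x\<bar> = w s" by (simp add: w_def)
    ultimately show ?thesis using dphi_pos[OF p, of s "psi p s x"] wpos[of s]
      by (simp add: drho_def D_def ww field_simps)
  qed
  ultimately show ?thesis by (simp add: w_def)
qed

text \<open>\<open>psi p s\<close> applied to every coordinate gives the foot of the normal that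
  reaches x at parameter s. This is the level \<tau> = R^p of the sphere through that foot.\<close>

definition rho :: "real \<Rightarrow> nat set \<Rightarrow> (nat \<Rightarrow> real) \<Rightarrow> real \<Rightarrow> real" where
  "rho p I x s = (\<Sum>i\<in>I. \<bar>psi p s (x i)\<bar> powr p)"

text \<open>The squared distance from x to the same foot. It grows with s while \<open>rho\<close>
  falls, so a single parameter decides membership in the parallel bodies of all levels.\<close>

definition delta :: "real \<Rightarrow> nat set \<Rightarrow> (nat \<Rightarrow> real) \<Rightarrow> real \<Rightarrow> real" where
  "delta p I x s = (\<Sum>i\<in>I. (x i - psi p s (x i))\<^sup>2)"

lemma rho_0: "p > 1 \<Longrightarrow> rho p I x 0 = (\<Sum>i\<in>I. \<bar>x i\<bar> powr p)"
  by (simp add: rho_def)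

lemma rho_nonneg: "0 \<le> rho p I x s"
  by (auto simp: rho_def intro: sum_nonneg)

lemma rho_antimono: "p > 1 \<Longrightarrow> 0 \<le> s \<Longrightarrow> s \<le> s' \<Longrightarrow> rho p I x s' \<le> rho p I x s"
  unfolding rho_def by (intro sum_mono powr_mono2 abs_psi_antimono) auto

lemma delta_mono: "p > 1 \<Longrightarrow> 0 \<le> s \<Longrightarrow> s \<le> s' \<Longrightarrow> delta p I x s \<le> delta p I x s'"
  unfolding delta_def
  by (intro sum_mono) (auto simp: abs_le_square_iff[symmetric] abs_diff_psi' abs_psi_antimono)

lemma delta_eq: "p > 1 \<Longrightarrow> delta p I x s = s\<^sup>2 * (\<Sum>i\<in>I. \<bar>psi p s (x i)\<bar> powr (2 * p - 2))"
proof -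
  assume p: "p > 1"
  have "(x i - psi p s (x i))\<^sup>2 = s\<^sup>2 * \<bar>psi p s (x i)\<bar> powr (2 * p - 2)" for i
  proof -
    have "(x i - psi p s (x i))\<^sup>2 = \<bar>x i - psi p s (x i)\<bar>\<^sup>2" by simp
    also have "\<dots> = s\<^sup>2 * (\<bar>psi p s (x i)\<bar> powr (p - 1))\<^sup>2"
      unfolding abs_diff_psi[OF p] by (simp add: power_mult_distrib)
    also have "(\<bar>psi p s (x i)\<bar> powr (p - 1))\<^sup>2 = \<bar>psi p s (x i)\<bar> powr (2 * p - 2)"
      by (simp add: power2_eq_square powr_add[symmetric])
    finally show ?thesis .
  qed
  then show ?thesis by (simp add: delta_def sum_distrib_left)
qed

lemma rho_strict_antimono:
  assumes p: "p > 1" and s: "0 \<le> s" "s < s'" and I: "finite I" "i \<in> I" "x i \<noteq> 0"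
  shows "rho p I x s' < rho p I x s"
  unfolding rho_def
proof (rule sum_strict_mono_ex1)
  show "\<forall>i\<in>I. \<bar>psi p s' (x i)\<bar> powr p \<le> \<bar>psi p s (x i)\<bar> powr p"
    using p s by (intro ballI powr_mono2 abs_psi_antimono) auto
  have "\<bar>psi p s' (x i)\<bar> powr p < \<bar>psi p s (x i)\<bar> powr p"
    using p s I by (intro powr_less_mono2 abs_psi_strict_antimono) auto
  then show "\<exists>i\<in>I. \<bar>psi p s' (x i)\<bar> powr p < \<bar>psi p s (x i)\<bar> powr p" using I by auto
qed (use I in auto)

lemma continuous_on_rho: "p > 1 \<Longrightarrow> continuous_on {0..} (rho p I x)"
  unfolding rho_def[abs_def]
  by (intro continuous_on_sum continuous_on_powr' continuous_on_abs_psi continuous_intros) auto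

lemma continuous_on_delta:
  assumes p: "p > 1" shows "continuous_on {0..} (delta p I x)"
proof -
  have "(x i - psi p s (x i))\<^sup>2 = (\<bar>x i\<bar> - \<bar>psi p s (x i)\<bar>)\<^sup>2" for i s
    unfolding abs_diff_psi'[OF p, symmetric] by simp
  then have eq: "delta p I x = (\<lambda>s. \<Sum>i\<in>I. (\<bar>x i\<bar> - \<bar>psi p s (x i)\<bar>)\<^sup>2)"
    unfolding delta_def[abs_def] by presburger
  show ?thesis unfolding eq by (intro continuous_intros continuous_on_abs_psi p)
qed

lemma tendsto_rho_at_top: "p > 1 \<Longrightarrow> (rho p I x \<longlongrightarrow> 0) at_top"
proof -
  assume p: "p > 1"
  have "((\<lambda>s. \<Sum>i\<in>I. \<bar>psi p s (x i)\<bar> powr p) \<longlongrightarrow> (\<Sum>i\<in>I. 0 powr p)) at_top"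
    using p by (intro tendsto_sum tendsto_powr' tendsto_abs_psi_at_top tendsto_const) auto
  then show ?thesis by (simp add: rho_def[abs_def])
qed

lemma rho_surj:
  assumes p: "p > 1" and "0 < \<tau>" "\<tau> < rho p I x 0"
  obtains s where "s > 0" "rho p I x s = \<tau>"
proof -
  have "eventually (\<lambda>s. rho p I x s < \<tau>) at_top"
    using tendsto_rho_at_top[OF p, of I x] \<open>0 < \<tau>\<close> by (rule order_tendstoD)
  then have "eventually (\<lambda>s. rho p I x s < \<tau> \<and> s > 0) at_top"
    using eventually_gt_at_top by (rule eventually_conj)
  then obtain S where S: "rho p I x S < \<tau>" "S > 0"
    unfolding eventually_at_top_linorder by blast
  have "\<exists>s\<ge>0. s \<le> S \<and> rho p I x s = \<tau>"
    using S assms(3) by (intro IVT2' continuous_on_subset[OF continuous_on_rho[OF p]]) auto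
  then obtain s where s: "s \<ge> 0" "rho p I x s = \<tau>" by blast
  then have "s \<noteq> 0" using assms by auto
  with s show ?thesis by (intro that[of s]) auto
qed

text \<open>If some coordinate of x is nonzero, \<open>rho\<close> decreases strictly from the level
  of x to 0 and maps s > 0 bijectively onto the levels in between. If all vanish, the range of
  levels is empty and the density is 0.\<close>

lemma nn_integral_rho_substitution:
  fixes G :: "real \<Rightarrow> ennreal"
  assumes p: "p > 1" and I: "finite I" and [measurable]: "G \<in> borel_measurable borel"
  shows "(\<integral>\<^sup>+\<tau>\<in>{0<..<rho p I x 0}. G \<tau> \<partial>lborel) =
    (\<integral>\<^sup>+s\<in>{0<..}. ennreal (\<Sum>i\<in>I. drho p s (psi p s (x i))) * G (rho p I x s) \<partial>lborel)"
proof (cases "\<forall>i\<in>I. x i = 0")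
  case True
  then have "rho p I x 0 = 0" using p by (simp add: rho_def)
  moreover have "(\<Sum>i\<in>I. drho p s (psi p s (x i))) = 0" for s
    using True p by (simp add: drho_def)
  ultimately show ?thesis by simp
next
  case False
  then obtain i where i: "i \<in> I" "x i \<noteq> 0" by auto
  have anti: "s' < s \<longleftrightarrow> rho p I x s < rho p I x s'" if "s \<ge> 0" "s' \<ge> 0" for s s'
    using rho_strict_antimono[OF p, of s s' I i x] rho_strict_antimono[OF p, of s' s I i x] that I i
    by (metis less_asym' linorder_neqE_linordered_idom)
  have pos: "rho p I x s > 0" for s
    using i p I unfolding rho_def by (intro sum_pos2[OF I i(1)]) (auto simp: psi_eq_0_iff)
  have img: "rho p I x ` {0<..} = {0<..<rho p I x 0}"
  proof (intro equalityI subsetI)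
    fix \<tau> assume "\<tau> \<in> {0<..<rho p I x 0}"
    then obtain s where "s > 0" "rho p I x s = \<tau>" using rho_surj[OF p, of \<tau> I x] by auto
    then show "\<tau> \<in> rho p I x ` {0<..}" by auto
  next
    fix \<tau> assume "\<tau> \<in> rho p I x ` {0<..}"
    then obtain s where "s > 0" "\<tau> = rho p I x s" by auto
    then show "\<tau> \<in> {0<..<rho p I x 0}" using anti[of s 0] pos by auto
  qed
  have inj: "inj_on (rho p I x) {0<..}"
  proof (rule inj_onI)
    fix a b :: real assume "a \<in> {0<..}" "b \<in> {0<..}" "rho p I x a = rho p I x b"
    then show "a = b" using anti[of a b] anti[of b a] by auto
  qed
  note [measurable] = measurable_psi2[OF p]
  have nn: "0 \<le> (\<Sum>i\<in>I. drho p s (psi p s (x i)))" for s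
    by (intro sum_nonneg drho_nonneg p)
  have [measurable]: "rho p I x \<in> borel_measurable borel"
    unfolding rho_def[abs_def] by measurable
  have [measurable]: "(\<lambda>s. \<Sum>i\<in>I. drho p s (psi p s (x i))) \<in> borel_measurable borel"
    unfolding drho_def dphi_def by measurable
  have "(\<integral>\<^sup>+\<tau>\<in>rho p I x ` {0<..}. G \<tau> \<partial>lborel) =
      (\<integral>\<^sup>+s\<in>{0<..}. ennreal \<bar>- (\<Sum>i\<in>I. drho p s (psi p s (x i)))\<bar> * G (rho p I x s) \<partial>lborel)"
  proof (rule nn_integral_change_of_variables_real)
    fix s :: real assume "s \<in> {0<..}"
    then show "(rho p I x has_field_derivative - (\<Sum>i\<in>I. drho p s (psi p s (x i)))) (at s)"
      unfolding rho_def[abs_def] sum_negf[symmetric]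
      by (intro DERIV_sum has_field_derivative_abs_psi_powr p) auto
  qed (use inj in \<open>auto simp: img\<close>)
  then show ?thesis using nn by (simp add: img)
qed

section \<open>Parallel bodies\<close>

text \<open>Indexed by the level \<tau> = R^p instead of the radius, in accordance with
  \<open>rho\<close>.\<close>

definition pball :: "real \<Rightarrow> nat set \<Rightarrow> real \<Rightarrow> (nat \<Rightarrow> real) set" where
  "pball p I \<tau> = {x \<in> I \<rightarrow>\<^sub>E UNIV. (\<Sum>i\<in>I. \<bar>x i\<bar> powr p) \<le> \<tau>}"

definition pbody :: "real \<Rightarrow> nat set \<Rightarrow> real \<Rightarrow> real \<Rightarrow> (nat \<Rightarrow> real) set" where
  "pbody p I t \<tau> = {(\<lambda>i\<in>I. x i + t * y i) | x y. x \<in> pball p I \<tau> \<and> y \<in> pball 2 I 1}"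

lemma pball_subset_pbody: "pball p I \<tau> \<subseteq> pbody p I t \<tau>"
proof
  fix x assume x: "x \<in> pball p I \<tau>"
  have "(\<lambda>i\<in>I. 0) \<in> pball 2 I 1" by (simp add: pball_def)
  moreover have "x = (\<lambda>i\<in>I. x i + t * (\<lambda>i\<in>I. 0) i)"
  proof (rule ext)
    fix i show "x i = (\<lambda>i\<in>I. x i + t * (\<lambda>i\<in>I. 0) i) i"
      using x PiE_arb[of x I "\<lambda>_. UNIV" i] by (cases "i \<in> I") (simp_all add: pball_def)
  qed
  ultimately show "x \<in> pbody p I t \<tau>" using x unfolding pbody_def mem_Collect_eq by metis
qed

lemma pbody_mono: "\<tau> \<le> \<tau>' \<Longrightarrow> pbody p I t \<tau> \<subseteq> pbody p I t \<tau>'"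
proof -
  assume "\<tau> \<le> \<tau>'"
  then have "pball p I \<tau> \<subseteq> pball p I \<tau>'" by (auto simp: pball_def)
  then show ?thesis unfolding pbody_def by blast
qed

section \<open>The foot of the normal as nearest point\<close>

lemma Young_powr:
  fixes a b p :: real
  assumes p: "p > 1" and "0 \<le> a" "0 \<le> b"
  shows "a powr (p - 1) * b \<le> (1 - 1 / p) * a powr p + b powr p / p"
proof (cases "a = 0 \<or> b = 0")
  case True
  then show ?thesis using p by auto
next
  case False
  then have ab: "a > 0" "b > 0" using assms by auto
  have "a powr (p - 1) * b = (a powr p) powr (1 - 1 / p) * (b powr p) powr (1 / p)"
  proof -
    have "p * (1 - 1 / p) = p - 1" using p by (simp add: field_simps)
    then show ?thesis using p ab by (simp add: powr_powr)
  qed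
  also have "\<dots> \<le> (1 - 1 / p) * a powr p + 1 / p * b powr p"
    using p ab by (intro Youngs_inequality_0) (auto simp: field_simps)
  finally show ?thesis by simp
qed

text \<open>Young's inequality shows that \<open>psi p s x\<close> is the point of its ball nearest to \<open>x\<close>.\<close>

lemma delta_le_dist:
  assumes p: "p > 1" and s: "s > 0" and y: "(\<Sum>i\<in>I. \<bar>y i\<bar> powr p) \<le> rho p I x s"
  shows "delta p I x s \<le> (\<Sum>i\<in>I. (x i - y i)\<^sup>2)"
proof -
  define u where "u = (\<lambda>i. psi p s (x i))"
  \<comment> \<open>Up to the factor p this is the gradient of the sum of |u_i|^p. Young's
    inequality bounds <g, y> by <g, u> for all y in the ball, so the ball lies behind the hyperplane
    through u orthogonal to x - u.\<close>
  define g where "g = (\<lambda>i. sgn (u i) * \<bar>u i\<bar> powr (p - 1))"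
  have xu: "x i - u i = s * g i" for i
    using diff_psi_eq[OF p, of "x i" s] s by (simp add: u_def g_def)
  have gu: "g i * u i = \<bar>u i\<bar> powr p" for i
  proof (cases "u i = 0")
    case False
    have "g i * u i = \<bar>u i\<bar> powr (p - 1) * \<bar>u i\<bar>"
      unfolding g_def using abs_sgn[of "u i"] by (simp add: mult_ac)
    also have "\<dots> = \<bar>u i\<bar> powr (p - 1) * \<bar>u i\<bar> powr 1" using False by simp
    also have "\<dots> = \<bar>u i\<bar> powr p" by (simp only: powr_add[symmetric]) simp
    finally show ?thesis .
  qed (use p in auto)
  have gy: "g i * y i \<le> (1 - 1 / p) * \<bar>u i\<bar> powr p + \<bar>y i\<bar> powr p / p" for i
  proof -
    have "g i * y i \<le> \<bar>g i\<bar> * \<bar>y i\<bar>" by (simp add: abs_mult[symmetric])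
    also have "\<dots> \<le> \<bar>u i\<bar> powr (p - 1) * \<bar>y i\<bar>"
      by (auto simp: g_def abs_mult abs_sgn_eq)
    also have "\<dots> \<le> (1 - 1 / p) * \<bar>u i\<bar> powr p + \<bar>y i\<bar> powr p / p"
      using p by (intro Young_powr) auto
    finally show ?thesis .
  qed
  have "(\<Sum>i\<in>I. g i * y i) \<le> (\<Sum>i\<in>I. (1 - 1 / p) * \<bar>u i\<bar> powr p + \<bar>y i\<bar> powr p / p)"
    by (intro sum_mono gy)
  also have "\<dots> = (1 - 1 / p) * (\<Sum>i\<in>I. \<bar>u i\<bar> powr p) + (\<Sum>i\<in>I. \<bar>y i\<bar> powr p) / p"
    by (simp only: sum.distrib sum_distrib_left sum_divide_distrib)
  also have "\<dots> \<le> (1 - 1 / p) * (\<Sum>i\<in>I. \<bar>u i\<bar> powr p) + (\<Sum>i\<in>I. \<bar>u i\<bar> powr p) / p"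
    using y p by (intro add_left_mono divide_right_mono) (auto simp: rho_def u_def)
  also have "\<dots> = (\<Sum>i\<in>I. g i * u i)"
    using p by (simp add: gu field_simps)
  finally have pos: "0 \<le> (\<Sum>i\<in>I. g i * (u i - y i))"
    by (simp add: right_diff_distrib sum_subtractf)
  have "(x i - u i)\<^sup>2 + 2 * s * (g i * (u i - y i)) \<le> (x i - y i)\<^sup>2" for i
  proof -
    have "(x i - y i)\<^sup>2 = (x i - u i)\<^sup>2 + 2 * (x i - u i) * (u i - y i) + (u i - y i)\<^sup>2"
      by (simp add: power2_eq_square algebra_simps)
    then show ?thesis by (simp add: xu mult_ac)
  qed
  then have "(\<Sum>i\<in>I. (x i - u i)\<^sup>2 + 2 * s * (g i * (u i - y i))) \<le> (\<Sum>i\<in>I. (x i - y i)\<^sup>2)"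
    by (intro sum_mono)
  then have "(\<Sum>i\<in>I. (x i - u i)\<^sup>2) + 2 * s * (\<Sum>i\<in>I. g i * (u i - y i)) \<le> (\<Sum>i\<in>I. (x i - y i)\<^sup>2)"
    by (simp only: sum.distrib sum_distrib_left)
  moreover have "0 \<le> 2 * s * (\<Sum>i\<in>I. g i * (u i - y i))" using pos s by simp
  ultimately show ?thesis by (simp add: delta_def u_def)
qed

text \<open>The foot lies on the boundary of the ball of level \<open>rho\<close> and is its nearest
  point to x, so the distance to the ball is the root of \<open>delta\<close>.\<close>

lemma mem_pbody_iff_delta:
  assumes p: "p > 1" and s: "s > 0" and t: "t \<ge> 0" and I: "finite I" and x: "x \<in> I \<rightarrow>\<^sub>E UNIV"
  shows "x \<in> pbody p I t (rho p I x s) \<longleftrightarrow> delta p I x s \<le> t\<^sup>2"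
proof
  assume "x \<in> pbody p I t (rho p I x s)"
  then obtain y z where xyz: "x = (\<lambda>i\<in>I. y i + t * z i)"
      "(\<Sum>i\<in>I. \<bar>y i\<bar> powr p) \<le> rho p I x s" "(\<Sum>i\<in>I. \<bar>z i\<bar> powr 2) \<le> 1"
    unfolding pbody_def pball_def by blast
  have "delta p I x s \<le> (\<Sum>i\<in>I. (x i - y i)\<^sup>2)" by (rule delta_le_dist) fact+
  also have "\<dots> = (\<Sum>i\<in>I. t\<^sup>2 * \<bar>z i\<bar> powr 2)"
    by (intro sum.cong refl) (subst xyz(1), simp add: power_mult_distrib)
  also have "\<dots> = t\<^sup>2 * (\<Sum>i\<in>I. \<bar>z i\<bar> powr 2)" by (simp only: sum_distrib_left)
  also have "\<dots> \<le> t\<^sup>2 * 1" using xyz(3) by (intro mult_left_mono) auto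
  finally show "delta p I x s \<le> t\<^sup>2" by simp
next
  assume le: "delta p I x s \<le> t\<^sup>2"
  define u where "u = (\<lambda>i\<in>I. psi p s (x i))"
  \<comment> \<open>For t = 0 division by zero gives z = 0. The representation of x survives,
    because then \<open>delta\<close> = 0 and x coincides with its foot.\<close>
  define z where "z = (\<lambda>i\<in>I. (x i - psi p s (x i)) / t)"
  have 1: "u \<in> pball p I (rho p I x s)"
    unfolding pball_def u_def rho_def by simp
  have 2: "z \<in> pball 2 I 1"
  proof -
    have "(\<Sum>i\<in>I. \<bar>z i\<bar> powr 2) = (\<Sum>i\<in>I. (x i - psi p s (x i))\<^sup>2 / t\<^sup>2)"
      by (intro sum.cong refl) (simp add: z_def power_divide)
    also have "\<dots> = delta p I x s / t\<^sup>2"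
      by (simp only: sum_divide_distrib delta_def)
    also have "\<dots> \<le> 1" using le by (cases "t = 0") (auto simp: divide_le_eq)
    finally have "(\<Sum>i\<in>I. \<bar>z i\<bar> powr 2) \<le> 1" .
    moreover have "z \<in> I \<rightarrow>\<^sub>E UNIV" by (simp add: z_def)
    ultimately show ?thesis unfolding pball_def by blast
  qed
  have 3: "x = (\<lambda>i\<in>I. u i + t * z i)"
  proof (rule ext)
    fix i
    show "x i = (\<lambda>i\<in>I. u i + t * z i) i"
    proof (cases "i \<in> I")
      case True
      have "x i = psi p s (x i)" if "t = 0"
      proof -
        have "delta p I x s = 0"
          using le that unfolding delta_def by (intro antisym sum_nonneg) auto
        then have "\<forall>i\<in>I. (x i - psi p s (x i))\<^sup>2 = 0"
          unfolding delta_def using I by (subst (asm) sum_nonneg_eq_0_iff) auto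
        then show ?thesis using True by auto
      qed
      then show ?thesis using True by (auto simp: u_def z_def)
    next
      case False
      then show ?thesis using PiE_arb[OF x False] by simp
    qed
  qed
  show "x \<in> pbody p I t (rho p I x s)"
    unfolding pbody_def mem_Collect_eq by (intro exI[of _ u] exI[of _ z] conjI 1 2 3)
qed

text \<open>Quantifying over rational parameters only makes the parallel body measurable jointly with the radius.\<close>

definition near :: "real \<Rightarrow> nat set \<Rightarrow> real \<Rightarrow> real \<Rightarrow> (nat \<Rightarrow> real) \<Rightarrow> bool" where
  "near p I t \<tau> x \<longleftrightarrow> (\<forall>q::rat. 0 < q \<longrightarrow> \<tau> < rho p I x (of_rat q) \<longrightarrow> delta p I x (of_rat q) \<le> t\<^sup>2)"

text \<open>\<open>rho\<close> decreases strictly, so the rationals tested by \<open>near\<close>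
  are those below the s with rho = \<tau>. On them \<open>delta\<close> stays below its value at s,
  and continuity from the left recovers that value. If \<tau> is at least the level of x, then x is
  in the ball and \<open>near\<close> holds vacuously.\<close>

lemma mem_pbody_iff_near:
  assumes p: "p > 1" and t: "t \<ge> 0" and I: "finite I" and x: "x \<in> I \<rightarrow>\<^sub>E UNIV" and \<tau>: "\<tau> > 0"
  shows "x \<in> pbody p I t \<tau> \<longleftrightarrow> near p I t \<tau> x"
proof (cases "\<tau> < rho p I x 0")
  case False
  then have "x \<in> pball p I \<tau>" using p x by (simp add: pball_def rho_0)
  then have "x \<in> pbody p I t \<tau>" using pball_subset_pbody by blast
  moreover have "near p I t \<tau> x"
    unfolding near_def
  proof (intro allI impI)
    fix q :: rat assume "0 < q" "\<tau> < rho p I x (of_rat q)"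
    moreover have "rho p I x (of_rat q) \<le> rho p I x 0"
      using \<open>0 < q\<close> by (intro rho_antimono p) auto
    ultimately show "delta p I x (of_rat q) \<le> t\<^sup>2" using False by simp
  qed
  ultimately show ?thesis by simp
next
  case True
  obtain s where s: "s > 0" "rho p I x s = \<tau>" using rho_surj[OF p \<tau> True] .
  have iff: "x \<in> pbody p I t \<tau> \<longleftrightarrow> delta p I x s \<le> t\<^sup>2"
    using mem_pbody_iff_delta[OF p s(1) t I x] s by simp
  have "\<exists>i\<in>I. x i \<noteq> 0"
  proof (rule ccontr)
    assume "\<not> ?thesis"
    then have "rho p I x 0 = 0" using p by (simp add: rho_0)
    then show False using True \<tau> by simp
  qed
  then obtain i where i: "i \<in> I" "x i \<noteq> 0" by blast
  show ?thesis
  proof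
    assume "x \<in> pbody p I t \<tau>"
    then have d: "delta p I x s \<le> t\<^sup>2" by (simp add: iff)
    show "near p I t \<tau> x"
      unfolding near_def
    proof (intro allI impI)
      fix q :: rat assume q: "0 < q" "\<tau> < rho p I x (of_rat q)"
      have "(of_rat q :: real) \<le> s"
      proof (rule ccontr)
        assume "\<not> ?thesis"
        then have "rho p I x (of_rat q) \<le> rho p I x s" using s by (intro rho_antimono p) auto
        then show False using q s by simp
      qed
      then have "delta p I x (of_rat q) \<le> delta p I x s" using q by (intro delta_mono p) auto
      then show "delta p I x (of_rat q) \<le> t\<^sup>2" using d by simp
    qed
  next
    assume near: "near p I t \<tau> x"
    have "delta p I x s \<le> t\<^sup>2"
    proof (rule ccontr)
      assume "\<not> ?thesis"
      then have gt: "t\<^sup>2 < delta p I x s" by simp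
      have "isCont (delta p I x) s"
        using continuous_on_interior[OF continuous_on_delta[OF p], of s] s by simp
      then have "(delta p I x \<longlongrightarrow> delta p I x s) (at_left s)"
        unfolding isCont_def by (rule filterlim_mono) (auto simp: at_within_le_at)
      then have "eventually (\<lambda>r. t\<^sup>2 < delta p I x r) (at_left s)"
        using gt by (rule order_tendstoD)
      then obtain b where b: "b < s" "\<And>r. b < r \<Longrightarrow> r < s \<Longrightarrow> t\<^sup>2 < delta p I x r"
        unfolding eventually_at_left_field by blast
      obtain q :: rat where q: "max b 0 < of_rat q" "of_rat q < s"
        using of_rat_dense[of "max b 0" s] b s by auto
      have "\<tau> < rho p I x (of_rat q)"
        unfolding s(2)[symmetric] using q I i
        by (intro rho_strict_antimono[OF p, where i = i]) auto
      moreover have "0 < q" using q by auto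
      ultimately have "delta p I x (of_rat q) \<le> t\<^sup>2" using near by (simp add: near_def)
      moreover have "t\<^sup>2 < delta p I x (of_rat q)" using b(2)[of "of_rat q"] q by simp
      ultimately show False by simp
    qed
    then show "x \<in> pbody p I t \<tau>" by (simp add: iff)
  qed
qed

section \<open>Joint measurability in the point and the level\<close>

lemma measurable_rho:
  assumes p: "p > 1" and [measurable]: "f \<in> borel_measurable M" "g \<in> M \<rightarrow>\<^sub>M PiM I (\<lambda>_. lborel)"
  shows "(\<lambda>w. rho p I (g w) (f w)) \<in> borel_measurable M"
    "(\<lambda>w. delta p I (g w) (f w)) \<in> borel_measurable M"
proof -
  note measurable_psi2[OF p, measurable]
  have [measurable]: "(\<lambda>w. g w i) \<in> borel_measurable M" if "i \<in> I" for i
    using measurable_compose[OF assms(3) measurable_component_singleton[OF that]] by simp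
  show "(\<lambda>w. rho p I (g w) (f w)) \<in> borel_measurable M"
    unfolding rho_def by measurable
  show "(\<lambda>w. delta p I (g w) (f w)) \<in> borel_measurable M"
    unfolding delta_def by measurable
qed

lemma measurable_near:
  assumes p: "p > 1" and [measurable]: "f \<in> borel_measurable M" "g \<in> M \<rightarrow>\<^sub>M PiM I (\<lambda>_. lborel)"
  shows "Measurable.pred M (\<lambda>w. near p I t (f w) (g w))"
proof -
  note measurable_rho[OF p, measurable]
  show ?thesis unfolding near_def by measurable
qed

section \<open>Disintegration of the volume of the shell\<close>

lemma sigma_finite_PiM_lborel: "finite I \<Longrightarrow> sigma_finite_measure (PiM I (\<lambda>_. lborel :: real measure))"
proof -
  assume I: "finite I"
  interpret product_sigma_finite "\<lambda>_. lborel :: real measure" by standard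
  show ?thesis by (rule sigma_finite[OF I])
qed

lemma sets_pbody:
  assumes p: "p > 1" and t: "t \<ge> 0" and I: "finite I" and \<tau>: "\<tau> > 0"
  shows "pbody p I t \<tau> \<in> sets (PiM I (\<lambda>_. lborel))"
proof -
  have sub: "pbody p I t \<tau> \<subseteq> I \<rightarrow>\<^sub>E UNIV" unfolding pbody_def by auto
  have "pbody p I t \<tau> = {x \<in> space (PiM I (\<lambda>_. lborel)). near p I t \<tau> x}"
    using mem_pbody_iff_near[OF p t I _ \<tau>] sub by (auto simp: space_PiM)
  also have "\<dots> \<in> sets (PiM I (\<lambda>_. lborel))"
    by (intro predE measurable_near[OF p]) auto
  finally show ?thesis .
qed

lemma sets_pball [measurable]: "pball p I \<tau> \<in> sets (PiM I (\<lambda>_. lborel))"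
proof -
  have "pball p I \<tau> = {x \<in> space (PiM I (\<lambda>_. lborel)). (\<Sum>i\<in>I. \<bar>x i\<bar> powr p) \<le> \<tau>}"
    by (auto simp: pball_def space_PiM)
  also have "\<dots> \<in> sets (PiM I (\<lambda>_. lborel))" by measurable
  finally show ?thesis .
qed

text \<open>Tonelli is used three times: the level at a fixed outer point is traded for s, and then
  at fixed s the outer point for its foot u, whose constraints are explicit. Removing the ball from
  its parallel body confines the levels to those below the level of x, which is the range of
  \<open>rho\<close> over s > 0.\<close>

lemma nn_integral_emeasure_pbody:
  assumes p: "p > 1" and t: "t \<ge> 0" and I: "finite I" and T: "T > 0"
  shows "(\<integral>\<^sup>+\<tau>\<in>{0<..T}. emeasure (PiM I (\<lambda>_. lborel)) (pbody p I t \<tau> - pball p I \<tau>) \<partial>lborel) =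
    (\<integral>\<^sup>+u. indicator {u. (\<Sum>i\<in>I. \<bar>u i\<bar> powr p) \<le> T} u *
      (\<integral>\<^sup>+s\<in>{0<..}. ennreal (\<Sum>i\<in>I. p * \<bar>u i\<bar> powr (2 * p - 2) * (\<Prod>k\<in>I - {i}. dphi p s (u k))) *
        indicator {s. s\<^sup>2 * (\<Sum>i\<in>I. \<bar>u i\<bar> powr (2 * p - 2)) \<le> t\<^sup>2} s \<partial>lborel) \<partial>PiM I (\<lambda>_. lborel))"
proof -
  let ?P = "PiM I (\<lambda>_. lborel :: real measure)"
  interpret P: sigma_finite_measure ?P by (rule sigma_finite_PiM_lborel[OF I])
  interpret pair_sigma_finite ?P "lborel :: real measure" ..
  note measurable_psi2[OF p, measurable] measurable_rho[OF p, measurable]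
    measurable_near[OF p, measurable]
  have m_drho [measurable]: "(\<lambda>w. \<Sum>i\<in>I. drho p (f w) (psi p (f w) (g w i))) \<in> borel_measurable M"
    if [measurable]: "f \<in> borel_measurable M" "g \<in> M \<rightarrow>\<^sub>M ?P" for f g and M :: "'m measure"
  proof -
    have [measurable]: "(\<lambda>w. g w i) \<in> borel_measurable M" if "i \<in> I" for i
      using measurable_compose[OF \<open>g \<in> M \<rightarrow>\<^sub>M ?P\<close> measurable_component_singleton[OF that]] by simp
    show ?thesis unfolding drho_def dphi_def by measurable
  qed
  \<comment> \<open>The integrand in the variables (outer point, s); \<open>?U\<close> is the same
    in the variables (foot, s).\<close>
  let ?X = "\<lambda>x s. indicator {0<..} s * (ennreal (\<Sum>i\<in>I. drho p s (psi p s (x i)))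
      * (indicator {..T} (rho p I x s) * indicator {..t\<^sup>2} (delta p I x s))) :: ennreal"
  let ?U = "\<lambda>u s. indicator {u. (\<Sum>i\<in>I. \<bar>u i\<bar> powr p) \<le> T} u * (ennreal (\<Sum>i\<in>I. p * \<bar>u i\<bar> powr (2 * p - 2) * (\<Prod>k\<in>I - {i}. dphi p s (u k)))
      * indicator {s. s\<^sup>2 * (\<Sum>i\<in>I. \<bar>u i\<bar> powr (2 * p - 2)) \<le> t\<^sup>2} s * indicator {0<..} s) :: ennreal"
  \<comment> \<open>\<open>near\<close> stands in for membership in the parallel body, which makes
    the integrand jointly measurable in x and \<tau>.\<close>
  define G where "G = (\<lambda>x \<tau>. indicator {\<tau>. \<tau> \<le> T \<and> near p I t \<tau> x} \<tau> :: ennreal)"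
  have mG [measurable]: "(\<lambda>w. G (f w) (g w)) \<in> borel_measurable M"
    if [measurable]: "f \<in> M \<rightarrow>\<^sub>M ?P" "g \<in> borel_measurable M" for f g and M :: "'m measure"
    unfolding G_def indicator_def by measurable
  have mG1 [measurable]: "G x \<in> borel_measurable borel" if "x \<in> space ?P" for x
    unfolding G_def indicator_def using that by measurable
  have "(\<integral>\<^sup>+\<tau>\<in>{0<..T}. emeasure ?P (pbody p I t \<tau> - pball p I \<tau>) \<partial>lborel) =
    (\<integral>\<^sup>+\<tau>. (\<integral>\<^sup>+x. indicator {0<..<rho p I x 0} \<tau> * G x \<tau> \<partial>?P) \<partial>lborel)"
  proof (rule nn_integral_cong)
    fix \<tau> :: real
    show "emeasure ?P (pbody p I t \<tau> - pball p I \<tau>) * indicator {0<..T} \<tau> =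
      (\<integral>\<^sup>+x. indicator {0<..<rho p I x 0} \<tau> * G x \<tau> \<partial>?P)"
    proof (cases "0 < \<tau> \<and> \<tau> \<le> T")
      case True
      then have *: "pbody p I t \<tau> - pball p I \<tau> \<in> sets ?P" by (intro sets.Diff sets_pbody p t I sets_pball) auto
      have "emeasure ?P (pbody p I t \<tau> - pball p I \<tau>) = (\<integral>\<^sup>+x. indicator (pbody p I t \<tau> - pball p I \<tau>) x \<partial>?P)"
        using * by simp
      also have "\<dots> = (\<integral>\<^sup>+x. indicator {0<..<rho p I x 0} \<tau> * G x \<tau> \<partial>?P)"
      proof (rule nn_integral_cong)
        fix x assume "x \<in> space ?P"
        then have x: "x \<in> I \<rightarrow>\<^sub>E UNIV" by (simp add: space_PiM)
        have "x \<in> pball p I \<tau> \<longleftrightarrow> \<not> \<tau> < rho p I x 0"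
          using x p by (auto simp: pball_def rho_0)
        then show "indicator (pbody p I t \<tau> - pball p I \<tau>) x = indicator {0<..<rho p I x 0} \<tau> * G x \<tau>"
          using mem_pbody_iff_near[OF p t I x, of \<tau>] True by (auto simp: G_def indicator_def)
      qed
      finally show ?thesis using True by simp
    next
      case False
      then have "indicator {0<..<rho p I x 0} \<tau> * G x \<tau> = 0" for x
        by (auto simp: G_def indicator_def)
      then have "(\<integral>\<^sup>+x. indicator {0<..<rho p I x 0} \<tau> * G x \<tau> \<partial>?P) = 0" by (simp only: nn_integral_0_iff_AE) simp
      moreover have "indicator {0<..T} \<tau> = (0::ennreal)" using False by (auto simp: indicator_def)
      ultimately show ?thesis by simp
    qed
  qed
  also have "\<dots> = (\<integral>\<^sup>+x. (\<integral>\<^sup>+\<tau>. indicator {0<..<rho p I x 0} \<tau> * G x \<tau> \<partial>lborel) \<partial>?P)"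
  proof (rule Fubini'[of "\<lambda>x \<tau>. indicator {0<..<rho p I x 0} \<tau> * G x \<tau>"])
    have "(\<lambda>w. indicator {0<..<rho p I (fst w) 0} (snd w) * G (fst w) (snd w) :: ennreal)
        \<in> borel_measurable (?P \<Otimes>\<^sub>M lborel)"
      unfolding indicator_def greaterThanLessThan_iff by measurable
    then show "(\<lambda>(x, \<tau>). indicator {0<..<rho p I x 0} \<tau> * G x \<tau>) \<in> borel_measurable (?P \<Otimes>\<^sub>M lborel)"
      by (simp add: split_beta')
  qed
  also have "\<dots> = (\<integral>\<^sup>+x. (\<integral>\<^sup>+s. ?X x s \<partial>lborel) \<partial>?P)"
  proof (rule nn_integral_cong)
    fix x assume xP: "x \<in> space ?P"
    then have x: "x \<in> I \<rightarrow>\<^sub>E UNIV" by (simp add: space_PiM)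
    have "(\<integral>\<^sup>+\<tau>. indicator {0<..<rho p I x 0} \<tau> * G x \<tau> \<partial>lborel) =
      (\<integral>\<^sup>+s\<in>{0<..}. ennreal (\<Sum>i\<in>I. drho p s (psi p s (x i))) * G x (rho p I x s) \<partial>lborel)"
      using nn_integral_rho_substitution[OF p I mG1[OF xP], of x] by (simp add: mult.commute)
    also have "\<dots> = (\<integral>\<^sup>+s. ?X x s \<partial>lborel)"
    proof (rule nn_integral_cong)
      fix s :: real
      show "ennreal (\<Sum>i\<in>I. drho p s (psi p s (x i))) * G x (rho p I x s) * indicator {0<..} s =
        ?X x s"
      proof (cases "s > 0")
        case True
        show ?thesis
        proof (cases "rho p I x s > 0")
          case pos: True
          have "near p I t (rho p I x s) x \<longleftrightarrow> delta p I x s \<le> t\<^sup>2"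
            using mem_pbody_iff_near[OF p t I x pos] mem_pbody_iff_delta[OF p True t I x] by simp
          then show ?thesis by (auto simp: G_def indicator_def)
        next
          \<comment> \<open>\<open>mem_pbody_iff_near\<close> assumes a positive level. At level 0
            all coordinates of the foot vanish, and the density with them.\<close>
          case False
          then have "(\<Sum>i\<in>I. \<bar>psi p s (x i)\<bar> powr p) = 0"
            using rho_nonneg[of p I x s] by (simp add: rho_def)
          then have "\<forall>i\<in>I. psi p s (x i) = 0"
            using I by (subst (asm) sum_nonneg_eq_0_iff) auto
          then have "(\<Sum>i\<in>I. drho p s (psi p s (x i))) = 0"
            by (simp add: drho_def)
          then show ?thesis by simp
        qed
      qed simp
    qed
    finally show "(\<integral>\<^sup>+\<tau>. indicator {0<..<rho p I x 0} \<tau> * G x \<tau> \<partial>lborel) =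
      (\<integral>\<^sup>+s. ?X x s \<partial>lborel)" .
  qed
  also have "\<dots> = (\<integral>\<^sup>+s. (\<integral>\<^sup>+x. ?X x s \<partial>?P) \<partial>lborel)"
  proof (rule Fubini'[symmetric])
    have "(\<lambda>w. indicator {0<..} (snd w) * (ennreal (\<Sum>i\<in>I. drho p (snd w) (psi p (snd w) (fst w i))) *
      (indicator {..T} (rho p I (fst w) (snd w)) * indicator {..t\<^sup>2} (delta p I (fst w) (snd w))))
      :: ennreal) \<in> borel_measurable (?P \<Otimes>\<^sub>M lborel)"
      by measurable
    then show "(\<lambda>(x, s). ?X x s :: ennreal)
      \<in> borel_measurable (?P \<Otimes>\<^sub>M lborel)"
      by (simp add: split_beta')
  qed
  also have "\<dots> = (\<integral>\<^sup>+s. (\<integral>\<^sup>+u. ?U u s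
      \<partial>?P) \<partial>lborel)"
  proof (rule nn_integral_cong)
    fix s :: real
    have [measurable]: "(\<lambda>u. \<lambda>i\<in>I. phi p s (u i)) \<in> ?P \<rightarrow>\<^sub>M ?P" by measurable
    show "(\<integral>\<^sup>+x. ?X x s \<partial>?P) =
      (\<integral>\<^sup>+u. ?U u s
      \<partial>?P)" (is "(\<integral>\<^sup>+x. ?F x \<partial>?P) = _")
    proof -
      have "(\<integral>\<^sup>+x. ?F x \<partial>?P) = (\<integral>\<^sup>+u. (\<Prod>i\<in>I. ennreal (dphi p s (u i))) * ?F (\<lambda>i\<in>I. phi p s (u i)) \<partial>?P)"
        by (rule nn_integral_PiM_componentwise_substitution)
          (auto intro!: nn_integral_phi_substitution p I)
      also have "\<dots> = (\<integral>\<^sup>+u. ?U u s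
        \<partial>?P)"
      proof (rule nn_integral_cong)
        fix u :: "nat \<Rightarrow> real"
        let ?x = "\<lambda>i\<in>I. phi p s (u i)"
        have psi_x: "psi p s (?x i) = u i" if "i \<in> I" for i using that p by simp
        have 1: "rho p I ?x s = (\<Sum>i\<in>I. \<bar>u i\<bar> powr p)"
          unfolding rho_def using psi_x by (intro sum.cong) auto
        have 2: "delta p I ?x s = s\<^sup>2 * (\<Sum>i\<in>I. \<bar>u i\<bar> powr (2 * p - 2))"
          unfolding delta_eq[OF p] using psi_x by (intro arg_cong[of _ _ "(*) (s\<^sup>2)"] sum.cong) auto
        have 3: "(\<Sum>i\<in>I. drho p s (psi p s (?x i))) = (\<Sum>i\<in>I. drho p s (u i))"
          using psi_x by (intro sum.cong) auto
        have "(\<Prod>i\<in>I. ennreal (dphi p s (u i))) = ennreal (\<Prod>i\<in>I. dphi p s (u i))"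
          using dphi_pos[OF p] by (intro prod_ennreal) (auto intro: less_imp_le)
        then have "(\<Prod>i\<in>I. ennreal (dphi p s (u i))) * ennreal (\<Sum>i\<in>I. drho p s (u i)) =
            ennreal ((\<Prod>i\<in>I. dphi p s (u i)) * (\<Sum>i\<in>I. drho p s (u i)))"
          by (simp add: ennreal_mult' prod_nonneg less_imp_le[OF dphi_pos[OF p]] sum_nonneg drho_nonneg[OF p])
        \<comment> \<open>The i-th term of the sum carries the Jacobian factor of coordinate i as
          its denominator, so the product over the other coordinates remains.\<close>
        also have "(\<Prod>i\<in>I. dphi p s (u i)) * (\<Sum>i\<in>I. drho p s (u i)) =
            (\<Sum>i\<in>I. p * \<bar>u i\<bar> powr (2 * p - 2) * (\<Prod>k\<in>I - {i}. dphi p s (u k)))"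
          unfolding sum_distrib_left
        proof (rule sum.cong)
          fix i assume "i \<in> I"
          then have "(\<Prod>i\<in>I. dphi p s (u i)) = dphi p s (u i) * (\<Prod>k\<in>I - {i}. dphi p s (u k))"
            using I by (rule prod.remove[rotated])
          then show "(\<Prod>i\<in>I. dphi p s (u i)) * drho p s (u i) =
              p * \<bar>u i\<bar> powr (2 * p - 2) * (\<Prod>k\<in>I - {i}. dphi p s (u k))"
            using dphi_pos[OF p, of s "u i"] by (simp add: drho_def)
        qed simp
        finally have 4: "(\<Prod>i\<in>I. ennreal (dphi p s (u i))) * ennreal (\<Sum>i\<in>I. drho p s (u i)) =
          ennreal (\<Sum>i\<in>I. p * \<bar>u i\<bar> powr (2 * p - 2) * (\<Prod>k\<in>I - {i}. dphi p s (u k)))" .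
        show "(\<Prod>i\<in>I. ennreal (dphi p s (u i))) * ?F ?x =
          ?U u s"
          unfolding 1 2 3 4[symmetric] by (auto simp: indicator_def)
      qed
      finally show ?thesis .
    qed
  qed
  also have "\<dots> = (\<integral>\<^sup>+u. (\<integral>\<^sup>+s. ?U u s
      \<partial>lborel) \<partial>?P)"
  proof (rule Fubini')
    have "(\<lambda>w. indicator {..T} (\<Sum>i\<in>I. \<bar>fst w i\<bar> powr p) * (
      ennreal (\<Sum>i\<in>I. p * \<bar>fst w i\<bar> powr (2 * p - 2) * (\<Prod>k\<in>I - {i}. dphi p (snd w) (fst w k))) *
        indicator {..t\<^sup>2} ((snd w)\<^sup>2 * (\<Sum>i\<in>I. \<bar>fst w i\<bar> powr (2 * p - 2))) * indicator {0<..} (snd w))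
      :: ennreal) \<in> borel_measurable (?P \<Otimes>\<^sub>M lborel)"
      unfolding dphi_def by measurable
    also have "(\<lambda>w. indicator {..T} (\<Sum>i\<in>I. \<bar>fst w i\<bar> powr p) * (
      ennreal (\<Sum>i\<in>I. p * \<bar>fst w i\<bar> powr (2 * p - 2) * (\<Prod>k\<in>I - {i}. dphi p (snd w) (fst w k))) *
        indicator {..t\<^sup>2} ((snd w)\<^sup>2 * (\<Sum>i\<in>I. \<bar>fst w i\<bar> powr (2 * p - 2))) * indicator {0<..} (snd w))
      :: ennreal) = (\<lambda>(u, s). ?U u s)"
      by (rule ext) (simp add: split_beta' indicator_def)
    finally show "(\<lambda>(u, s). ?U u s :: ennreal)
      \<in> borel_measurable (?P \<Otimes>\<^sub>M lborel)" .
  qed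
  also have "\<dots> = (\<integral>\<^sup>+u. indicator {u. (\<Sum>i\<in>I. \<bar>u i\<bar> powr p) \<le> T} u *
      (\<integral>\<^sup>+s\<in>{0<..}. ennreal (\<Sum>i\<in>I. p * \<bar>u i\<bar> powr (2 * p - 2) * (\<Prod>k\<in>I - {i}. dphi p s (u k))) *
        indicator {s. s\<^sup>2 * (\<Sum>i\<in>I. \<bar>u i\<bar> powr (2 * p - 2)) \<le> t\<^sup>2} s \<partial>lborel) \<partial>?P)"
    by (intro nn_integral_cong) (auto simp: indicator_def)
  finally show ?thesis .
qed

section \<open>Moment integrals\<close>

lemma nn_integral_abs_real:
  fixes f :: "real \<Rightarrow> ennreal"
  assumes [measurable]: "f \<in> borel_measurable borel"
  shows "(\<integral>\<^sup>+x. f \<bar>x\<bar> \<partial>lborel) = 2 * (\<integral>\<^sup>+x\<in>{0<..}. f x \<partial>lborel)"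
proof -
  have "(\<integral>\<^sup>+x. f \<bar>x\<bar> \<partial>lborel) =
      (\<integral>\<^sup>+x. f x * indicator {0<..} x + f (- x) * indicator {0<..} (- x) \<partial>lborel)"
    using AE_lborel_singleton[of "0::real"]
    by (intro nn_integral_cong_AE) (auto elim!: eventually_mono simp: indicator_def)
  also have "\<dots> = (\<integral>\<^sup>+x\<in>{0<..}. f x \<partial>lborel) + (\<integral>\<^sup>+x. f (- x) * indicator {0<..} (- x) \<partial>lborel)"
    by (rule nn_integral_add) measurable
  also have "(\<integral>\<^sup>+x. f (- x) * indicator {0<..} (- x) \<partial>lborel) = (\<integral>\<^sup>+x\<in>{0<..}. f x \<partial>lborel)"
    by (subst (2) nn_integral_real_affine[where c = "-1" and t = 0]) auto
  finally show ?thesis by (simp add: mult_2)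
qed

lemma nn_integral_powr_substitution:
  fixes c :: real and f :: "real \<Rightarrow> ennreal"
  assumes c: "c \<noteq> 0" and [measurable]: "f \<in> borel_measurable borel"
  shows "(\<integral>\<^sup>+x\<in>{0<..}. f x \<partial>lborel) =
    (\<integral>\<^sup>+y\<in>{0<..}. ennreal (\<bar>c\<bar> * y powr (c - 1)) * f (y powr c) \<partial>lborel)"
proof -
  have img: "(\<lambda>y. y powr c) ` {0<..} = {0::real<..}"
  proof (intro equalityI subsetI)
    fix x :: real assume x: "x \<in> {0<..}"
    then have "x = (x powr (1 / c)) powr c" "x powr (1 / c) \<in> {0<..}" using c by (simp_all add: powr_powr)
    then show "x \<in> (\<lambda>y. y powr c) ` {0<..}" by (rule image_eqI)
  qed auto
  have inj: "inj_on (\<lambda>y. y powr c) {0::real<..}"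
  proof (rule inj_onI)
    fix x y :: real assume "x \<in> {0<..}" "y \<in> {0<..}" "x powr c = y powr c"
    then have "(x powr c) powr (1 / c) = (y powr c) powr (1 / c)" "x > 0" "y > 0" by auto
    then show "x = y" using c by (simp add: powr_powr)
  qed
  have "(\<integral>\<^sup>+x\<in>(\<lambda>y. y powr c) ` {0<..}. f x \<partial>lborel) =
      (\<integral>\<^sup>+y\<in>{0<..}. ennreal \<bar>c * y powr (c - 1)\<bar> * f (y powr c) \<partial>lborel)"
  proof (rule nn_integral_change_of_variables_real)
    fix x :: real assume "x \<in> {0<..}"
    then show "((\<lambda>y. y powr c) has_real_derivative c * x powr (c - 1)) (at x)"
      by (auto intro!: derivative_eq_intros)
  qed (use inj in \<open>auto simp: img\<close>)
  then show ?thesis by (simp add: img abs_mult)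
qed

section \<open>Gamma integrals and the moments\<close>

lemma nn_integral_Gamma:
  fixes a q :: real
  assumes a: "a > 0" and q: "q > 0"
  shows "(\<integral>\<^sup>+x\<in>{0<..}. ennreal (x powr (a - 1) * exp (- q * x)) \<partial>lborel) = ennreal (Gamma a * q powr (- a))"
proof -
  have "ennreal (Gamma a) = (\<integral>\<^sup>+x\<in>{0<..}. ennreal (x powr (a - 1) * exp (- x)) \<partial>lborel)"
    unfolding Gamma_conv_nn_integral_real[OF a]
    by (intro nn_integral_cong_AE eventually_mono[OF AE_lborel_singleton[of 0]])
      (auto simp: indicator_def exp_minus field_simps)
  also have "\<dots> = ennreal \<bar>q\<bar> * (\<integral>\<^sup>+x. ennreal ((0 + q * x) powr (a - 1) * exp (- (0 + q * x))) *
      indicator {0<..} (0 + q * x) \<partial>lborel)"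
    using q by (intro nn_integral_real_affine) auto
  also have "(\<integral>\<^sup>+x. ennreal ((0 + q * x) powr (a - 1) * exp (- (0 + q * x))) *
      indicator {0<..} (0 + q * x) \<partial>lborel) =
      (\<integral>\<^sup>+x. ennreal (q powr (a - 1)) * (ennreal (x powr (a - 1) * exp (- q * x)) * indicator {0<..} x) \<partial>lborel)"
    using q by (intro nn_integral_cong)
      (auto simp: indicator_def powr_mult zero_less_mult_iff ennreal_mult'[symmetric] mult_ac)
  also have "\<dots> = ennreal (q powr (a - 1)) *
      (\<integral>\<^sup>+x\<in>{0<..}. ennreal (x powr (a - 1) * exp (- q * x)) \<partial>lborel)"
    by (rule nn_integral_cmult) measurable
  finally have *: "ennreal (Gamma a) = ennreal (q powr a) *
      (\<integral>\<^sup>+x\<in>{0<..}. ennreal (x powr (a - 1) * exp (- q * x)) \<partial>lborel)"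
    using q by (simp add: mult.assoc[symmetric] ennreal_mult'[symmetric] powr_mult_base)
  have "ennreal (Gamma a * q powr (- a)) = ennreal (q powr (- a)) * ennreal (Gamma a)"
    using Gamma_real_pos[OF a] by (simp add: ennreal_mult mult.commute)
  also have "\<dots> = (ennreal (q powr (- a)) * ennreal (q powr a)) *
      (\<integral>\<^sup>+x\<in>{0<..}. ennreal (x powr (a - 1) * exp (- q * x)) \<partial>lborel)"
    unfolding * by (simp only: mult.assoc)
  also have "ennreal (q powr (- a)) * ennreal (q powr a) = 1"
    using q by (simp add: ennreal_mult'[symmetric] powr_add[symmetric])
  finally show ?thesis by simp
qed

text \<open>I, J and K are \<open>mom p (2 * p - 2) r\<close> for r = 0, p - 2 and 2p - 2. The two
  exponents are parameters because the left edge needs the same integrals with their roles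
  exchanged.\<close>

definition mom :: "real \<Rightarrow> real \<Rightarrow> real \<Rightarrow> real \<Rightarrow> real" where
  "mom P Q r \<theta> = (\<integral>x. \<bar>x\<bar> powr r * exp (- (\<bar>x\<bar> powr P) - \<theta> * \<bar>x\<bar> powr Q) \<partial>lborel)"

lemma nn_integral_mom_0:
  fixes P r :: real
  assumes P: "P > 0" and r: "r > -1"
  shows "(\<integral>\<^sup>+x. ennreal (\<bar>x\<bar> powr r * exp (- (\<bar>x\<bar> powr P))) \<partial>lborel) = ennreal (2 / P * Gamma ((r + 1) / P))"
proof -
  have "(\<integral>\<^sup>+x. ennreal (\<bar>x\<bar> powr r * exp (- (\<bar>x\<bar> powr P))) \<partial>lborel) =
      2 * (\<integral>\<^sup>+x\<in>{0<..}. ennreal (x powr r * exp (- (x powr P))) \<partial>lborel)"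
    by (rule nn_integral_abs_real) measurable
  also have "(\<integral>\<^sup>+x\<in>{0<..}. ennreal (x powr r * exp (- (x powr P))) \<partial>lborel) =
    (\<integral>\<^sup>+y\<in>{0<..}. ennreal (\<bar>1 / P\<bar> * y powr (1 / P - 1)) *
      ennreal ((y powr (1 / P)) powr r * exp (- ((y powr (1 / P)) powr P))) \<partial>lborel)"
    using P by (intro nn_integral_powr_substitution) auto
  also have "\<dots> = (\<integral>\<^sup>+y. ennreal (1 / P) *
      (ennreal (y powr ((r + 1) / P - 1) * exp (- 1 * y)) * indicator {0<..} y) \<partial>lborel)"
    using P
    by (intro nn_integral_cong)
      (auto simp: indicator_def ennreal_mult'[symmetric] powr_powr powr_add[symmetric] field_simps)
  also have "\<dots> = ennreal (1 / P) * (\<integral>\<^sup>+y\<in>{0<..}. ennreal (y powr ((r + 1) / P - 1) * exp (- 1 * y)) \<partial>lborel)"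
    by (rule nn_integral_cmult) measurable
  also have "\<dots> = ennreal (1 / P) * ennreal (Gamma ((r + 1) / P))"
    using P r by (subst nn_integral_Gamma) auto
  finally show ?thesis
    using P by (simp add: ennreal_mult'[symmetric] flip: ennreal_numeral)
qed

lemma integrable_mom:
  fixes P Q r \<theta> :: real
  assumes P: "P > 0" and r: "r > -1" and \<theta>: "\<theta> \<ge> 0"
  shows "integrable lborel (\<lambda>x. \<bar>x\<bar> powr r * exp (- (\<bar>x\<bar> powr P) - \<theta> * \<bar>x\<bar> powr Q))"
proof (rule Bochner_Integration.integrable_bound)
  show "integrable lborel (\<lambda>x. \<bar>x\<bar> powr r * exp (- (\<bar>x\<bar> powr P)))"
    by (rule integrableI_nonneg) (auto simp: nn_integral_mom_0[OF P r])
qed (use \<theta> in \<open>auto intro!: mult_left_mono\<close>)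

lemma nn_integral_mom:
  fixes P Q r \<theta> :: real
  assumes "P > 0" "r > -1" "\<theta> \<ge> 0"
  shows "(\<integral>\<^sup>+x. ennreal (\<bar>x\<bar> powr r * exp (- (\<bar>x\<bar> powr P) - \<theta> * \<bar>x\<bar> powr Q)) \<partial>lborel) = ennreal (mom P Q r \<theta>)"
  unfolding mom_def by (rule nn_integral_eq_integral[OF integrable_mom[OF assms]]) auto

lemma mom_0:
  fixes P r :: real
  assumes P: "P > 0" and r: "r > -1"
  shows "mom P Q r 0 = 2 / P * Gamma ((r + 1) / P)"
proof -
  have "ennreal (mom P Q r 0) = ennreal (2 / P * Gamma ((r + 1) / P))"
    using nn_integral_mom[OF P r, of 0 Q] nn_integral_mom_0[OF P r] by simp
  moreover have "mom P Q r 0 \<ge> 0" unfolding mom_def by (rule integral_nonneg_AE) auto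
  moreover have "Gamma ((r + 1) / P) > 0" using P r by (intro Gamma_real_pos) auto
  ultimately show ?thesis using P by (subst (asm) ennreal_inj) auto
qed

lemma mom_pos:
  fixes P Q r \<theta> :: real
  assumes "P > 0" "r > -1" "\<theta> \<ge> 0"
  shows "mom P Q r \<theta> > 0"
proof -
  let ?f = "\<lambda>x. \<bar>x\<bar> powr r * exp (- (\<bar>x\<bar> powr P) - \<theta> * \<bar>x\<bar> powr Q)"
  have "0 \<le> mom P Q r \<theta>" unfolding mom_def by (rule integral_nonneg_AE) auto
  moreover have "mom P Q r \<theta> \<noteq> 0"
  proof
    assume "mom P Q r \<theta> = 0"
    then have "AE x in lborel. ?f x = 0"
      unfolding mom_def by (subst (asm) integral_nonneg_eq_0_iff_AE[OF integrable_mom[OF assms]]) auto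
    then have "AE x in lborel. x = (0::real)" by (auto elim!: eventually_mono)
    with AE_lborel_singleton[of "0::real"] have "AE x in (lborel :: real measure). False"
      by eventually_elim simp
    then show False by (simp add: eventually_False ae_filter_eq_bot_iff)
  qed
  ultimately show ?thesis by simp
qed

lemma mom_antimono:
  fixes P Q r \<theta> :: real
  assumes "P > 0" "r > -1" "0 \<le> \<theta>" "\<theta> \<le> \<theta>'"
  shows "mom P Q r \<theta>' \<le> mom P Q r \<theta>"
  unfolding mom_def using assms
  by (intro integral_mono integrable_mom mult_left_mono) (auto intro!: mult_right_mono)

text \<open>The substitution x -> \<theta>^(-1/Q) x moves the parameter from |x|^Q to |x|^P, where
  it becomes \<theta>^(-P/Q): large \<theta> turns into a small parameter.\<close>

lemma mom_scaling:
  fixes P Q r \<theta> :: real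
  assumes P: "P > 0" and Q: "Q > 0" and r: "r > -1" and \<theta>: "\<theta> > 0"
  shows "mom P Q r \<theta> = \<theta> powr (- (r + 1) / Q) * mom Q P r (\<theta> powr (- P / Q))"
proof -
  define e where "e = - 1 / Q"
  have e: "e * Q = - 1" "e * P = - P / Q" "e + e * r = - (r + 1) / Q"
    using Q by (simp_all add: e_def field_simps)
  define c where "c = \<theta> powr e"
  have c: "c > 0" using \<theta> by (simp add: c_def)
  have cQ: "\<theta> * c powr Q = 1" "c powr P = \<theta> powr (- P / Q)" "c * c powr r = \<theta> powr (- (r + 1) / Q)"
    using \<theta> unfolding c_def powr_powr powr_add[symmetric] e by (simp_all add: powr_minus)
  have "mom P Q r \<theta> = \<bar>c\<bar> *\<^sub>R (\<integral>x. \<bar>0 + c * x\<bar> powr r *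
      exp (- (\<bar>0 + c * x\<bar> powr P) - \<theta> * \<bar>0 + c * x\<bar> powr Q) \<partial>lborel)"
    unfolding mom_def using c by (intro lborel_integral_real_affine) auto
  also have "(\<integral>x. \<bar>0 + c * x\<bar> powr r * exp (- (\<bar>0 + c * x\<bar> powr P) - \<theta> * \<bar>0 + c * x\<bar> powr Q) \<partial>lborel) =
      (\<integral>x. c powr r * (\<bar>x\<bar> powr r * exp (- (\<bar>x\<bar> powr Q) - c powr P * \<bar>x\<bar> powr P)) \<partial>lborel)"
  proof (rule Bochner_Integration.integral_cong)
    fix x :: real
    have "\<theta> * (c powr Q * \<bar>x\<bar> powr Q) = \<bar>x\<bar> powr Q" using cQ(1) by (simp add: mult.assoc[symmetric])
    then show "\<bar>0 + c * x\<bar> powr r * exp (- (\<bar>0 + c * x\<bar> powr P) - \<theta> * \<bar>0 + c * x\<bar> powr Q) =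
      c powr r * (\<bar>x\<bar> powr r * exp (- (\<bar>x\<bar> powr Q) - c powr P * \<bar>x\<bar> powr P))"
      using c by (simp add: abs_mult powr_mult mult_ac)
  qed simp
  also have "\<bar>c\<bar> *\<^sub>R \<dots> = (c * c powr r) * mom Q P r (c powr P)"
    using c by (simp add: mom_def)
  finally show ?thesis by (simp only: cQ)
qed

lemma abs_exp_minus_diff_le:
  fixes u v :: real assumes "0 \<le> u" "0 \<le> v"
  shows "\<bar>exp (- u) - exp (- v)\<bar> \<le> \<bar>u - v\<bar>"
proof -
  have *: "exp (- u) - exp (- v) \<le> v - u" if "0 \<le> u" "u \<le> v" for u v :: real
  proof -
    have "exp (- u) - exp (- v) = exp (- u) * (1 - exp (- (v - u)))"
      by (simp add: right_diff_distrib exp_add[symmetric])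
    also have "\<dots> \<le> 1 * (v - u)"
    proof (rule mult_mono)
      show "1 - exp (- (v - u)) \<le> v - u"
        using exp_ge_add_one_self[of "u - v"] unfolding minus_diff_eq by linarith
    qed (use that in auto)
    finally show ?thesis by simp
  qed
  show ?thesis using *[of u v] *[of v u] assms by (cases "u \<le> v") (auto simp: abs_if)
qed

text \<open>Dominated convergence of the difference quotients with majorant |x|^(r+Q) exp(-|x|^P).
  At \<theta> = 0, where the edge regimes use it, the derivative is one-sided, since for Q > P the
  integral diverges at negative \<theta>.\<close>

lemma has_field_derivative_mom:
  fixes P Q r \<theta> :: real
  assumes P: "P > 0" and Q: "Q > 0" and r: "r > -1" and \<theta>: "\<theta> \<ge> 0"
  shows "(mom P Q r has_real_derivative - mom P Q (r + Q) \<theta>) (at \<theta> within {0..})"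
  unfolding has_field_derivative_iff tendsto_at_iff_sequentially
proof (intro allI impI)
  fix X assume X: "\<forall>i. X i \<in> {0..} - {\<theta>}" "X \<longlonglongrightarrow> \<theta>"
  let ?f = "\<lambda>\<theta> x::real. \<bar>x\<bar> powr r * exp (- (\<bar>x\<bar> powr P) - \<theta> * \<bar>x\<bar> powr Q)"
  have lim: "(\<lambda>i. \<integral>x. (?f (X i) x - ?f \<theta> x) / (X i - \<theta>) \<partial>lborel) \<longlonglongrightarrow>
      (\<integral>x. - (\<bar>x\<bar> powr (r + Q) * exp (- (\<bar>x\<bar> powr P) - \<theta> * \<bar>x\<bar> powr Q)) \<partial>lborel)"
  proof (rule integral_dominated_convergence)
    show "integrable lborel (\<lambda>x. \<bar>x\<bar> powr (r + Q) * exp (- (\<bar>x\<bar> powr P) - 0 * \<bar>x\<bar> powr Q))"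
      using P Q r by (intro integrable_mom) auto
    show "AE x in lborel. (\<lambda>i. (?f (X i) x - ?f \<theta> x) / (X i - \<theta>)) \<longlonglongrightarrow>
        - (\<bar>x\<bar> powr (r + Q) * exp (- (\<bar>x\<bar> powr P) - \<theta> * \<bar>x\<bar> powr Q))"
    proof (rule AE_I2)
      fix x :: real
      have "((\<lambda>\<theta>. ?f \<theta> x) has_real_derivative
          - (\<bar>x\<bar> powr (r + Q) * exp (- (\<bar>x\<bar> powr P) - \<theta> * \<bar>x\<bar> powr Q))) (at \<theta> within {0..})"
        by (auto intro!: derivative_eq_intros simp: powr_add mult_ac)
      then show "(\<lambda>i. (?f (X i) x - ?f \<theta> x) / (X i - \<theta>)) \<longlonglongrightarrow>
        - (\<bar>x\<bar> powr (r + Q) * exp (- (\<bar>x\<bar> powr P) - \<theta> * \<bar>x\<bar> powr Q))"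
        unfolding has_field_derivative_iff tendsto_at_iff_sequentially o_def using X by blast
    qed
    fix i
    show "AE x in lborel. norm ((?f (X i) x - ?f \<theta> x) / (X i - \<theta>)) \<le>
        \<bar>x\<bar> powr (r + Q) * exp (- (\<bar>x\<bar> powr P) - 0 * \<bar>x\<bar> powr Q)"
    proof (rule AE_I2)
      fix x :: real
      have Xi: "X i \<ge> 0" "X i \<noteq> \<theta>" using X by auto
      define a where "a = \<bar>x\<bar> powr Q"
      have a: "a \<ge> 0" by (simp add: a_def)
      have "\<bar>exp (- (X i * a)) - exp (- (\<theta> * a))\<bar> \<le> \<bar>X i * a - \<theta> * a\<bar>"
        using Xi \<theta> a by (intro abs_exp_minus_diff_le) auto
      also have "\<dots> = a * \<bar>X i - \<theta>\<bar>" using a by (simp add: left_diff_distrib[symmetric] abs_mult)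
      finally have le: "\<bar>exp (- (X i * a)) - exp (- (\<theta> * a))\<bar> / \<bar>X i - \<theta>\<bar> \<le> a"
        using Xi by (simp add: divide_le_eq)
      have "?f (X i) x - ?f \<theta> x = \<bar>x\<bar> powr r * exp (- (\<bar>x\<bar> powr P)) * (exp (- (X i * a)) - exp (- (\<theta> * a)))"
        by (simp add: a_def exp_diff exp_minus field_simps)
      then have "norm ((?f (X i) x - ?f \<theta> x) / (X i - \<theta>)) =
          \<bar>x\<bar> powr r * exp (- (\<bar>x\<bar> powr P)) * (\<bar>exp (- (X i * a)) - exp (- (\<theta> * a))\<bar> / \<bar>X i - \<theta>\<bar>)"
        by (simp add: abs_mult)
      also have "\<dots> \<le> \<bar>x\<bar> powr r * exp (- (\<bar>x\<bar> powr P)) * a"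
        using le by (intro mult_left_mono) auto
      also have "\<dots> = \<bar>x\<bar> powr (r + Q) * exp (- (\<bar>x\<bar> powr P) - 0 * \<bar>x\<bar> powr Q)"
        by (simp add: a_def powr_add)
      finally show "norm ((?f (X i) x - ?f \<theta> x) / (X i - \<theta>)) \<le>
        \<bar>x\<bar> powr (r + Q) * exp (- (\<bar>x\<bar> powr P) - 0 * \<bar>x\<bar> powr Q)" .
    qed
  qed measurable
  have eq: "(\<integral>x. (?f (X i) x - ?f \<theta> x) / (X i - \<theta>) \<partial>lborel) =
      (mom P Q r (X i) - mom P Q r \<theta>) / (X i - \<theta>)" for i
  proof -
    have "X i \<ge> 0" using X by auto
    then show ?thesis
      unfolding mom_def integral_divide_zero
      using \<theta> P r by (subst Bochner_Integration.integral_diff) (auto intro!: integrable_mom)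
  qed
  have "(\<lambda>i. (mom P Q r (X i) - mom P Q r \<theta>) / (X i - \<theta>)) \<longlonglongrightarrow>
      (\<integral>x. - (\<bar>x\<bar> powr (r + Q) * exp (- (\<bar>x\<bar> powr P) - \<theta> * \<bar>x\<bar> powr Q)) \<partial>lborel)"
    using lim unfolding eq .
  then show "((\<lambda>y. (mom P Q r y - mom P Q r \<theta>) / (y - \<theta>)) \<circ> X) \<longlonglongrightarrow> - mom P Q (r + Q) \<theta>"
    unfolding o_def by (simp add: mom_def)
qed

section \<open>Reduction to one-dimensional integrals\<close>

lemma nn_integral_power_truncated:
  fixes t q :: real
  assumes t: "t > 0" and q: "q > 0"
  shows "(\<integral>\<^sup>+s\<in>{0<..}. ennreal (s ^ m) * indicator {s. s\<^sup>2 * q \<le> t\<^sup>2} s \<partial>lborel) =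
    ennreal (t ^ (m + 1) / real (m + 1) * q powr (- (real m + 1) / 2))"
proof -
  define a where "a = t / sqrt q"
  have a: "a > 0" using t q by (simp add: a_def)
  have iff: "s\<^sup>2 * q \<le> t\<^sup>2 \<longleftrightarrow> s \<le> a" if "s > 0" for s
  proof -
    have "s\<^sup>2 * q = (s * sqrt q)\<^sup>2" using q by (simp add: power_mult_distrib)
    then have "s\<^sup>2 * q \<le> t\<^sup>2 \<longleftrightarrow> s * sqrt q \<le> t"
      using that q t by (simp add: power2_le_iff_abs_le abs_mult)
    then show ?thesis using q by (simp add: a_def pos_le_divide_eq)
  qed
  have "(\<integral>\<^sup>+s\<in>{0<..}. ennreal (s ^ m) * indicator {s. s\<^sup>2 * q \<le> t\<^sup>2} s \<partial>lborel) =
      (\<integral>\<^sup>+s. ennreal (s ^ m) * indicator {0..a} s \<partial>lborel)"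
    using AE_lborel_singleton[of "0::real"]
    by (intro nn_integral_cong_AE, eventually_elim) (auto simp: indicator_def iff)
  also have "\<dots> = ennreal (a ^ (m + 1) / real (m + 1) - 0 ^ (m + 1) / real (m + 1))"
  proof (rule nn_integral_FTC_Icc)
    fix x :: real
    show "((\<lambda>x. x ^ (m + 1) / real (m + 1)) has_real_derivative x ^ m) (at x)"
      by (rule derivative_eq_intros refl | simp)+
  qed (use a in auto)
  also have "a ^ (m + 1) = t ^ (m + 1) * q powr (- (real m + 1) / 2)"
  proof -
    have "sqrt q ^ (m + 1) = q powr ((real m + 1) / 2)"
      using q by (simp add: powr_half_sqrt[symmetric] powr_powr powr_realpow[symmetric] add_divide_distrib powr_add del: power_Suc)
    moreover have "- (real m + 1) / 2 = - ((real m + 1) / 2)" by (simp only: minus_divide_left)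
    then have "q powr (- (real m + 1) / 2) = 1 / q powr ((real m + 1) / 2)"
      by (simp only: powr_minus_divide)
    ultimately show ?thesis unfolding a_def power_divide by simp
  qed
  finally show ?thesis by simp
qed

text \<open>The default weight is \<open>1\<close> and not \<open>\<bar>x\<bar> powr 0\<close>, since \<open>0 powr 0 = 0\<close>.\<close>

definition wt :: "real \<Rightarrow> nat \<Rightarrow> nat set \<Rightarrow> nat \<Rightarrow> real \<Rightarrow> real" where
  "wt p i S k x = (if k = i then \<bar>x\<bar> powr (2 * p - 2) else if k \<in> S then \<bar>x\<bar> powr (p - 2) else 1)"

lemma measurable_wt [measurable]: "wt p i S k \<in> borel_measurable borel"
  unfolding wt_def by measurable

lemma wt_nonneg: "0 \<le> wt p i S k x"
  by (simp add: wt_def)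

lemma prod_wt:
  assumes I: "finite I" "i \<in> I" "S \<subseteq> I - {i}"
  shows "(\<Prod>k\<in>I. wt p i S k (u k)) = \<bar>u i\<bar> powr (2 * p - 2) * (\<Prod>k\<in>S. \<bar>u k\<bar> powr (p - 2))"
proof -
  have "(\<Prod>k\<in>I. wt p i S k (u k)) = wt p i S i (u i) * (\<Prod>k\<in>I - {i}. wt p i S k (u k))"
    using I by (intro prod.remove)
  also have "(\<Prod>k\<in>I - {i}. wt p i S k (u k)) = (\<Prod>k\<in>S. wt p i S k (u k))"
    using I by (intro prod.mono_neutral_right) (auto simp: wt_def)
  also have "\<dots> = (\<Prod>k\<in>S. \<bar>u k\<bar> powr (p - 2))"
    using I by (intro prod.cong) (auto simp: wt_def)
  finally show ?thesis by (simp add: wt_def)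
qed

text \<open>Up to constants, the density of the coefficient of t^(card S + 1): i is the coordinate
  contributed by the derivative of the level, S the set of coordinates whose Jacobian factor
  contributes its s-dependent term. The negative power comes from integrating s^(card S) up to t
  divided by the root of the sum of |u_k|^(2p-2).\<close>

definition shell_density :: "real \<Rightarrow> nat set \<Rightarrow> nat \<Rightarrow> nat set \<Rightarrow> (nat \<Rightarrow> real) \<Rightarrow> real" where
  "shell_density p I i S u = (\<Prod>k\<in>I. wt p i S k (u k)) *
     (\<Sum>k\<in>I. \<bar>u k\<bar> powr (2 * p - 2)) powr (- (real (card S) + 1) / 2)"

lemma shell_density_nonneg: "0 \<le> shell_density p I i S u"
  unfolding shell_density_def by (intro mult_nonneg_nonneg prod_nonneg wt_nonneg ballI) auto

lemma measurable_shell_density [measurable]: "shell_density p I i S \<in> borel_measurable (PiM I (\<lambda>_. lborel))"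
  unfolding shell_density_def by measurable

text \<open>Expanding the product of the factors 1 + s (p-1) |u_k|^(p-2) over subsets S separates
  the powers of s, which are then integrated explicitly.\<close>

lemma inner_integral_expansion:
  assumes p: "p > 1" and t: "t > 0" and I: "finite I"
  shows "(\<integral>\<^sup>+s\<in>{0<..}. ennreal (\<Sum>i\<in>I. p * \<bar>u i\<bar> powr (2 * p - 2) * (\<Prod>k\<in>I - {i}. dphi p s (u k))) *
        indicator {s. s\<^sup>2 * (\<Sum>i\<in>I. \<bar>u i\<bar> powr (2 * p - 2)) \<le> t\<^sup>2} s \<partial>lborel) =
    (\<Sum>i\<in>I. \<Sum>S\<in>Pow (I - {i}). ennreal (p * (p - 1) ^ card S * t ^ (card S + 1) / real (card S + 1)) *
      ennreal (shell_density p I i S u))" (is "?L = ?R")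
proof -
  define q where "q = (\<Sum>i\<in>I. \<bar>u i\<bar> powr (2 * p - 2))"
  have "q \<ge> 0" by (auto simp: q_def intro: sum_nonneg)
  show ?thesis
  proof (cases "q = 0")
    \<comment> \<open>Here the constraint on s is void, but every weight |u_i|^(2p-2) vanishes; on
      the right side \<open>powr\<close> with base 0 gives 0 as well.\<close>
    case True
    then have *: "\<bar>u i\<bar> powr (2 * p - 2) = 0" if "i \<in> I" for i
      using that I unfolding q_def by (subst (asm) sum_nonneg_eq_0_iff) auto
    have "?L = 0" using * by simp
    moreover have "shell_density p I i S u = 0" for i S
      unfolding shell_density_def using True by (simp add: q_def[symmetric])
    ultimately show ?thesis by simp
  next
    case False
    with \<open>q \<ge> 0\<close> have q: "q > 0" by simp
    define c where "c = (\<lambda>i S. p * \<bar>u i\<bar> powr (2 * p - 2) * (p - 1) ^ card S * (\<Prod>k\<in>S. \<bar>u k\<bar> powr (p - 2)))"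
    have c: "c i S \<ge> 0" for i S
      unfolding c_def using p by (intro mult_nonneg_nonneg prod_nonneg) auto
    let ?ind = "\<lambda>s. indicator {s. s\<^sup>2 * q \<le> t\<^sup>2} s * indicator {0<..} s :: ennreal"
    have "?L = (\<integral>\<^sup>+s. (\<Sum>i\<in>I. \<Sum>S\<in>Pow (I - {i}). ennreal (c i S) * (ennreal (s ^ card S) * ?ind s)) \<partial>lborel)"
    proof (rule nn_integral_cong)
      fix s :: real
      show "ennreal (\<Sum>i\<in>I. p * \<bar>u i\<bar> powr (2 * p - 2) * (\<Prod>k\<in>I - {i}. dphi p s (u k))) *
        indicator {s. s\<^sup>2 * (\<Sum>i\<in>I. \<bar>u i\<bar> powr (2 * p - 2)) \<le> t\<^sup>2} s * indicator {0<..} s =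
        (\<Sum>i\<in>I. \<Sum>S\<in>Pow (I - {i}). ennreal (c i S) * (ennreal (s ^ card S) * ?ind s))"
      proof (cases "s > 0")
        case s: True
        have "(\<Sum>i\<in>I. p * \<bar>u i\<bar> powr (2 * p - 2) * (\<Prod>k\<in>I - {i}. dphi p s (u k))) =
          (\<Sum>i\<in>I. \<Sum>S\<in>Pow (I - {i}). c i S * s ^ card S)"
        proof (rule sum.cong)
          fix i assume "i \<in> I"
          have "(\<Prod>k\<in>I - {i}. dphi p s (u k)) = (\<Prod>k\<in>I - {i}. s * (p - 1) * \<bar>u k\<bar> powr (p - 2) + 1)"
            using s by (simp add: dphi_def add.commute)
          also have "\<dots> = (\<Sum>S\<in>Pow (I - {i}). (\<Prod>k\<in>S. s * (p - 1) * \<bar>u k\<bar> powr (p - 2)) * (\<Prod>k\<in>I - {i} - S. 1))"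
            using I by (intro prod_add) auto
          also have "\<dots> = (\<Sum>S\<in>Pow (I - {i}). s ^ card S * (p - 1) ^ card S * (\<Prod>k\<in>S. \<bar>u k\<bar> powr (p - 2)))"
            by (simp add: prod.distrib power_mult_distrib)
          finally show "p * \<bar>u i\<bar> powr (2 * p - 2) * (\<Prod>k\<in>I - {i}. dphi p s (u k)) =
              (\<Sum>S\<in>Pow (I - {i}). c i S * s ^ card S)"
            by (simp add: c_def sum_distrib_left mult_ac)
        qed simp
        then have "ennreal (\<Sum>i\<in>I. p * \<bar>u i\<bar> powr (2 * p - 2) * (\<Prod>k\<in>I - {i}. dphi p s (u k))) =
          (\<Sum>i\<in>I. \<Sum>S\<in>Pow (I - {i}). ennreal (c i S) * ennreal (s ^ card S))"
          using s c by (simp add: ennreal_mult' sum_nonneg flip: sum_ennreal)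
        then show ?thesis
          by (simp add: q_def[symmetric] sum_distrib_right mult.assoc)
      qed simp
    qed
    also have "\<dots> = (\<Sum>i\<in>I. \<Sum>S\<in>Pow (I - {i}). ennreal (c i S) * (\<integral>\<^sup>+s. ennreal (s ^ card S) * ?ind s \<partial>lborel))"
      by (simp add: nn_integral_sum nn_integral_cmult)
    also have "\<dots> = ?R"
    proof (intro sum.cong refl)
      fix i S assume iS: "i \<in> I" "S \<in> Pow (I - {i})"
      have "(\<integral>\<^sup>+s. ennreal (s ^ card S) * ?ind s \<partial>lborel) =
          ennreal (t ^ (card S + 1) / real (card S + 1) * q powr (- (real (card S) + 1) / 2))"
        using nn_integral_power_truncated[OF t q, of "card S"] by (simp only: mult.assoc)
      moreover have "ennreal (c i S) * ennreal (t ^ (card S + 1) / real (card S + 1) * q powr (- (real (card S) + 1) / 2)) =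
         ennreal (p * (p - 1) ^ card S * t ^ (card S + 1) / real (card S + 1)) * ennreal (shell_density p I i S u)"
      proof -
        have eq: "c i S * (t ^ (card S + 1) / real (card S + 1) * q powr (- (real (card S) + 1) / 2)) =
          p * (p - 1) ^ card S * t ^ (card S + 1) / real (card S + 1) * shell_density p I i S u"
        proof -
          have "shell_density p I i S u = \<bar>u i\<bar> powr (2 * p - 2) * (\<Prod>k\<in>S. \<bar>u k\<bar> powr (p - 2)) *
              q powr (- (real (card S) + 1) / 2)"
            unfolding shell_density_def q_def[symmetric] using iS I by (subst prod_wt) auto
          then show ?thesis by (simp add: c_def)
        qed
        have "0 \<le> p * (p - 1) ^ card S * t ^ (card S + 1) / real (card S + 1)" using p t by simp
        then show ?thesis
          unfolding ennreal_mult'[OF c, symmetric] eq by (rule ennreal_mult')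
      qed
      ultimately show "ennreal (c i S) * (\<integral>\<^sup>+s. ennreal (s ^ card S) * ?ind s \<partial>lborel) =
        ennreal (p * (p - 1) ^ card S * t ^ (card S + 1) / real (card S + 1)) * ennreal (shell_density p I i S u)"
        by simp
    qed
    finally show ?thesis .
  qed
qed

section \<open>Homogeneity and factorisation of the coefficients\<close>

definition shell_integral :: "real \<Rightarrow> nat set \<Rightarrow> nat \<Rightarrow> nat set \<Rightarrow> real \<Rightarrow> ennreal" where
  "shell_integral p I i S T = (\<integral>\<^sup>+u. indicator {u. (\<Sum>i\<in>I. \<bar>u i\<bar> powr p) \<le> T} u * ennreal (shell_density p I i S u)
     \<partial>PiM I (\<lambda>_. lborel))"

lemma measurable_sublevel:
  fixes I :: "nat set" and p T :: real
  shows "(\<lambda>u. indicator {u. (\<Sum>i\<in>I. \<bar>u i\<bar> powr p) \<le> T} u :: ennreal) \<in> borel_measurable (PiM I (\<lambda>_. lborel))"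
  unfolding indicator_def mem_Collect_eq by measurable

lemma nn_integral_emeasure_pbody_shell_integral:
  assumes p: "p > 1" and t: "t > 0" and I: "finite I" and T: "T > 0"
  shows "(\<integral>\<^sup>+\<tau>\<in>{0<..T}. emeasure (PiM I (\<lambda>_. lborel)) (pbody p I t \<tau> - pball p I \<tau>) \<partial>lborel) =
    (\<Sum>i\<in>I. \<Sum>S\<in>Pow (I - {i}).
      ennreal (p * (p - 1) ^ card S * t ^ (card S + 1) / real (card S + 1)) * shell_integral p I i S T)"
proof -
  note measurable_sublevel[measurable]
  show ?thesis
    using t unfolding nn_integral_emeasure_pbody[OF p less_imp_le[OF t] I T] inner_integral_expansion[OF p t I]
    by (simp add: sum_distrib_left mult.left_commute[of "indicator _ _"] nn_integral_sum nn_integral_cmult shell_integral_def)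
qed

text \<open>The density is homogeneous of degree p - 1 - card S, the volume element adds card I, and
  the constraint has degree p.\<close>

lemma shell_integral_scaling:
  assumes p: "p > 1" and I: "finite I" "i \<in> I" "S \<subseteq> I - {i}" and T: "T > 0"
  shows "shell_integral p I i S T = ennreal (T powr ((real (card I) + p - 1 - real (card S)) / p)) * shell_integral p I i S 1"
proof -
  define c where "c = T powr (1 / p)"
  have c: "c > 0" using T by (simp add: c_def)
  have cp: "c powr p = T" using T p by (simp add: c_def powr_powr)
  let ?P = "PiM I (\<lambda>_. lborel :: real measure)"
  define ex where "ex = (\<lambda>k. if k = i then 2 * p - 2 else if k \<in> S then p - 2 else 0)"
  define m where "m = real (card S)"
  have sum_ex: "(\<Sum>k\<in>I. ex k) = 2 * p - 2 + m * (p - 2)"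
  proof -
    have "(\<Sum>k\<in>I. ex k) = ex i + (\<Sum>k\<in>I - {i}. ex k)" using I by (intro sum.remove)
    also have "(\<Sum>k\<in>I - {i}. ex k) = (\<Sum>k\<in>S. ex k)"
      using I by (intro sum.mono_neutral_right) (auto simp: ex_def)
    also have "\<dots> = (\<Sum>k\<in>S. p - 2)" using I by (intro sum.cong) (auto simp: ex_def)
    finally show ?thesis by (simp add: ex_def m_def)
  qed
  have wt_c: "wt p i S k (c * x) = c powr ex k * wt p i S k x" for k x
    using c by (auto simp: wt_def ex_def abs_mult powr_mult)
  have prod_c: "(\<Prod>k\<in>I. wt p i S k (c * u k)) = c powr (2 * p - 2 + m * (p - 2)) * (\<Prod>k\<in>I. wt p i S k (u k))" for u
    using c I by (simp add: wt_c prod.distrib powr_sum sum_ex[symmetric])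
  have sum_c: "(\<Sum>k\<in>I. \<bar>c * u k\<bar> powr e) = c powr e * (\<Sum>k\<in>I. \<bar>u k\<bar> powr e)" for u :: "nat \<Rightarrow> real" and e
    using c by (simp add: abs_mult powr_mult sum_distrib_left)
  have h_c: "shell_density p I i S (\<lambda>k\<in>I. c * u k) = c powr (p - 1 - m) * shell_density p I i S u" for u
  proof -
    have "shell_density p I i S (\<lambda>k\<in>I. c * u k) = (\<Prod>k\<in>I. wt p i S k (c * u k)) *
        (\<Sum>k\<in>I. \<bar>c * u k\<bar> powr (2 * p - 2)) powr (- (m + 1) / 2)"
      unfolding shell_density_def m_def by (simp cong: prod.cong sum.cong)
    also have "\<dots> = (c powr (2 * p - 2 + m * (p - 2)) * (c powr (2 * p - 2)) powr (- (m + 1) / 2)) * shell_density p I i S u"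
      unfolding prod_c sum_c using c by (subst powr_mult) (auto intro!: sum_nonneg simp: shell_density_def m_def)
    also have "c powr (2 * p - 2 + m * (p - 2)) * (c powr (2 * p - 2)) powr (- (m + 1) / 2) =
        c powr (2 * p - 2 + m * (p - 2) + (2 * p - 2) * (- (m + 1) / 2))"
      by (simp only: powr_powr powr_add)
    also have "2 * p - 2 + m * (p - 2) + (2 * p - 2) * (- (m + 1) / 2) = p - 1 - m"
      by (simp add: field_simps)
    finally show ?thesis .
  qed
  note measurable_sublevel[measurable]
  have "shell_integral p I i S T = (\<integral>\<^sup>+u. (\<Prod>k\<in>I. ennreal c) * (indicator {u. (\<Sum>i\<in>I. \<bar>u i\<bar> powr p) \<le> T} (\<lambda>k\<in>I. c * u k) *
      ennreal (shell_density p I i S (\<lambda>k\<in>I. c * u k))) \<partial>?P)"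
    unfolding shell_integral_def
  proof (rule nn_integral_PiM_componentwise_substitution)
    fix f :: "real \<Rightarrow> ennreal" assume [measurable]: "f \<in> borel_measurable borel"
    show "(\<integral>\<^sup>+x. f x \<partial>lborel) = (\<integral>\<^sup>+u. ennreal c * f (c * u) \<partial>lborel)"
      using c nn_integral_real_affine[of f c 0] by (simp add: nn_integral_cmult)
  qed (use I in auto)
  also have "\<dots> = (\<integral>\<^sup>+u. ennreal (c ^ card I * c powr (p - 1 - m)) *
      (indicator {u. (\<Sum>i\<in>I. \<bar>u i\<bar> powr p) \<le> 1} u * ennreal (shell_density p I i S u)) \<partial>?P)"
  proof (rule nn_integral_cong)
    fix u :: "nat \<Rightarrow> real"
    have "(\<Sum>k\<in>I. \<bar>(\<lambda>k\<in>I. c * u k) k\<bar> powr p) = T * (\<Sum>k\<in>I. \<bar>u k\<bar> powr p)"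
      unfolding cp[symmetric] sum_c[symmetric] by (simp cong: sum.cong)
    then have "(\<Sum>k\<in>I. \<bar>(\<lambda>k\<in>I. c * u k) k\<bar> powr p) \<le> T \<longleftrightarrow> (\<Sum>k\<in>I. \<bar>u k\<bar> powr p) \<le> 1"
      using T by simp
    then show "(\<Prod>k\<in>I. ennreal c) * (indicator {u. (\<Sum>i\<in>I. \<bar>u i\<bar> powr p) \<le> T} (\<lambda>k\<in>I. c * u k) *
      ennreal (shell_density p I i S (\<lambda>k\<in>I. c * u k))) = ennreal (c ^ card I * c powr (p - 1 - m)) *
      (indicator {u. (\<Sum>i\<in>I. \<bar>u i\<bar> powr p) \<le> 1} u * ennreal (shell_density p I i S u))"
      using c by (simp add: indicator_def h_c ennreal_mult' ennreal_power shell_density_nonneg mult_ac)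
  qed
  also have "\<dots> = ennreal (c ^ card I * c powr (p - 1 - m)) * shell_integral p I i S 1"
    unfolding shell_integral_def by (rule nn_integral_cmult) measurable
  also have "c ^ card I * c powr (p - 1 - m) = T powr ((real (card I) + p - 1 - real (card S)) / p)"
  proof -
    have e: "real (card I) * (1 / p) + (p - 1 - m) * (1 / p) = (real (card I) + p - 1 - real (card S)) / p"
      using p by (simp add: m_def field_simps)
    show ?thesis
      unfolding powr_realpow[OF c, symmetric] powr_add[symmetric] e[symmetric]
      by (simp add: c_def powr_powr distrib_left mult.commute flip: powr_add)
  qed
  finally show ?thesis .
qed

text \<open>Here m is the codimension minus one: \<open>theta_integral p m j\<close> belongs to the
  intrinsic volume of index j in dimension m + j + 1. The value is an \<open>ennreal\<close> so that
  identities can precede finiteness.\<close>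

definition theta_integral :: "real \<Rightarrow> nat \<Rightarrow> nat \<Rightarrow> ennreal" where
  "theta_integral p m j = (\<integral>\<^sup>+\<theta>\<in>{0<..}. ennreal (\<theta> powr ((real m + 1) / 2 - 1) * mom p (2 * p - 2) (2 * p - 2) \<theta> *
     mom p (2 * p - 2) (p - 2) \<theta> ^ m * mom p (2 * p - 2) 0 \<theta> ^ j) \<partial>lborel)"

lemma nn_integral_exp_tail:
  assumes "N \<ge> 0"
  shows "(\<integral>\<^sup>+\<tau>\<in>{0<..}. ennreal (exp (- \<tau>)) * indicator {N..} \<tau> \<partial>lborel) = ennreal (exp (- N))"
proof -
  have "(\<integral>\<^sup>+\<tau>\<in>{0<..}. ennreal (exp (- \<tau>)) * indicator {N..} \<tau> \<partial>lborel) =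
      (\<integral>\<^sup>+\<tau>. ennreal (exp (- \<tau>)) * indicator {N..} \<tau> \<partial>lborel)"
    using AE_lborel_singleton[of "0::real"]
    by (intro nn_integral_cong_AE, eventually_elim) (use assms in \<open>auto simp: indicator_def\<close>)
  also have "\<dots> = ennreal (0 - (- exp (- N)))"
  proof (rule nn_integral_FTC_atLeast)
    have "((\<lambda>x::real. exp (- x)) \<longlongrightarrow> 0) at_top"
      by (rule filterlim_compose[OF exp_at_bot filterlim_uminus_at_bot_at_top])
    from tendsto_minus[OF this] show "((\<lambda>x::real. - exp (- x)) \<longlongrightarrow> 0) at_top" by simp
    show "((\<lambda>x. - exp (- x)) has_real_derivative exp (- x)) (at x)" for x :: real
      by (rule derivative_eq_intros refl | simp)+
  qed auto
  finally show ?thesis by simp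
qed

lemma nn_integral_weighted_exp:
  assumes p: "p > 1" and \<theta>: "\<theta> \<ge> 0"
  shows "(\<integral>\<^sup>+x. ennreal (wt p i S k x * exp (- (\<bar>x\<bar> powr p) - \<theta> * \<bar>x\<bar> powr (2 * p - 2))) \<partial>lborel) =
    ennreal (mom p (2 * p - 2) (if k = i then 2 * p - 2 else if k \<in> S then p - 2 else 0) \<theta>)"
proof -
  have "(\<integral>\<^sup>+x. ennreal (wt p i S k x * exp (- (\<bar>x\<bar> powr p) - \<theta> * \<bar>x\<bar> powr (2 * p - 2))) \<partial>lborel) =
    (\<integral>\<^sup>+x. ennreal (\<bar>x\<bar> powr (if k = i then 2 * p - 2 else if k \<in> S then p - 2 else 0) *
       exp (- (\<bar>x\<bar> powr p) - \<theta> * \<bar>x\<bar> powr (2 * p - 2))) \<partial>lborel)"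
    using AE_lborel_singleton[of "0::real"]
    by (intro nn_integral_cong_AE, eventually_elim) (auto simp: wt_def)
  also have "\<dots> = ennreal (mom p (2 * p - 2) (if k = i then 2 * p - 2 else if k \<in> S then p - 2 else 0) \<theta>)"
    using p \<theta> by (intro nn_integral_mom) auto
  finally show ?thesis .
qed

lemma prod_mom_exponents:
  assumes I: "finite I" "i \<in> I" "S \<subseteq> I - {i}"
  shows "(\<Prod>k\<in>I. g (if k = i then a else if k \<in> S then b else c)) =
    g a * g b ^ card S * (g c :: real) ^ (card I - 1 - card S)"
proof -
  have "finite S" using I finite_subset by blast
  have "(\<Prod>k\<in>I. g (if k = i then a else if k \<in> S then b else c)) =
      g a * (\<Prod>k\<in>I - {i}. g (if k = i then a else if k \<in> S then b else c))"
    using I by (subst prod.remove[of I i]) auto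
  also have "(\<Prod>k\<in>I - {i}. g (if k = i then a else if k \<in> S then b else c)) =
      (\<Prod>k\<in>I - {i}. if k \<in> S then g b else g c)"
    by (intro prod.cong) auto
  also have "\<dots> = (\<Prod>k\<in>S. g b) * (\<Prod>k\<in>I - {i} - S. g c)"
  proof -
    have "(I - {i}) \<inter> {k. k \<in> S} = S" "(I - {i}) \<inter> - {k. k \<in> S} = I - {i} - S" using I by auto
    then show ?thesis using I by (subst prod.If_cases) simp_all
  qed
  also have "\<dots> = g b ^ card S * g c ^ (card I - 1 - card S)"
    using I \<open>finite S\<close> by (simp add: card_Diff_subset)
  finally show ?thesis by (simp add: mult.assoc)
qed

text \<open>Two Gamma integrals separate the coordinates. As a function of \<tau> the coefficient is
  a power \<tau>^e, so integrating against exp(-\<tau>) produces Gamma(e + 1) on one side and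
  replaces the constraint by exp(-\<Sum>|u_i|^p) on the other. The negative power of
  \<Sum>|u_i|^(2p-2) becomes a Gamma integral in \<theta>. What remains is a product over the
  coordinates, hence a product of moments.\<close>

lemma shell_integral_eq:
  assumes p: "p > 1" and I: "finite I" "i \<in> I" "S \<subseteq> I - {i}"
  shows "ennreal (Gamma ((real (card S) + 1) / 2) * Gamma ((real (card I) + p - 1 - real (card S)) / p + 1)) *
    shell_integral p I i S 1 = theta_integral p (card S) (card I - 1 - card S)"
proof -
  let ?P = "PiM I (\<lambda>_. lborel :: real measure)"
  interpret P: sigma_finite_measure ?P by (rule sigma_finite_PiM_lborel[OF I(1)])
  interpret pair_sigma_finite ?P "lborel :: real measure" ..
  interpret product_sigma_finite "\<lambda>_. lborel :: real measure" by standard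
  define m where "m = card S"
  define e where "e = (real (card I) + p - 1 - real m) / p"
  define a where "a = (real m + 1) / 2"
  have "m \<le> card I - 1" unfolding m_def
    using card_mono[of "I - {i}" S] I by simp
  moreover have "card I > 0" using I by (auto simp: card_gt_0_iff)
  ultimately have e: "e > 0" using p by (simp add: e_def)
  have a: "a > 0" by (simp add: a_def)
  define N where "N = (\<lambda>u :: nat \<Rightarrow> real. \<Sum>i\<in>I. \<bar>u i\<bar> powr p)"
  define q where "q = (\<lambda>u :: nat \<Rightarrow> real. \<Sum>i\<in>I. \<bar>u i\<bar> powr (2 * p - 2))"
  have N0: "N u \<ge> 0" and q0: "q u \<ge> 0" for u by (auto simp: N_def q_def intro: sum_nonneg)
  have [measurable]: "N \<in> borel_measurable ?P" "q \<in> borel_measurable ?P"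
    unfolding N_def q_def by measurable
  define w where "w = (\<lambda>u. \<Prod>k\<in>I. wt p i S k (u k))"
  have w0: "w u \<ge> 0" for u unfolding w_def by (intro prod_nonneg ballI wt_nonneg)
  have [measurable]: "w \<in> borel_measurable ?P" unfolding w_def by measurable
  have h: "shell_density p I i S u = w u * q u powr (- a)" for u
    by (simp only: shell_density_def w_def q_def a_def m_def minus_divide_left)
  let ?e = "\<lambda>u \<tau>. ennreal (shell_density p I i S u) * (ennreal (exp (- \<tau>)) * indicator {N u..} \<tau> * indicator {0<..} \<tau>)"
  let ?w = "\<lambda>u \<theta>. ennreal (w u * exp (- N u)) * (ennreal (\<theta> powr (a - 1) * exp (- q u * \<theta>)) * indicator {0<..} \<theta>)"
  have "ennreal (Gamma (e + 1)) * shell_integral p I i S 1 =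
    (\<integral>\<^sup>+\<tau>\<in>{0<..}. ennreal (\<tau> powr (e + 1 - 1) * exp (- 1 * \<tau>)) \<partial>lborel) * shell_integral p I i S 1"
    using e by (subst nn_integral_Gamma) auto
  also have "\<dots> = (\<integral>\<^sup>+\<tau>. (ennreal (\<tau> powr (e + 1 - 1) * exp (- 1 * \<tau>)) * indicator {0<..} \<tau>) * shell_integral p I i S 1 \<partial>lborel)"
    by (rule nn_integral_multc[symmetric]) measurable
  also have "\<dots> = (\<integral>\<^sup>+\<tau>. (\<integral>\<^sup>+u. ?e u \<tau> \<partial>?P) \<partial>lborel)"
  proof (rule nn_integral_cong)
    fix \<tau> :: real
    show "(ennreal (\<tau> powr (e + 1 - 1) * exp (- 1 * \<tau>)) * indicator {0<..} \<tau>) * shell_integral p I i S 1 =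
      (\<integral>\<^sup>+u. ?e u \<tau> \<partial>?P)"
    proof (cases "\<tau> > 0")
      case True
      note measurable_sublevel[measurable]
      have "(ennreal (\<tau> powr (e + 1 - 1) * exp (- 1 * \<tau>)) * indicator {0<..} \<tau>) * shell_integral p I i S 1 =
          ennreal (exp (- \<tau>)) * shell_integral p I i S \<tau>"
        using True by (subst shell_integral_scaling[OF p I True]) (simp add: e_def m_def ennreal_mult mult_ac)
      also have "\<dots> = (\<integral>\<^sup>+u. ennreal (exp (- \<tau>)) *
          (indicator {u. (\<Sum>i\<in>I. \<bar>u i\<bar> powr p) \<le> \<tau>} u * ennreal (shell_density p I i S u)) \<partial>?P)"
        unfolding shell_integral_def by (rule nn_integral_cmult[symmetric]) measurable
      also have "\<dots> = (\<integral>\<^sup>+u. ?e u \<tau> \<partial>?P)"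
        using True by (intro nn_integral_cong) (auto simp: indicator_def N_def mult.commute)
      finally show ?thesis .
    qed simp
  qed
  also have "\<dots> = (\<integral>\<^sup>+u. (\<integral>\<^sup>+\<tau>. ?e u \<tau> \<partial>lborel) \<partial>?P)"
  proof (rule Fubini')
    have "(\<lambda>z. ennreal (shell_density p I i S (fst z)) * (ennreal (exp (- snd z)) * indicator {N (fst z)..} (snd z) * indicator {0<..} (snd z)))
      \<in> borel_measurable (?P \<Otimes>\<^sub>M lborel)"
      unfolding indicator_def atLeast_iff by measurable
    then show "(\<lambda>(u, \<tau>). ?e u \<tau>)
      \<in> borel_measurable (?P \<Otimes>\<^sub>M lborel)"
      by (simp add: split_beta')
  qed
  also have "\<dots> = (\<integral>\<^sup>+u. ennreal (shell_density p I i S u) * ennreal (exp (- N u)) \<partial>?P)"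
    using nn_integral_exp_tail[OF N0] by (intro nn_integral_cong) (simp add: nn_integral_cmult)
  finally have 1: "ennreal (Gamma (e + 1)) * shell_integral p I i S 1 =
      (\<integral>\<^sup>+u. ennreal (shell_density p I i S u) * ennreal (exp (- N u)) \<partial>?P)" .
  have "ennreal (Gamma a * Gamma (e + 1)) * shell_integral p I i S 1 =
      ennreal (Gamma a) * (\<integral>\<^sup>+u. ennreal (shell_density p I i S u) * ennreal (exp (- N u)) \<partial>?P)"
    using a e by (simp add: ennreal_mult Gamma_real_pos less_imp_le mult.assoc flip: 1)
  also have "\<dots> = (\<integral>\<^sup>+u. ennreal (Gamma a) * (ennreal (shell_density p I i S u) * ennreal (exp (- N u))) \<partial>?P)"
    by (rule nn_integral_cmult[symmetric]) measurable
  also have "\<dots> = (\<integral>\<^sup>+u. (\<integral>\<^sup>+\<theta>. ?w u \<theta> \<partial>lborel) \<partial>?P)"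
  proof (rule nn_integral_cong)
    fix u :: "nat \<Rightarrow> real"
    show "ennreal (Gamma a) * (ennreal (shell_density p I i S u) * ennreal (exp (- N u))) =
      (\<integral>\<^sup>+\<theta>. ?w u \<theta> \<partial>lborel)"
    proof (cases "q u = 0")
      case True
      then have "\<bar>u i\<bar> powr (2 * p - 2) = 0"
        unfolding q_def using I by (subst (asm) sum_nonneg_eq_0_iff) auto
      then have "w u = 0" unfolding w_def using I by (simp add: prod_wt)
      then show ?thesis by (simp add: h)
    next
      case False
      then have q: "q u > 0" using q0[of u] by simp
      have "(\<integral>\<^sup>+\<theta>. ?w u \<theta> \<partial>lborel) =
          ennreal (w u * exp (- N u)) * ennreal (Gamma a * q u powr (- a))"
        unfolding nn_integral_Gamma[OF a q, symmetric] by (rule nn_integral_cmult) measurable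
      also have "\<dots> = ennreal (w u * exp (- N u) * (Gamma a * q u powr (- a)))"
        using w0[of u] by (intro ennreal_mult'[symmetric]) auto
      also have "w u * exp (- N u) * (Gamma a * q u powr (- a)) = Gamma a * (shell_density p I i S u * exp (- N u))"
        by (simp add: h)
      also have "ennreal \<dots> = ennreal (Gamma a) * (ennreal (shell_density p I i S u) * ennreal (exp (- N u)))"
        using a by (simp add: ennreal_mult' shell_density_nonneg Gamma_real_pos less_imp_le)
      finally show ?thesis by simp
    qed
  qed
  also have "\<dots> = (\<integral>\<^sup>+\<theta>. (\<integral>\<^sup>+u. ?w u \<theta> \<partial>?P) \<partial>lborel)"
  proof (rule Fubini'[symmetric])
    have "(\<lambda>z. ennreal (w (fst z) * exp (- N (fst z))) * (ennreal (snd z powr (a - 1) * exp (- q (fst z) * snd z)) * indicator {0<..} (snd z)))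
      \<in> borel_measurable (?P \<Otimes>\<^sub>M lborel)"
      by measurable
    then show "(\<lambda>(u, \<theta>). ?w u \<theta>)
      \<in> borel_measurable (?P \<Otimes>\<^sub>M lborel)"
      by (simp add: split_beta')
  qed
  also have "\<dots> = theta_integral p m (card I - 1 - m)"
    unfolding theta_integral_def
  proof (rule nn_integral_cong)
    fix \<theta> :: real
    show "(\<integral>\<^sup>+u. ?w u \<theta> \<partial>?P) =
      ennreal (\<theta> powr ((real m + 1) / 2 - 1) * mom p (2 * p - 2) (2 * p - 2) \<theta> *
        mom p (2 * p - 2) (p - 2) \<theta> ^ m * mom p (2 * p - 2) 0 \<theta> ^ (card I - 1 - m)) * indicator {0<..} \<theta>"
    proof (cases "\<theta> > 0")
      case True
      let ?f = "\<lambda>k x. wt p i S k x * exp (- (\<bar>x\<bar> powr p) - \<theta> * \<bar>x\<bar> powr (2 * p - 2))"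
      have "(\<integral>\<^sup>+u. ?w u \<theta> \<partial>?P) =
        (\<integral>\<^sup>+u. ennreal (\<theta> powr (a - 1)) * (\<Prod>k\<in>I. ennreal (?f k (u k))) \<partial>?P)"
      proof (rule nn_integral_cong)
        fix u :: "nat \<Rightarrow> real"
        have "(\<Prod>k\<in>I. ennreal (?f k (u k))) = ennreal (\<Prod>k\<in>I. ?f k (u k))"
          by (intro prod_ennreal mult_nonneg_nonneg wt_nonneg) auto
        also have "(\<Prod>k\<in>I. ?f k (u k)) = w u * exp (- N u - q u * \<theta>)"
          using I(1) by (simp add: prod.distrib w_def N_def q_def exp_sum[symmetric] sum_subtractf sum_negf sum_distrib_left mult.commute)
        finally show "?w u \<theta> =
            ennreal (\<theta> powr (a - 1)) * (\<Prod>k\<in>I. ennreal (?f k (u k)))"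
          using True w0[of u] by (simp add: ennreal_mult[symmetric] exp_diff exp_minus field_simps)
      qed
      also have "\<dots> = ennreal (\<theta> powr (a - 1)) * (\<integral>\<^sup>+u. (\<Prod>k\<in>I. ennreal (?f k (u k))) \<partial>?P)"
        by (rule nn_integral_cmult) measurable
      also have "(\<integral>\<^sup>+u. (\<Prod>k\<in>I. ennreal (?f k (u k))) \<partial>?P) = (\<Prod>k\<in>I. (\<integral>\<^sup>+x. ennreal (?f k x) \<partial>lborel))"
        by (rule product_nn_integral_prod[OF I(1)]) measurable
      also have "\<dots> = (\<Prod>k\<in>I. ennreal (mom p (2 * p - 2) (if k = i then 2 * p - 2 else if k \<in> S then p - 2 else 0) \<theta>))"
        using True by (intro prod.cong refl nn_integral_weighted_exp p) auto
      also have "\<dots> = ennreal (\<Prod>k\<in>I. mom p (2 * p - 2) (if k = i then 2 * p - 2 else if k \<in> S then p - 2 else 0) \<theta>)"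
        using True p by (intro prod_ennreal less_imp_le mom_pos) auto
      also have "(\<Prod>k\<in>I. mom p (2 * p - 2) (if k = i then 2 * p - 2 else if k \<in> S then p - 2 else 0) \<theta>) =
          mom p (2 * p - 2) (2 * p - 2) \<theta> * mom p (2 * p - 2) (p - 2) \<theta> ^ m * mom p (2 * p - 2) 0 \<theta> ^ (card I - 1 - m)"
        unfolding m_def by (rule prod_mom_exponents[OF I])
      finally show ?thesis using True
        by (simp add: a_def ennreal_mult'[symmetric] mult.assoc)
    qed simp
  qed
  finally show ?thesis by (simp add: a_def e_def m_def)
qed

section \<open>Volume of the parallel body\<close>

lemma pball_mono: "\<tau> \<le> \<tau>' \<Longrightarrow> pball p I \<tau> \<subseteq> pball p I \<tau>'"
  by (auto simp: pball_def)

lemma emeasure_pball_scaling: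
  assumes p: "p > 1" and I: "finite I" and T: "\<tau> > 0"
  shows "emeasure (PiM I (\<lambda>_. lborel)) (pball p I \<tau>) =
    ennreal (\<tau> powr (real (card I) / p)) * emeasure (PiM I (\<lambda>_. lborel)) (pball p I 1)"
proof -
  define c where "c = \<tau> powr (1 / p)"
  have c: "c > 0" using T by (simp add: c_def)
  have cp: "c powr p = \<tau>" using T p by (simp add: c_def powr_powr)
  let ?P = "PiM I (\<lambda>_. lborel :: real measure)"
  have "emeasure ?P (pball p I \<tau>) = (\<integral>\<^sup>+x. indicator (pball p I \<tau>) x \<partial>?P)"
    by simp
  also have "\<dots> = (\<integral>\<^sup>+u. (\<Prod>k\<in>I. ennreal c) * indicator (pball p I \<tau>) (\<lambda>k\<in>I. c * u k) \<partial>?P)"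
  proof (rule nn_integral_PiM_componentwise_substitution)
    fix f :: "real \<Rightarrow> ennreal" assume [measurable]: "f \<in> borel_measurable borel"
    show "(\<integral>\<^sup>+x. f x \<partial>lborel) = (\<integral>\<^sup>+u. ennreal c * f (c * u) \<partial>lborel)"
      using c nn_integral_real_affine[of f c 0] by (simp add: nn_integral_cmult)
  qed (use I in auto)
  also have "\<dots> = (\<integral>\<^sup>+u. ennreal (c ^ card I) * indicator (pball p I 1) u \<partial>?P)"
  proof (rule nn_integral_cong)
    fix u assume "u \<in> space ?P"
    then have u: "u \<in> I \<rightarrow>\<^sub>E UNIV" by (simp add: space_PiM)
    have "(\<Sum>k\<in>I. \<bar>(\<lambda>k\<in>I. c * u k) k\<bar> powr p) = (\<Sum>k\<in>I. \<tau> * \<bar>u k\<bar> powr p)"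
      using c by (intro sum.cong) (auto simp: abs_mult powr_mult cp)
    also have "\<dots> = \<tau> * (\<Sum>k\<in>I. \<bar>u k\<bar> powr p)" by (simp only: sum_distrib_left)
    finally have "(\<Sum>k\<in>I. \<bar>(\<lambda>k\<in>I. c * u k) k\<bar> powr p) \<le> \<tau> \<longleftrightarrow> (\<Sum>k\<in>I. \<bar>u k\<bar> powr p) \<le> 1"
      using T by simp
    then have "(\<lambda>k\<in>I. c * u k) \<in> pball p I \<tau> \<longleftrightarrow> u \<in> pball p I 1"
      using u by (simp add: pball_def)
    then show "(\<Prod>k\<in>I. ennreal c) * indicator (pball p I \<tau>) (\<lambda>k\<in>I. c * u k) =
        ennreal (c ^ card I) * indicator (pball p I 1) u"
      using c by (simp add: indicator_def ennreal_power)
  qed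
  also have "\<dots> = ennreal (c ^ card I) * emeasure ?P (pball p I 1)"
    by (simp add: nn_integral_cmult)
  also have "c ^ card I = \<tau> powr (real (card I) / p)"
    using T by (simp add: c_def powr_realpow[symmetric] powr_powr)
  finally show ?thesis .
qed

text \<open>Each coordinate of a point of the body is at most \<tau>^(1/p) + t in modulus, so the
  body lies in a cube.\<close>

lemma emeasure_pbody_finite:
  assumes p: "p > 1" and t: "t \<ge> 0" and I: "finite I" and \<tau>: "\<tau> > 0"
  shows "emeasure (PiM I (\<lambda>_. lborel)) (pbody p I t \<tau>) < \<infinity>"
proof -
  interpret product_sigma_finite "\<lambda>_. lborel :: real measure" by standard
  define R where "R = \<tau> powr (1 / p) + t"
  have "pbody p I t \<tau> \<subseteq> Pi\<^sub>E I (\<lambda>_. {- R..R})"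
  proof
    fix x assume "x \<in> pbody p I t \<tau>"
    then obtain y z where xyz: "x = (\<lambda>i\<in>I. y i + t * z i)"
        "(\<Sum>i\<in>I. \<bar>y i\<bar> powr p) \<le> \<tau>" "(\<Sum>i\<in>I. \<bar>z i\<bar> powr 2) \<le> 1"
      unfolding pbody_def pball_def by blast
    have "\<bar>x i\<bar> \<le> R" if i: "i \<in> I" for i
    proof -
      have "\<bar>y i\<bar> powr p \<le> (\<Sum>i\<in>I. \<bar>y i\<bar> powr p)" using I i by (intro member_le_sum) auto
      then have "(\<bar>y i\<bar> powr p) powr (1 / p) \<le> \<tau> powr (1 / p)"
        using xyz(2) p by (intro powr_mono2) auto
      then have 1: "\<bar>y i\<bar> \<le> \<tau> powr (1 / p)" using p by (simp add: powr_powr)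
      have "\<bar>z i\<bar> powr 2 \<le> (\<Sum>i\<in>I. \<bar>z i\<bar> powr 2)" using I i by (intro member_le_sum) auto
      then have "\<bar>z i\<bar>\<^sup>2 \<le> 1\<^sup>2" using xyz(3) by simp
      then have "\<bar>z i\<bar> \<le> 1" by (simp add: abs_square_le_1)
      then have 2: "\<bar>t * z i\<bar> \<le> t" using t by (simp add: abs_mult mult_left_le)
      show ?thesis using 1 2 i abs_triangle_ineq[of "y i" "t * z i"] by (simp add: xyz(1) R_def)
    qed
    then have "x i \<in> {- R..R}" if "i \<in> I" for i
      using that by (simp add: abs_le_iff minus_le_iff)
    moreover have "x i = undefined" if "i \<notin> I" for i using that xyz(1) by simp
    ultimately show "x \<in> Pi\<^sub>E I (\<lambda>_. {- R..R})" by (simp add: PiE_iff extensional_def)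
  qed
  then have "emeasure (PiM I (\<lambda>_. lborel)) (pbody p I t \<tau>) \<le> emeasure (PiM I (\<lambda>_. lborel)) (Pi\<^sub>E I (\<lambda>_. {- R..R}))"
    using I by (intro emeasure_mono) auto
  also have "\<dots> = (\<Prod>i\<in>I. emeasure lborel {- R..R})"
    using I by (intro emeasure_PiM) auto
  also have "\<dots> < \<infinity>"
    using t by (auto simp: R_def power_less_top_ennreal)
  finally show ?thesis .
qed

text \<open>At t = T = 1 all terms of the expansion are nonnegative, and their sum is an integral
  over levels in (0, 1] of volumes of subsets of one bounded body.\<close>

lemma shell_integral_finite:
  assumes p: "p > 1" and I: "finite I" "i \<in> I" "S \<subseteq> I - {i}"
  shows "shell_integral p I i S 1 < \<infinity>"
proof -
  let ?P = "PiM I (\<lambda>_. lborel :: real measure)"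
  let ?F = "\<lambda>i S. ennreal (p * (p - 1) ^ card S * 1 ^ (card S + 1) / real (card S + 1)) * shell_integral p I i S 1"
  have "?F i S \<le> (\<Sum>S\<in>Pow (I - {i}). ?F i S)"
    using I by (intro member_le_sum) auto
  also have "\<dots> \<le> (\<Sum>i\<in>I. \<Sum>S\<in>Pow (I - {i}). ?F i S)"
    using I by (intro member_le_sum[of i I "\<lambda>i. \<Sum>S\<in>Pow (I - {i}). ?F i S"]) auto
  also have "\<dots> = (\<integral>\<^sup>+\<tau>\<in>{0<..1}. emeasure ?P (pbody p I 1 \<tau> - pball p I \<tau>) \<partial>lborel)"
    using nn_integral_emeasure_pbody_shell_integral[OF p _ I(1), of 1 1] by simp
  also have "\<dots> \<le> (\<integral>\<^sup>+\<tau>. emeasure ?P (pbody p I 1 1) * indicator {0<..1::real} \<tau> \<partial>lborel)"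
  proof (rule nn_integral_mono)
    fix \<tau> :: real
    show "emeasure ?P (pbody p I 1 \<tau> - pball p I \<tau>) * indicator {0<..1} \<tau> \<le>
      emeasure ?P (pbody p I 1 1) * indicator {0<..1} \<tau>"
    proof (cases "\<tau> \<in> {0<..1}")
      case True
      then have "pbody p I 1 \<tau> - pball p I \<tau> \<subseteq> pbody p I 1 1"
        using pbody_mono[of \<tau> 1 p I 1] by auto
      then show ?thesis using True sets_pbody[OF p _ I(1), of 1 1] by (auto intro!: emeasure_mono)
    qed simp
  qed
  also have "\<dots> = emeasure ?P (pbody p I 1 1)"
    by (simp add: nn_integral_cmult_indicator)
  also have "\<dots> < \<infinity>" using I p by (intro emeasure_pbody_finite) auto
  finally have "?F i S < \<infinity>" .
  moreover have "p * (p - 1) ^ card S * 1 ^ (card S + 1) / real (card S + 1) > 0"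
    using p by simp
  moreover have "c < \<infinity>" if "ennreal K * c < \<infinity>" "K > 0" for K c
    using that by (auto simp: ennreal_mult_less_top)
  ultimately show ?thesis by blast
qed

text \<open>Every pair m, j is realised by an index set with m + j + 1 elements and a subset S of
  size m. This finiteness is the source of the integrability and of the majorants in the asymptotic
  arguments.\<close>

lemma theta_integral_finite:
  assumes p: "p > 1" shows "theta_integral p m j < \<infinity>"
proof -
  let ?I = "{..<m + j + 1}" and ?S = "{1..<m + 1}"
  have sub: "?S \<subseteq> ?I - {0}" by auto
  have "card ?S = m" "card ?I - 1 - m = j" by auto
  then have "theta_integral p m j = ennreal (Gamma ((real m + 1) / 2) * Gamma ((real (card ?I) + p - 1 - real m) / p + 1)) *
      shell_integral p ?I 0 ?S 1"
    using shell_integral_eq[OF p finite_lessThan _ sub] by simp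
  moreover have "shell_integral p ?I 0 ?S 1 < \<infinity>" using p by (intro shell_integral_finite) auto
  ultimately show ?thesis by (simp add: ennreal_mult_less_top)
qed

text \<open>
  The volume of the parallel body is monotone in \<open>\<tau>\<close>, so its value at \<open>\<tau> = 1\<close> can be read off
  from the derivative at \<open>1\<close> of the integral over \<open>{0<..T}\<close>.
\<close>

lemma measure_pbody:
  assumes p: "p > 1" and t: "t > 0" and I: "finite I"
  shows "measure (PiM I (\<lambda>_. lborel)) (pbody p I t 1) = measure (PiM I (\<lambda>_. lborel)) (pball p I 1) +
    (\<Sum>i\<in>I. \<Sum>S\<in>Pow (I - {i}). p * (p - 1) ^ card S * t ^ (card S + 1) / real (card S + 1) *
       ((real (card I) + p - 1 - real (card S)) / p * enn2real (shell_integral p I i S 1)))"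
proof -
  let ?P = "PiM I (\<lambda>_. lborel :: real measure)"
  interpret P: sigma_finite_measure ?P by (rule sigma_finite_PiM_lborel[OF I])
  note measurable_psi2[OF p, measurable] measurable_rho[OF p, measurable]
    measurable_near[OF p, measurable]
  have t0: "t \<ge> 0" using t by simp
  define V where "V = (\<lambda>\<tau>. measure ?P (pbody p I t \<tau>))"
  define B where "B = (\<lambda>\<tau>. measure ?P (pball p I \<tau>))"
  define e where "e = (\<lambda>S :: nat set. (real (card I) + p - 1 - real (card S)) / p)"
  define k where "k = (\<lambda>S :: nat set. p * (p - 1) ^ card S * t ^ (card S + 1) / real (card S + 1))"
  define c where "c = (\<lambda>i S. enn2real (shell_integral p I i S 1))"
  define Q where "Q = (\<lambda>T. \<Sum>i\<in>I. \<Sum>S\<in>Pow (I - {i}). k S * (T powr e S * c i S))"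
  define D where "D = (\<Sum>i\<in>I. \<Sum>S\<in>Pow (I - {i}). k S * (e S * c i S))"
  define f where "f = (\<lambda>\<tau>. emeasure ?P (pbody p I t \<tau> - pball p I \<tau>))"
  have k0: "k S \<ge> 0" for S using p t by (simp add: k_def)
  have c0: "c i S \<ge> 0" for i S by (simp add: c_def)
  have fin: "emeasure ?P (pbody p I t \<tau>) < \<infinity>" if "\<tau> > 0" for \<tau>
    by (rule emeasure_pbody_finite[OF p t0 I that])
  have fmV: "pbody p I t \<tau> \<in> fmeasurable ?P" if "\<tau> > 0" for \<tau>
    using fin[OF that] sets_pbody[OF p t0 I that] by (intro fmeasurableI) auto
  have fmB: "pball p I \<tau> \<in> fmeasurable ?P" if "\<tau> > 0" for \<tau>
    by (rule fmeasurableI2[OF fmV[OF that] pball_subset_pbody sets_pball])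
  have Beq: "B \<tau> = \<tau> powr (real (card I) / p) * B 1" if "\<tau> > 0" for \<tau>
    using emeasure_pball_scaling[OF p I that] unfolding B_def measure_def by (simp add: enn2real_mult)
  have F: "(\<integral>\<^sup>+\<tau>\<in>{0<..T}. f \<tau> \<partial>lborel) = ennreal (Q T)" if "T > 0" for T
  proof -
    have "(\<integral>\<^sup>+\<tau>\<in>{0<..T}. f \<tau> \<partial>lborel) = (\<Sum>i\<in>I. \<Sum>S\<in>Pow (I - {i}). ennreal (k S) * shell_integral p I i S T)"
      unfolding f_def k_def by (rule nn_integral_emeasure_pbody_shell_integral[OF p t I that])
    also have "\<dots> = (\<Sum>i\<in>I. \<Sum>S\<in>Pow (I - {i}). ennreal (k S * (T powr e S * c i S)))"
    proof (intro sum.cong refl)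
      fix i S assume iS: "i \<in> I" "S \<in> Pow (I - {i})"
      have "shell_integral p I i S 1 = ennreal (c i S)"
        unfolding c_def using shell_integral_finite[OF p I, of i S] iS by (simp add: less_top)
      then have "shell_integral p I i S T = ennreal (T powr e S * c i S)"
        using shell_integral_scaling[OF p I, of i S T] iS that by (simp add: e_def ennreal_mult' c0)
      then show "ennreal (k S) * shell_integral p I i S T = ennreal (k S * (T powr e S * c i S))"
        using k0 by (simp add: ennreal_mult')
    qed
    also have "\<dots> = ennreal (Q T)"
      unfolding Q_def using k0 c0 by (simp add: sum_nonneg flip: sum_ennreal)
    finally show ?thesis .
  qed
  have Q0: "Q T \<ge> 0" for T unfolding Q_def using k0 c0 by (intro sum_nonneg) auto
  \<comment> \<open>The volume of the shell is a section integral of a jointly measurable function,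
    because \<open>near\<close> describes membership; this gives measurability in \<tau>.\<close>
  have mf: "(\<lambda>\<tau>. f \<tau> * indicator {0<..} \<tau>) \<in> borel_measurable lborel"
  proof -
    have "(\<lambda>z. indicator {z. 0 < fst z \<and> fst z < rho p I (snd z) 0 \<and> near p I t (fst z) (snd z)} z :: ennreal)
        \<in> borel_measurable (lborel \<Otimes>\<^sub>M ?P)"
      unfolding indicator_def mem_Collect_eq by measurable
    then have "(\<lambda>(\<tau>, x). indicator {z. 0 < fst z \<and> fst z < rho p I (snd z) 0 \<and> near p I t (fst z) (snd z)} (\<tau>, x) :: ennreal)
        \<in> borel_measurable (lborel \<Otimes>\<^sub>M ?P)" by (simp add: split_beta')
    then have "(\<lambda>\<tau>. \<integral>\<^sup>+x. indicator {z. 0 < fst z \<and> fst z < rho p I (snd z) 0 \<and> near p I t (fst z) (snd z)} (\<tau>, x) \<partial>?P)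
        \<in> borel_measurable lborel"
      by (rule P.borel_measurable_nn_integral)
    also have "(\<lambda>\<tau>. \<integral>\<^sup>+x. indicator {z. 0 < fst z \<and> fst z < rho p I (snd z) 0 \<and> near p I t (fst z) (snd z)} (\<tau>, x) \<partial>?P) =
        (\<lambda>\<tau>. f \<tau> * indicator {0<..} \<tau>)"
    proof (rule ext)
      fix \<tau> :: real
      show "(\<integral>\<^sup>+x. indicator {z. 0 < fst z \<and> fst z < rho p I (snd z) 0 \<and> near p I t (fst z) (snd z)} (\<tau>, x) \<partial>?P) =
        f \<tau> * indicator {0<..} \<tau>"
      proof (cases "\<tau> > 0")
        case True
        then have *: "pbody p I t \<tau> - pball p I \<tau> \<in> sets ?P" by (intro sets.Diff sets_pbody p t0 I sets_pball)
        have "(\<integral>\<^sup>+x. indicator {z. 0 < fst z \<and> fst z < rho p I (snd z) 0 \<and> near p I t (fst z) (snd z)} (\<tau>, x) \<partial>?P) =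
            (\<integral>\<^sup>+x. indicator (pbody p I t \<tau> - pball p I \<tau>) x \<partial>?P)"
        proof (rule nn_integral_cong)
          fix x assume "x \<in> space ?P"
          then have x: "x \<in> I \<rightarrow>\<^sub>E UNIV" by (simp add: space_PiM)
          have "x \<in> pball p I \<tau> \<longleftrightarrow> \<not> \<tau> < rho p I x 0"
            using x p by (auto simp: pball_def rho_0)
          then show "indicator {z. 0 < fst z \<and> fst z < rho p I (snd z) 0 \<and> near p I t (fst z) (snd z)} (\<tau>, x) =
              (indicator (pbody p I t \<tau> - pball p I \<tau>) x :: ennreal)"
            using mem_pbody_iff_near[OF p t0 I x True] True by (auto simp: indicator_def)
        qed
        also have "\<dots> = f \<tau>" using * by (simp add: f_def)
        finally show ?thesis using True by simp
      qed (simp add: indicator_def)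
    qed
    finally show ?thesis .
  qed
  have split: "ennreal (Q b) = ennreal (Q a) + (\<integral>\<^sup>+\<tau>\<in>{a<..b}. f \<tau> \<partial>lborel)" if ab: "0 < a" "a \<le> b" for a b
  proof -
    have "ennreal (Q b) = (\<integral>\<^sup>+\<tau>. f \<tau> * indicator {0<..b} \<tau> \<partial>lborel)" using F[of b] ab by simp
    also have "\<dots> = (\<integral>\<^sup>+\<tau>. (f \<tau> * indicator {0<..} \<tau>) * indicator {..a} \<tau> +
        (f \<tau> * indicator {0<..} \<tau>) * indicator {a<..b} \<tau> \<partial>lborel)"
      using ab by (intro nn_integral_cong) (auto simp: indicator_def)
    also have "\<dots> = (\<integral>\<^sup>+\<tau>. (f \<tau> * indicator {0<..} \<tau>) * indicator {..a} \<tau> \<partial>lborel) +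
        (\<integral>\<^sup>+\<tau>. (f \<tau> * indicator {0<..} \<tau>) * indicator {a<..b} \<tau> \<partial>lborel)"
      by (intro nn_integral_add borel_measurable_times_ennreal mf) auto
    also have "(\<integral>\<^sup>+\<tau>. (f \<tau> * indicator {0<..} \<tau>) * indicator {..a} \<tau> \<partial>lborel) = (\<integral>\<^sup>+\<tau>\<in>{0<..a}. f \<tau> \<partial>lborel)"
      by (intro nn_integral_cong) (auto simp: indicator_def)
    also have "\<dots> = ennreal (Q a)" using F[of a] ab by simp
    also have "(\<integral>\<^sup>+\<tau>. (f \<tau> * indicator {0<..} \<tau>) * indicator {a<..b} \<tau> \<partial>lborel) = (\<integral>\<^sup>+\<tau>\<in>{a<..b}. f \<tau> \<partial>lborel)"
      using ab by (intro nn_integral_cong) (auto simp: indicator_def)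
    finally show ?thesis .
  qed
  \<comment> \<open>For \<tau> in (a, b] the body contains the one of level a, and the ball is
    contained in the one of level b.\<close>
  have lower: "(b - a) * (V a - B b) \<le> Q b - Q a" if ab: "0 < a" "a \<le> b" for a b
  proof (cases "V a - B b \<ge> 0")
    case True
    have "ennreal ((b - a) * (V a - B b)) = (\<integral>\<^sup>+\<tau>. ennreal (V a - B b) * indicator {a<..b} \<tau> \<partial>lborel)"
      using ab True by (subst nn_integral_cmult_indicator) (simp_all add: ennreal_mult' mult.commute)
    also have "\<dots> \<le> (\<integral>\<^sup>+\<tau>\<in>{a<..b}. f \<tau> \<partial>lborel)"
    proof (rule nn_integral_mono)
      fix \<tau> :: real
      show "ennreal (V a - B b) * indicator {a<..b} \<tau> \<le> f \<tau> * indicator {a<..b} \<tau>"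
      proof (cases "\<tau> \<in> {a<..b}")
        case True
        then have \<tau>: "\<tau> > 0" using ab by auto
        have "V \<tau> = measure ?P ((pbody p I t \<tau> - pball p I \<tau>) \<union> pball p I \<tau>)"
          unfolding V_def using pball_subset_pbody[of p I \<tau> t] by (simp add: Un_absorb2)
        also have "\<dots> \<le> measure ?P (pbody p I t \<tau> - pball p I \<tau>) + B \<tau>"
          unfolding B_def using sets_pbody[OF p t0 I \<tau>] by (intro measure_Un_le) auto
        finally have 1: "V \<tau> - B \<tau> \<le> measure ?P (pbody p I t \<tau> - pball p I \<tau>)" by simp
        have 2: "V a \<le> V \<tau>" unfolding V_def using True ab fmV[OF \<tau>] sets_pbody[OF p t0 I, of a]
          by (intro measure_mono_fmeasurable pbody_mono) auto
        have 3: "B \<tau> \<le> B b" unfolding B_def using True ab fmB[of b]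
          by (intro measure_mono_fmeasurable pball_mono sets_pball) auto
        have "pbody p I t \<tau> - pball p I \<tau> \<in> fmeasurable ?P"
          using fmV[OF \<tau>] fmB[OF \<tau>] by (intro fmeasurable.Diff)
        then have "f \<tau> = ennreal (measure ?P (pbody p I t \<tau> - pball p I \<tau>))"
          unfolding f_def by (intro emeasure_eq_measure2)
        then show ?thesis using 1 2 3 True by (simp add: ennreal_leI)
      qed simp
    qed
    finally have "ennreal (Q a) + ennreal ((b - a) * (V a - B b)) \<le> ennreal (Q b)"
      unfolding split[OF ab] by (intro add_left_mono)
    then have "ennreal (Q a + (b - a) * (V a - B b)) \<le> ennreal (Q b)"
      using Q0 True ab by (simp add: ennreal_plus)
    then show ?thesis using Q0 by (simp add: ennreal_le_iff)
  next
    case False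
    then have "(b - a) * (V a - B b) \<le> 0" using ab by (intro mult_nonneg_nonpos) auto
    moreover have "Q a \<le> Q b"
    proof -
      have "ennreal (Q a) \<le> ennreal (Q b)" unfolding split[OF ab] by simp
      then show ?thesis using Q0 by (simp add: ennreal_le_iff)
    qed
    ultimately show ?thesis by simp
  qed
  \<comment> \<open>The opposite comparison: for \<tau> in (a, b] the shell lies in the body of
    level b without the ball of level a.\<close>
  have upper: "Q b - Q a \<le> (b - a) * (V b - B a)" if ab: "0 < a" "a \<le> b" for a b
  proof -
    have fmd: "pbody p I t b - pball p I a \<in> fmeasurable ?P"
      using fmV[of b] fmB[of a] ab by (intro fmeasurable.Diff) auto
    have "pball p I a \<subseteq> pbody p I t b" using pball_subset_pbody pbody_mono[OF ab(2)] by blast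
    then have md: "measure ?P (pbody p I t b - pball p I a) = V b - B a"
      unfolding V_def B_def using fin[of b] ab sets_pbody[OF p t0 I, of b]
      by (intro measure_Diff) auto
    then have nn: "V b - B a \<ge> 0" by (metis measure_nonneg)
    have "(\<integral>\<^sup>+\<tau>\<in>{a<..b}. f \<tau> \<partial>lborel) \<le> (\<integral>\<^sup>+\<tau>. ennreal (V b - B a) * indicator {a<..b} \<tau> \<partial>lborel)"
    proof (rule nn_integral_mono)
      fix \<tau> :: real
      show "f \<tau> * indicator {a<..b} \<tau> \<le> ennreal (V b - B a) * indicator {a<..b} \<tau>"
      proof (cases "\<tau> \<in> {a<..b}")
        case True
        have "pbody p I t \<tau> - pball p I \<tau> \<subseteq> pbody p I t b - pball p I a"
          using pbody_mono[of \<tau> b p I t] pball_mono[of a \<tau> p I] True by auto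
        then have "f \<tau> \<le> emeasure ?P (pbody p I t b - pball p I a)"
          unfolding f_def using fmd by (intro emeasure_mono) auto
        also have "\<dots> = ennreal (V b - B a)"
          using emeasure_eq_measure2[OF fmd] md by simp
        finally show ?thesis using True by simp
      qed simp
    qed
    also have "\<dots> = ennreal ((b - a) * (V b - B a))"
      using ab nn by (subst nn_integral_cmult_indicator) (simp_all add: ennreal_mult' mult.commute)
    finally have "ennreal (Q b) \<le> ennreal (Q a) + ennreal ((b - a) * (V b - B a))"
      unfolding split[OF ab] by (intro add_left_mono)
    then have "ennreal (Q b) \<le> ennreal (Q a + (b - a) * (V b - B a))"
      using Q0 nn ab by (simp add: ennreal_plus)
    moreover have "0 \<le> Q a + (b - a) * (V b - B a)" using Q0 nn ab by simp
    ultimately show ?thesis by (simp add: ennreal_le_iff)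
  qed
  have "(Q has_real_derivative D) (at 1)"
    unfolding Q_def D_def by (intro DERIV_sum) (auto intro!: derivative_eq_intros)
  then have dQ: "((\<lambda>y. (Q y - Q 1) / (y - 1)) \<longlongrightarrow> D) (at 1)"
    by (simp add: has_field_derivative_iff)
  have "isCont (\<lambda>\<tau>. \<tau> powr (real (card I) / p) * B 1) 1"
    by (intro continuous_intros) auto
  then have lim: "((\<lambda>\<tau>. \<tau> powr (real (card I) / p) * B 1) \<longlongrightarrow> B 1) (at 1)"
    by (simp add: isCont_def)
  have "eventually (\<lambda>\<tau>. \<tau> \<in> {0<..}) (at (1::real))"
    by (rule eventually_at_in_open') auto
  then have "eventually (\<lambda>\<tau>. \<tau> powr (real (card I) / p) * B 1 = B \<tau>) (at 1)"
  proof eventually_elim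
    case (elim \<tau>)
    then show ?case using Beq[of \<tau>] by simp
  qed
  with lim have tB: "(B \<longlongrightarrow> B 1) (at 1)" by (rule Lim_transform_eventually)
  \<comment> \<open>\<open>V\<close> is known to be monotone only, so \<open>V 1\<close> is
    squeezed: difference quotients of \<open>Q\<close> from the right bound it above, those from the
    left bound it below. \<open>B\<close> is continuous by homogeneity.\<close>
  have "V 1 - B 1 \<le> D"
  proof (rule tendsto_le[OF trivial_limit_at_right_real])
    show "((\<lambda>y. (Q y - Q 1) / (y - 1)) \<longlongrightarrow> D) (at_right 1)"
      using dQ by (rule filterlim_mono) (auto simp: at_within_le_at)
    show "((\<lambda>y. V 1 - B y) \<longlongrightarrow> V 1 - B 1) (at_right 1)"
      using tB by (intro tendsto_diff tendsto_const filterlim_mono[OF tB]) (auto simp: at_within_le_at)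
    show "\<forall>\<^sub>F y in at_right 1. V 1 - B y \<le> (Q y - Q 1) / (y - 1)"
      using eventually_at_right_less[of "1::real"]
    proof eventually_elim
      case (elim y)
      then show ?case using lower[of 1 y] by (simp add: pos_le_divide_eq mult.commute)
    qed
  qed
  moreover have "D \<le> V 1 - B 1"
  proof (rule tendsto_le[OF trivial_limit_at_left_real])
    show "((\<lambda>y. (Q y - Q 1) / (y - 1)) \<longlongrightarrow> D) (at_left 1)"
      using dQ by (rule filterlim_mono) (auto simp: at_within_le_at)
    show "((\<lambda>y. V 1 - B y) \<longlongrightarrow> V 1 - B 1) (at_left 1)"
      using tB by (intro tendsto_diff tendsto_const filterlim_mono[OF tB]) (auto simp: at_within_le_at)
    have "eventually (\<lambda>y::real. y \<in> {0<..<1}) (at_left 1)"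
      using eventually_at_left_real[of 0 "1::real"] by simp
    then show "\<forall>\<^sub>F y in at_left 1. (Q y - Q 1) / (y - 1) \<le> V 1 - B y"
    proof eventually_elim
      case (elim y)
      have "(Q y - Q 1) / (y - 1) = (Q 1 - Q y) / (1 - y)"
        by (metis minus_diff_eq minus_divide_divide)
      then show ?case using upper[of y 1] elim by (simp add: pos_divide_le_eq mult.commute)
    qed
  qed
  ultimately have "V 1 = B 1 + D" by simp
  then show ?thesis by (simp add: V_def B_def D_def k_def e_def c_def)
qed

section \<open>Intrinsic volumes\<close>

lemma sum_Pow_card:
  fixes f :: "nat \<Rightarrow> real"
  assumes "finite A"
  shows "(\<Sum>S\<in>Pow A. f (card S)) = (\<Sum>k\<le>card A. real (card A choose k) * f k)"
proof -
  have "(\<Sum>S\<in>Pow A. f (card S)) = (\<Sum>k\<le>card A. \<Sum>S\<in>{S \<in> Pow A. card S = k}. f (card S))"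
    using assms by (intro sum.group[symmetric]) (auto intro: card_mono)
  also have "\<dots> = (\<Sum>k\<le>card A. real (card A choose k) * f k)"
  proof (intro sum.cong refl)
    fix k
    have "{S \<in> Pow A. card S = k} = {S. S \<subseteq> A \<and> card S = k}" by auto
    then show "(\<Sum>S\<in>{S \<in> Pow A. card S = k}. f (card S)) = real (card A choose k) * f k"
      using n_subsets[OF assms, of k] by simp
  qed
  finally show ?thesis .
qed

lemma euclidean_volume_unit_ball: "euclidean_volume k (lp_ball 2 k) = unit_ball_vol (real k)"
proof -
  let ?P = "PiM {..<k} (\<lambda>_. lborel :: real measure)"
  have "lp_ball 2 k = {f. sqrt (\<Sum>i<k. (f i)\<^sup>2) \<le> 1} \<inter> space ?P"
    by (auto simp: lp_ball_def space_PiM real_sqrt_le_1_iff)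
  then have "emeasure ?P (lp_ball 2 k) = ennreal (unit_ball_vol (real k))"
    using emeasure_cball_aux[of "{..<k}" 1] by simp
  then show ?thesis by (simp add: euclidean_volume_def measure_def)
qed

lemma lp_ball_eq_pball: "lp_ball p n = pball p {..<n} 1"
  by (simp add: lp_ball_def pball_def)

lemma parallel_body_eq_pbody: "parallel_body n (lp_ball p n) t = pbody p {..<n} t 1"
  by (simp add: parallel_body_def pbody_def lp_ball_eq_pball)

lemma pbody_0: "pbody p I 0 \<tau> = pball p I \<tau>"
proof
  show "pbody p I 0 \<tau> \<subseteq> pball p I \<tau>"
    unfolding pbody_def
  proof (intro subsetI, elim CollectE exE conjE)
    fix z x y assume z: "z = (\<lambda>i\<in>I. x i + 0 * y i)" and x: "x \<in> pball p I \<tau>"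
    have "z = x" 
    proof (rule ext)
      fix i show "z i = x i" using x PiE_arb[of x I "\<lambda>_. UNIV" i] z by (cases "i \<in> I") (auto simp: pball_def)
    qed
    then show "z \<in> pball p I \<tau>" using x by simp
  qed
qed (rule pball_subset_pbody)

text \<open>A polynomial vanishing for all t \<ge> 0 has infinitely many roots, and unit ball
  volumes are positive, so the Steiner coefficients are determined. Cutting the candidate off beyond
  n matches the normalisation in the definition.\<close>

lemma intrinsic_volume_eqI:
  assumes ex: "\<And>t. t \<ge> 0 \<Longrightarrow> euclidean_volume n (parallel_body n K t) =
      (\<Sum>j\<le>n. unit_ball_vol (real (n - j)) * W j * t ^ (n - j))"
    and j: "j \<le> n"
  shows "intrinsic_volume n K j = W j"
proof -
  define W' where "W' = (\<lambda>j. if j \<le> n then W j else 0)"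
  have ex': "euclidean_volume n (parallel_body n K t) =
      (\<Sum>j\<le>n. unit_ball_vol (real (n - j)) * W' j * t ^ (n - j))" if "t \<ge> 0" for t
    unfolding ex[OF that] by (intro sum.cong) (auto simp: W'_def)
  have "intrinsic_volume n K = W'"
    unfolding intrinsic_volume_def euclidean_volume_unit_ball
  proof (rule the_equality)
    show "(\<forall>j>n. W' j = 0) \<and> (\<forall>t\<ge>0. euclidean_volume n (parallel_body n K t) =
        (\<Sum>j\<le>n. unit_ball_vol (real (n - j)) * W' j * t ^ (n - j)))"
      using ex' by (simp add: W'_def)
  next
    fix V assume V: "(\<forall>j>n. V j = 0) \<and> (\<forall>t\<ge>0. euclidean_volume n (parallel_body n K t) =
        (\<Sum>j\<le>n. unit_ball_vol (real (n - j)) * V j * t ^ (n - j)))"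
    define c where "c = (\<lambda>i. unit_ball_vol (real i) * (V (n - i) - W' (n - i)))"
    have c0: "(\<Sum>i\<le>n. c i * t ^ i) = 0" if "t \<ge> 0" for t
    proof -
      have "(\<Sum>j\<le>n. unit_ball_vol (real (n - j)) * V j * t ^ (n - j)) =
          (\<Sum>j\<le>n. unit_ball_vol (real (n - j)) * W' j * t ^ (n - j))"
        using V ex'[OF that] that by simp
      then have "(\<Sum>j\<le>n. c (n - j) * t ^ (n - j)) = 0"
        by (simp add: c_def right_diff_distrib left_diff_distrib sum_subtractf)
      also have "(\<Sum>j\<le>n. c (n - j) * t ^ (n - j)) = (\<Sum>i\<le>n. c i * t ^ i)"
        by (rule sum.reindex_bij_witness[of _ "\<lambda>i. n - i" "\<lambda>i. n - i"]) auto
      finally show ?thesis .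
    qed
    have "infinite {0::real..}" by (simp add: infinite_Ici)
    then have "infinite {t. (\<Sum>i\<le>n. c i * t ^ i) = 0}"
      by (rule infinite_super[rotated]) (use c0 in auto)
    then have "c i = 0" if "i \<le> n" for i
      using polyfun_finite_roots[of c n] that by blast
    then have "V (n - i) = W' (n - i)" if "i \<le> n" for i
      using that unit_ball_vol_pos[of "real i"] unfolding c_def by (metis eq_iff_diff_eq_0 less_irrefl mult_eq_0_iff of_nat_0_le_iff)
    then have "V j = W' j" if "j \<le> n" for j
      using that by (metis diff_diff_cancel diff_le_self)
    moreover have "V j = W' j" if "\<not> j \<le> n" for j using that V by (simp add: W'_def)
    ultimately show "V = W'" by blast
  qed
  then show ?thesis using j by (simp add: W'_def)
qed

text \<open>Comparison of coefficients with m = n - j - 1. The choice of i contributes n and the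
  choice of S the binomial coefficient. The exponent e produced by the \<tau>-derivative cancels in
  Gamma(e + 1) = e Gamma(e), and the unit ball volume absorbs m + 1 and Gamma((m + 1) / 2) up to the
  factor 2.\<close>

lemma intrinsic_volume_lp_ball:
  assumes p: "p > 1" and j: "j < n"
  shows "intrinsic_volume n (lp_ball p n) j =
    p * (p - 1) ^ (n - j - 1) * real n * real ((n - 1) choose j) /
      (2 * pi powr ((real n - real j) / 2) * Gamma ((real j + p) / p)) * enn2real (theta_integral p (n - j - 1) j)"
proof -
  define I where "I = {..<n}"
  let ?P = "PiM I (\<lambda>_. lborel :: real measure)"
  define A where "A = (\<lambda>m. real n * real ((n - 1) choose m) * (p * (p - 1) ^ m) /
      (real (m + 1) * Gamma ((real m + 1) / 2) * Gamma ((real n + p - 1 - real m) / p)) * enn2real (theta_integral p m (n - 1 - m)))"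
  have n: "n > 0" using j by simp
  have vol: "measure ?P (pbody p I t 1) = measure ?P (pball p I 1) + (\<Sum>m<n. A m * t ^ (m + 1))" if t: "t > 0" for t
  proof -
    have "p * (p - 1) ^ card S * t ^ (card S + 1) / real (card S + 1) *
       ((real (card I) + p - 1 - real (card S)) / p * enn2real (shell_integral p I i S 1)) =
       (p * (p - 1) ^ card S) /
      (real (card S + 1) * Gamma ((real (card S) + 1) / 2) * Gamma ((real n + p - 1 - real (card S)) / p)) *
         enn2real (theta_integral p (card S) (n - 1 - card S)) * t ^ (card S + 1)"
      if iS: "i \<in> I" "S \<in> Pow (I - {i})" for i S
    proof -
      define m where "m = card S"
      define e where "e = (real n + p - 1 - real m) / p"
      have "m \<le> n - 1" using card_mono[of "I - {i}" S] iS by (simp add: I_def m_def)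
      then have e: "e > 0" using p n by (simp add: e_def of_nat_diff)
      have G: "Gamma ((real m + 1) / 2) > 0" "Gamma e > 0" "Gamma (e + 1) = e * Gamma e"
        using e by (auto intro!: Gamma_real_pos Gamma_plus1 simp: nonpos_Ints_def)
      have "theta_integral p m (n - 1 - m) = ennreal (Gamma ((real m + 1) / 2) * Gamma (e + 1)) * shell_integral p I i S 1"
        using shell_integral_eq[OF p, of I i S] iS by (simp add: I_def m_def e_def)
      then have "enn2real (theta_integral p m (n - 1 - m)) = Gamma ((real m + 1) / 2) * (e * Gamma e) * enn2real (shell_integral p I i S 1)"
        using G e by (simp add: enn2real_mult)
      moreover have "z = g1 * (e * g2) * x \<Longrightarrow> g1 > 0 \<Longrightarrow> g2 > 0 \<Longrightarrow> e * x = z / (g1 * g2)" for z x g1 g2 :: real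
        by (simp add: field_simps)
      ultimately have "e * enn2real (shell_integral p I i S 1) = enn2real (theta_integral p m (n - 1 - m)) / (Gamma ((real m + 1) / 2) * Gamma e)"
        using G(1,2) by blast
      moreover have "card I = n" by (simp add: I_def)
      ultimately show ?thesis unfolding m_def[symmetric] e_def[symmetric]
        by (simp add: e_def[symmetric] mult_ac del: power_Suc)
    qed
    then have "(\<Sum>i\<in>I. \<Sum>S\<in>Pow (I - {i}). p * (p - 1) ^ card S * t ^ (card S + 1) / real (card S + 1) *
       ((real (card I) + p - 1 - real (card S)) / p * enn2real (shell_integral p I i S 1))) =
       (\<Sum>i\<in>I. \<Sum>S\<in>Pow (I - {i}). (\<lambda>m. (p * (p - 1) ^ m) /
      (real (m + 1) * Gamma ((real m + 1) / 2) * Gamma ((real n + p - 1 - real m) / p)) *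
         enn2real (theta_integral p m (n - 1 - m)) * t ^ (m + 1)) (card S))"
      by (intro sum.cong refl) blast
    also have "\<dots> = (\<Sum>i\<in>I. \<Sum>m\<le>n - 1. real ((n - 1) choose m) * ((p * (p - 1) ^ m) /
      (real (m + 1) * Gamma ((real m + 1) / 2) * Gamma ((real n + p - 1 - real m) / p)) *
         enn2real (theta_integral p m (n - 1 - m)) * t ^ (m + 1)))"
    proof (rule sum.cong[OF refl])
      fix i assume "i \<in> I"
      then have "card (I - {i}) = n - 1" "finite (I - {i})" by (simp_all add: I_def)
      then show "(\<Sum>S\<in>Pow (I - {i}). (\<lambda>m. (p * (p - 1) ^ m) /
      (real (m + 1) * Gamma ((real m + 1) / 2) * Gamma ((real n + p - 1 - real m) / p)) *
         enn2real (theta_integral p m (n - 1 - m)) * t ^ (m + 1)) (card S)) = (\<Sum>m\<le>n - 1. real ((n - 1) choose m) * ((p * (p - 1) ^ m) /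
      (real (m + 1) * Gamma ((real m + 1) / 2) * Gamma ((real n + p - 1 - real m) / p)) *
         enn2real (theta_integral p m (n - 1 - m)) * t ^ (m + 1)))"
        by (subst sum_Pow_card) auto
    qed
    also have "\<dots> = (\<Sum>m\<le>n - 1. A m * t ^ (m + 1))"
      by (simp add: I_def A_def sum_distrib_left mult.assoc)
    also have "{..n - 1} = {..<n}" using n by auto
    finally show ?thesis using measure_pbody[OF p t, of I] by (simp add: I_def)
  qed
  \<comment> \<open>For j = n this is the constant term, the volume of the ball itself, to which the
    shell contributes nothing.\<close>
  define W where "W = (\<lambda>j. if j = n then measure ?P (pball p I 1) else A (n - j - 1) / unit_ball_vol (real (n - j)))"
  have "intrinsic_volume n (lp_ball p n) j = W j"
  proof (rule intrinsic_volume_eqI)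
    fix t :: real assume t: "t \<ge> 0"
    have "(\<Sum>j\<le>n. unit_ball_vol (real (n - j)) * W j * t ^ (n - j)) =
       (\<Sum>j<n. unit_ball_vol (real (n - j)) * W j * t ^ (n - j)) + unit_ball_vol 0 * W n"
      by (simp add: lessThan_Suc_atMost[symmetric])
    also have "(\<Sum>j<n. unit_ball_vol (real (n - j)) * W j * t ^ (n - j)) = (\<Sum>j<n. A (n - Suc j) * t ^ (n - Suc j + 1))"
    proof (rule sum.cong[OF refl])
      fix j assume "j \<in> {..<n}"
      then have nj: "n - j = n - Suc j + 1" "j \<noteq> n" by auto
      have "u * (A (n - j - 1) / u) = A (n - Suc j)" if "u > 0" for u using that by simp
      from this[of "unit_ball_vol (real (n - j))"]
      have "unit_ball_vol (real (n - j)) * W j = A (n - Suc j)"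
        using nj unfolding W_def by (simp del: of_nat_diff)
      then show "unit_ball_vol (real (n - j)) * W j * t ^ (n - j) = A (n - Suc j) * t ^ (n - Suc j + 1)"
        using nj(1) by (simp only:)
    qed
    also have "\<dots> = (\<Sum>m<n. A m * t ^ (m + 1))"
      by (rule sum.nat_diff_reindex)
    also have "\<dots> + unit_ball_vol 0 * W n = measure ?P (pbody p I t 1)"
    proof (cases "t = 0")
      case True
      then show ?thesis by (simp add: W_def pbody_0)
    next
      case False
      then show ?thesis using vol[of t] t by (simp add: W_def)
    qed
    finally show "euclidean_volume n (parallel_body n (lp_ball p n) t) =
      (\<Sum>j\<le>n. unit_ball_vol (real (n - j)) * W j * t ^ (n - j))"
      by (simp add: euclidean_volume_def parallel_body_eq_pbody I_def)
  qed (use j in simp)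
  also have "W j = A (n - j - 1) / unit_ball_vol (real (n - j))" using j by (simp add: W_def)
  also have "\<dots> = p * (p - 1) ^ (n - j - 1) * real n * real ((n - 1) choose j) /
      (2 * pi powr ((real n - real j) / 2) * Gamma ((real j + p) / p)) * enn2real (theta_integral p (n - j - 1) j)"
  proof -
    define m where "m = n - j - 1"
    have m: "n - j = m + 1" "n - 1 - m = j" "real n - real j = real m + 1" "real n + p - 1 - real m = real j + p"
      using j by (auto simp: m_def of_nat_diff)
    have ch: "(n - 1) choose m = (n - 1) choose j"
      using binomial_symmetric[of j "n - 1"] j by (simp add: m_def diff_right_commute)
    have G: "Gamma ((real m + 1) / 2 + 1) = (real m + 1) / 2 * Gamma ((real m + 1) / 2)"
      by (rule Gamma_plus1) (auto simp: nonpos_Ints_def)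
    have pos: "Gamma ((real m + 1) / 2) > 0" "Gamma ((real j + p) / p) > 0" "real m + 1 > 0"
      using p by (auto intro!: Gamma_real_pos)
    have u: "unit_ball_vol (real m + 1) = pi powr ((real m + 1) / 2) / ((real m + 1) / 2 * Gamma ((real m + 1) / 2))"
      unfolding unit_ball_vol_def G ..
    have alg: "real n * C * (p * q) / (k * g1 * g2) * M / (P / (k / 2 * g1)) =
        p * q * real n * C / (2 * P * g2) * M" if "g1 > 0" "g2 > 0" "P > 0" "k > 0" for C q g1 g2 M P k :: real
      using that by (simp add: field_simps)
    show ?thesis
      unfolding m add_diff_cancel_right' A_def ch of_nat_add of_nat_1 u by (rule alg) (use pos in auto)
  qed
  finally show ?thesis .
qed

section \<open>A Watson-type lemma\<close>

lemma has_bochner_integral_Gamma: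
  fixes a q :: real
  assumes a: "a > 0" and q: "q > 0"
  shows "has_bochner_integral lborel (\<lambda>x. indicator {0<..} x * (x powr (a - 1) * exp (- q * x))) (Gamma a * q powr (- a))"
proof (rule has_bochner_integral_nn_integral)
  have "(\<integral>\<^sup>+x. ennreal (indicator {0<..} x * (x powr (a - 1) * exp (- q * x))) \<partial>lborel) =
    (\<integral>\<^sup>+x\<in>{0<..}. ennreal (x powr (a - 1) * exp (- q * x)) \<partial>lborel)"
    by (intro nn_integral_cong) (auto simp: indicator_def)
  then show "(\<integral>\<^sup>+x. ennreal (indicator {0<..} x * (x powr (a - 1) * exp (- q * x))) \<partial>lborel) =
      ennreal (Gamma a * q powr (- a))"
    using nn_integral_Gamma[OF a q] by simp
qed (use a q in \<open>auto simp: Gamma_real_pos less_imp_le\<close>)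

lemma tendsto_powr_times_power_0:
  fixes r :: real
  assumes "0 < r" "r < 1"
  shows "(\<lambda>n. real n powr \<sigma> * r ^ n) \<longlonglongrightarrow> 0"
proof -
  define l where "l = - ln r"
  have l: "l > 0" using assms by (simp add: l_def)
  have "r ^ n = exp (- l * real n)" for n
    using assms by (simp add: l_def mult.commute exp_of_nat_mult)
  moreover have "(\<lambda>n. real n powr \<sigma> * exp (- l * real n)) \<longlonglongrightarrow> 0"
    using l by real_asymp
  ultimately show ?thesis by simp
qed

text \<open>After x = y / N the factor (E x / E 0)^N tends to exp(-k y) with k = d / E 0, and a
  Gamma integral remains. A one-sided derivative at 0 and monotonicity suffice for \<open>E\<close>.
  Integrability is assumed at the single power N0 and passes to all larger ones, because E / E 0 is
  at most 1.\<close>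

lemma watson_asymptotics:
  fixes A E :: "real \<Rightarrow> real" and \<sigma> d :: real
  assumes \<sigma>: "\<sigma> > 0"
    and [measurable]: "A \<in> borel_measurable borel" "E \<in> borel_measurable borel"
    and A_nonneg: "\<And>x. x > 0 \<Longrightarrow> 0 \<le> A x"
    and A_lim: "(A \<longlongrightarrow> A0) (at_right 0)"
    and E_pos: "\<And>x. x \<ge> 0 \<Longrightarrow> 0 < E x"
    and E_anti: "\<And>x y. 0 \<le> x \<Longrightarrow> x \<le> y \<Longrightarrow> E y \<le> E x"
    and E_deriv: "(E has_real_derivative - d) (at 0 within {0..})"
    and d: "d > 0"
    and integ: "integrable lborel (\<lambda>x. indicator {0<..} x * (x powr (\<sigma> - 1) * A x * E x ^ N0))"
  shows "(\<lambda>N. real N powr \<sigma> * (\<integral>x. indicator {0<..} x * (x powr (\<sigma> - 1) * A x * E x ^ N) \<partial>lborel) / E 0 ^ N)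
    \<longlonglongrightarrow> A0 * Gamma \<sigma> * (d / E 0) powr (- \<sigma>)"
proof -
  have E0: "E 0 > 0" using E_pos by simp
  define F where "F = (\<lambda>x. E x / E 0)"
  have [measurable]: "F \<in> borel_measurable borel" unfolding F_def by measurable
  have F_pos: "F x > 0" if "x \<ge> 0" for x using E_pos[OF that] E0 by (simp add: F_def)
  have F_anti: "F y \<le> F x" if "0 \<le> x" "x \<le> y" for x y
    using E_anti[OF that] E0 by (simp add: F_def divide_right_mono)
  define k where "k = d / E 0"
  have k: "k > 0" using d E0 by (simp add: k_def)
  have F_deriv: "(F has_real_derivative - k) (at 0 within {0..})"
    unfolding F_def k_def using DERIV_cdivide[OF E_deriv, of "E 0"] by simp
  have F0: "F 0 = 1" using E0 by (simp add: F_def)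
  have quot: "((\<lambda>x. (F x - 1) / x) \<longlongrightarrow> - k) (at_right 0)"
    using F_deriv unfolding has_field_derivative_iff F0 at_within_Ici_at_right by simp
  \<comment> \<open>Near 0 the difference quotient of \<open>F\<close> is below -k/2, whence F x
    \<le> exp(-k x / 2). After rescaling this becomes a majorant independent of N.\<close>
  have ev: "eventually (\<lambda>x. (F x - 1) / x < - (k / 2) \<and> A x < A0 + 1) (at_right 0)"
    using order_tendstoD(2)[OF quot, of "- (k / 2)"] order_tendstoD(2)[OF A_lim, of "A0 + 1"] k
    by (auto intro: eventually_conj)
  then obtain b where b: "b > 0" "\<And>x. 0 < x \<Longrightarrow> x < b \<Longrightarrow> (F x - 1) / x < - (k / 2) \<and> A x < A0 + 1"
    unfolding eventually_at_right_field by blast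
  \<comment> \<open>Half of b, so that the estimates include the end point.\<close>
  define \<delta> where "\<delta> = b / 2"
  have \<delta>: "\<delta> > 0" "\<delta> < b" using b by (auto simp: \<delta>_def)
  have F_le: "F x \<le> exp (- (k / 2) * x)" if "0 < x" "x \<le> \<delta>" for x
  proof -
    have "F x - 1 < - (k / 2) * x" using b(2)[of x] that \<delta> by (simp add: pos_divide_less_eq)
    then show ?thesis using exp_ge_add_one_self[of "- (k / 2) * x"] by linarith
  qed
  have A_le: "A x \<le> A0 + 1" if "0 < x" "x \<le> \<delta>" for x using b(2)[of x] that \<delta> by auto
  have A1: "A0 + 1 \<ge> 0" using A_le[of \<delta>] A_nonneg[of \<delta>] \<delta> by simp
  have F\<delta>: "F \<delta> < 1" using F_le[of \<delta>] \<delta> k by (auto intro: le_less_trans)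
  define g where "g = (\<lambda>N::nat. \<lambda>x. x powr (\<sigma> - 1) * A x * F x ^ N)"
  have [measurable]: "g N \<in> borel_measurable borel" for N unfolding g_def by measurable
  have g_nonneg: "g N x \<ge> 0" if "x > 0" for N x
    unfolding g_def using A_nonneg[OF that] F_pos[of x] that by simp
  have "integrable lborel (\<lambda>x. (indicator {0<..} x * (x powr (\<sigma> - 1) * A x * E x ^ N0)) / E 0 ^ N0)"
    using integ by (rule integrable_divide_zero)
  then have g_int0: "integrable lborel (\<lambda>x. indicator {0<..} x * g N0 x)"
    by (simp add: g_def F_def power_divide)
  have g_le: "g N x \<le> F y ^ (N - N0) * g N0 x" if "N \<ge> N0" "0 \<le> y" "y \<le> x" "x > 0" for N x y
  proof -
    have "F x ^ N = F x ^ (N - N0) * F x ^ N0" using that by (simp flip: power_add)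
    also have "\<dots> \<le> F y ^ (N - N0) * F x ^ N0"
      using that F_anti[of y x] F_pos[of x] by (intro mult_right_mono power_mono) auto
    finally show ?thesis using A_nonneg[of x] that unfolding g_def
      by (simp add: mult.left_commute[of "F y ^ (N - N0)"] mult_left_mono)
  qed
  have g_int: "integrable lborel (\<lambda>x. indicator {0<..} x * g N x)" if "N \<ge> N0" for N
  proof (rule Bochner_Integration.integrable_bound[OF g_int0])
    show "AE x in lborel. norm (indicator {0<..} x * g N x) \<le> norm (indicator {0<..} x * g N0 x)"
      using g_le[OF that, of 0] g_nonneg F0 by (intro AE_I2) (auto simp: indicator_def)
  qed measurable
  let ?near = "\<lambda>N. real N powr \<sigma> * (\<integral>x. indicator {0<..\<delta>} x * g N x \<partial>lborel)"
  let ?far = "\<lambda>N. real N powr \<sigma> * (\<integral>x. indicator {\<delta><..} x * g N x \<partial>lborel)"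
  let ?lim = "\<integral>y. indicator {0<..} y * (y powr (\<sigma> - 1) * A0 * exp (- k * y)) \<partial>lborel"
  have part1: "(\<lambda>N. ?near N) \<longlonglongrightarrow>
      ?lim"
  proof -
    \<comment> \<open>The rescaled integrand: the powers of N from x^(\<sigma>-1) and from dx cancel
      N^\<sigma>.\<close>
    define f where "f = (\<lambda>N::nat. \<lambda>y. indicator {0<..\<delta>} (y / real N) * (y powr (\<sigma> - 1) * A (y / real N) * F (y / real N) ^ N))"
    have "(\<lambda>N. \<integral>y. f N y \<partial>lborel) \<longlonglongrightarrow>
      ?lim"
    proof (rule integral_dominated_convergence)
      show "integrable lborel (\<lambda>y. (A0 + 1) * (indicator {0<..} y * (y powr (\<sigma> - 1) * exp (- (k / 2) * y))))"
        using has_bochner_integral_Gamma[OF \<sigma>, of "k / 2"] k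
        by (intro integrable_mult_right) (simp add: has_bochner_integral_iff)
      show "AE y in lborel. (\<lambda>N. f N y) \<longlonglongrightarrow> indicator {0<..} y * (y powr (\<sigma> - 1) * A0 * exp (- k * y))"
      proof (rule AE_I2)
        fix y :: real
        show "(\<lambda>N. f N y) \<longlonglongrightarrow> indicator {0<..} y * (y powr (\<sigma> - 1) * A0 * exp (- k * y))"
        proof (cases "y > 0")
          case True
          have yN: "filterlim (\<lambda>N. y / real N) (at_right 0) sequentially"
            unfolding filterlim_at
          proof
            show "(\<lambda>N. y / real N) \<longlonglongrightarrow> 0" by real_asymp
            show "\<forall>\<^sub>F N in sequentially. y / real N \<in> {0<..} \<and> y / real N \<noteq> 0"
              using eventually_gt_at_top[of 0] by eventually_elim (use True in auto)
          qed
          have "eventually (\<lambda>N. y / real N \<in> {0<..<\<delta>}) sequentially"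
            by (rule eventually_compose_filterlim[OF _ yN]) (use eventually_at_right_real[OF \<delta>(1)] in simp)
          then have ind: "eventually (\<lambda>N. (y powr (\<sigma> - 1) * A (y / real N) * exp (y * (ln (F (y / real N)) / (y / real N)))) = f N y) sequentially"
            using eventually_gt_at_top[of 0]
          proof eventually_elim
            case (elim N)
            have "F (y / real N) > 0" using True by (intro F_pos) auto
            then have "F (y / real N) ^ N = exp (real N * ln (F (y / real N)))"
              by (simp add: exp_of_nat_mult)
            then show ?case using True elim by (simp add: f_def field_simps)
          qed
          \<comment> \<open>\<open>ln F\<close> has slope -k at 0, so N ln F(y / N) tends to -k
            y.\<close>
          have "((\<lambda>x. ln (F x)) has_real_derivative 1 / F 0 * (- k)) (at 0 within {0..})"
            using F_deriv F0 by (intro DERIV_chain2[where f = ln and g = F] DERIV_ln_divide) auto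
          then have "((\<lambda>x. ln (F x) / x) \<longlongrightarrow> - k) (at_right 0)"
            unfolding has_field_derivative_iff F0 at_within_Ici_at_right by simp
          then have "(\<lambda>N. ln (F (y / real N)) / (y / real N)) \<longlonglongrightarrow> - k"
            by (rule filterlim_compose[OF _ yN])
          then have "(\<lambda>N. y powr (\<sigma> - 1) * A (y / real N) * exp (y * (ln (F (y / real N)) / (y / real N)))) \<longlonglongrightarrow>
              y powr (\<sigma> - 1) * A0 * exp (y * (- k))"
            by (intro tendsto_intros filterlim_compose[OF A_lim yN])
          then have "(\<lambda>N. f N y) \<longlonglongrightarrow> y powr (\<sigma> - 1) * A0 * exp (y * (- k))"
            using ind by (rule Lim_transform_eventually)
          then show ?thesis using True by (simp add: mult.commute)
        next
          case False
          have "f N y = 0" for N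
          proof -
            have "\<not> 0 < y / real N" using False by (cases "N = 0") (auto simp: zero_less_divide_iff)
            then show ?thesis by (simp add: f_def)
          qed
          then show ?thesis using False by simp
        qed
      qed
      fix N
      show "AE y in lborel. norm (f N y) \<le> (A0 + 1) * (indicator {0<..} y * (y powr (\<sigma> - 1) * exp (- (k / 2) * y)))"
      proof (rule AE_I2)
        fix y :: real
        show "norm (f N y) \<le> (A0 + 1) * (indicator {0<..} y * (y powr (\<sigma> - 1) * exp (- (k / 2) * y)))"
        proof (cases "y / real N \<in> {0<..\<delta>}")
          case True
          then have N: "N > 0" by (cases N) auto
          then have y: "y > 0" using True by (simp add: zero_less_divide_iff)
          have x: "0 < y / real N" "y / real N \<le> \<delta>" using True by auto
          have Fp: "0 \<le> F (y / real N)" using F_pos[of "y / real N"] x by simp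
          have "F (y / real N) ^ N \<le> exp (- (k / 2) * (y / real N)) ^ N"
            using Fp F_le[OF x] by (rule power_mono[rotated])
          also have "\<dots> = exp (- (k / 2) * y)"
            using N by (simp flip: exp_of_nat_mult)
          finally have "A (y / real N) * F (y / real N) ^ N \<le> (A0 + 1) * exp (- (k / 2) * y)"
            using A_le[OF x] A_nonneg[OF x(1)] A1 Fp by (intro mult_mono) auto
          then have "y powr (\<sigma> - 1) * (A (y / real N) * F (y / real N) ^ N) \<le> y powr (\<sigma> - 1) * ((A0 + 1) * exp (- (k / 2) * y))"
            by (rule mult_left_mono) simp
          moreover have "norm (f N y) = y powr (\<sigma> - 1) * (A (y / real N) * F (y / real N) ^ N)"
            using True A_nonneg[OF x(1)] Fp by (simp add: f_def abs_mult mult.assoc)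
          ultimately show ?thesis using y by (simp add: mult_ac)
        next
          case False
          then have "f N y = 0" by (simp add: f_def)
          then show ?thesis using A1 by simp
        qed
      qed
    qed (unfold f_def, measurable)
    moreover have "eventually (\<lambda>N. (\<integral>y. f N y \<partial>lborel) = ?near N) sequentially"
      using eventually_gt_at_top[of 0]
    proof eventually_elim
      case (elim N)
      have "(\<integral>x. indicator {0<..\<delta>} x * g N x \<partial>lborel) = \<bar>1 / real N\<bar> *\<^sub>R
          (\<integral>y. indicator {0<..\<delta>} (0 + 1 / real N * y) * g N (0 + 1 / real N * y) \<partial>lborel)"
        using elim by (intro lborel_integral_real_affine) auto
      also have "\<dots> = 1 / real N * (\<integral>y. indicator {0<..\<delta>} (y / real N) * g N (y / real N) \<partial>lborel)"
        by simp
      finally have "?near N =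
          real N powr (\<sigma> - 1) * (\<integral>y. indicator {0<..\<delta>} (y / real N) * g N (y / real N) \<partial>lborel)"
        using elim by (simp add: powr_diff)
      also have "\<dots> = (\<integral>y. real N powr (\<sigma> - 1) * (indicator {0<..\<delta>} (y / real N) * g N (y / real N)) \<partial>lborel)"
        by simp
      also have "\<dots> = (\<integral>y. f N y \<partial>lborel)"
      proof (rule Bochner_Integration.integral_cong[OF refl])
        fix y :: real
        show "real N powr (\<sigma> - 1) * (indicator {0<..\<delta>} (y / real N) * g N (y / real N)) = f N y"
        proof (cases "y > 0")
          case True
          have "real N powr (\<sigma> - 1) * (y / real N) powr (\<sigma> - 1) = y powr (\<sigma> - 1)"
            using True elim by (simp add: powr_divide)
          then show ?thesis by (simp add: f_def g_def mult_ac) 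
        next
          case False
          then have "\<not> 0 < y / real N" using elim by (simp add: zero_less_divide_iff)
          then show ?thesis by (simp add: f_def)
        qed
      qed
      finally show ?case by simp
    qed
    ultimately show ?thesis by (rule Lim_transform_eventually)
  qed
  have part2: "(\<lambda>N. ?far N) \<longlonglongrightarrow> 0"
  proof (rule tendsto_sandwich[where f = "\<lambda>_. 0"])
    \<comment> \<open>Beyond \<delta> all but N0 of the factors are bounded by F \<delta> < 1, so
      the far part decays geometrically while \<open>C\<close> stays fixed.\<close>
    define C where "C = (\<integral>x. indicator {0<..} x * g N0 x \<partial>lborel) / F \<delta> ^ N0"
    show "(\<lambda>N. (real N powr \<sigma> * F \<delta> ^ N) * C) \<longlonglongrightarrow> 0"
      using F\<delta> F_pos[of \<delta>] \<delta> by (intro tendsto_mult_left_zero tendsto_powr_times_power_0) auto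
    show "\<forall>\<^sub>F N in sequentially. 0 \<le> ?far N"
    proof (intro always_eventually allI mult_nonneg_nonneg)
      fix N
      have "0 \<le> indicator {\<delta><..} x * g N x" for x
        using g_nonneg[of x N] \<delta> by (auto simp: indicator_def)
      then show "0 \<le> (\<integral>x. indicator {\<delta><..} x * g N x \<partial>lborel)"
        by (intro integral_nonneg_AE AE_I2)
    qed simp
    show "\<forall>\<^sub>F N in sequentially. ?far N \<le> (real N powr \<sigma> * F \<delta> ^ N) * C"
      using eventually_ge_at_top[of N0]
    proof eventually_elim
      case (elim N)
      have "(\<integral>x. indicator {\<delta><..} x * g N x \<partial>lborel) \<le> (\<integral>x. F \<delta> ^ (N - N0) * (indicator {0<..} x * g N0 x) \<partial>lborel)"
      proof (rule integral_mono_AE')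
        show "integrable lborel (\<lambda>x. F \<delta> ^ (N - N0) * (indicator {0<..} x * g N0 x))"
          using g_int0 by simp
        show "AE x in lborel. indicator {\<delta><..} x * g N x \<le> F \<delta> ^ (N - N0) * (indicator {0<..} x * g N0 x)"
          using g_le[OF elim, of \<delta>] g_nonneg[of _ N0] F_pos[of \<delta>] \<delta> by (intro AE_I2) (auto simp: indicator_def)
        show "AE x in lborel. 0 \<le> F \<delta> ^ (N - N0) * (indicator {0<..} x * g N0 x)"
          using g_nonneg[of _ N0] F_pos[of \<delta>] \<delta> by (intro AE_I2) (auto simp: indicator_def)
      qed
      also have "\<dots> = F \<delta> ^ N * C"
        using F_pos[of \<delta>] \<delta> elim by (simp add: C_def power_diff)
      finally show ?case by (simp add: mult.assoc mult_left_mono)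
    qed
  qed simp
  have sum: "(\<lambda>N. ?near N +
      ?far N) \<longlonglongrightarrow>
      ?lim + 0"
    by (rule tendsto_add[OF part1 part2])
  have val: "?lim = A0 * Gamma \<sigma> * k powr (- \<sigma>)"
  proof -
    have "?lim =
        (\<integral>y. A0 * (indicator {0<..} y * (y powr (\<sigma> - 1) * exp (- k * y))) \<partial>lborel)"
      by (simp add: mult_ac)
    also have "\<dots> = A0 * (Gamma \<sigma> * k powr (- \<sigma>))"
      using has_bochner_integral_Gamma[OF \<sigma> k] by (subst integral_mult_right_zero) (simp add: has_bochner_integral_integral_eq)
    finally show ?thesis by simp
  qed
  have ev: "eventually (\<lambda>N. ?near N +
      ?far N =
      real N powr \<sigma> * (\<integral>x. indicator {0<..} x * (x powr (\<sigma> - 1) * A x * E x ^ N) \<partial>lborel) / E 0 ^ N) sequentially"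
    using eventually_ge_at_top[of N0]
  proof eventually_elim
    case (elim N)
    have i1: "integrable lborel (\<lambda>x. indicator {0<..\<delta>} x * g N x)"
      by (rule Bochner_Integration.integrable_bound[OF g_int[OF elim]]) (auto simp: indicator_def)
    have i2: "integrable lborel (\<lambda>x. indicator {\<delta><..} x * g N x)"
      by (rule Bochner_Integration.integrable_bound[OF g_int[OF elim]]) (use \<delta> in \<open>auto simp: indicator_def\<close>)
    have "(\<integral>x. indicator {0<..\<delta>} x * g N x \<partial>lborel) + (\<integral>x. indicator {\<delta><..} x * g N x \<partial>lborel) =
        (\<integral>x. indicator {0<..\<delta>} x * g N x + indicator {\<delta><..} x * g N x \<partial>lborel)"
      by (rule Bochner_Integration.integral_add[symmetric, OF i1 i2])
    also have "\<dots> = (\<integral>x. (indicator {0<..} x * (x powr (\<sigma> - 1) * A x * E x ^ N)) / E 0 ^ N \<partial>lborel)"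
      using \<delta> by (intro Bochner_Integration.integral_cong) (auto simp: indicator_def g_def F_def power_divide)
    also have "\<dots> = (\<integral>x. indicator {0<..} x * (x powr (\<sigma> - 1) * A x * E x ^ N) \<partial>lborel) / E 0 ^ N"
      by simp
    finally show ?case by (simp add: distrib_left[symmetric])
  qed
  show ?thesis
    using Lim_transform_eventually[OF sum[unfolded val add_0_right] ev] by (simp add: k_def)
qed

section \<open>The edge regimes\<close>

lemma measurable_mom [measurable]: "mom P Q r \<in> borel_measurable borel"
proof -
  have "(\<lambda>\<theta>. \<integral>x. \<bar>x\<bar> powr r * exp (- (\<bar>x\<bar> powr P) - \<theta> * \<bar>x\<bar> powr Q) \<partial>lborel) \<in> borel_measurable borel"
    by (rule lborel.borel_measurable_lebesgue_integral) measurable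
  then show ?thesis by (simp add: mom_def[abs_def])
qed

lemma mom_tendsto_at_right_0:
  fixes P Q r :: real
  assumes "P > 0" "Q > 0" "r > -1"
  shows "(mom P Q r \<longlongrightarrow> mom P Q r 0) (at_right 0)"
proof -
  have "continuous (at 0 within {0..}) (mom P Q r)"
    using has_field_derivative_mom[of P Q r 0] assms by (intro DERIV_continuous) auto
  then show ?thesis unfolding continuous_within at_within_Ici_at_right .
qed

lemma has_bochner_integral_nn:
  assumes "(\<integral>\<^sup>+x\<in>{0<..}. ennreal (f x) \<partial>lborel) = M" "M < \<infinity>" "\<And>x::real. x > 0 \<Longrightarrow> 0 \<le> f x"
    and [measurable]: "f \<in> borel_measurable borel"
  shows "has_bochner_integral lborel (\<lambda>x. indicator {0<..} x * f x) (enn2real M)"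
proof (rule has_bochner_integral_nn_integral)
  have "(\<integral>\<^sup>+x. ennreal (indicator {0<..} x * f x) \<partial>lborel) = (\<integral>\<^sup>+x\<in>{0<..}. ennreal (f x) \<partial>lborel)"
    by (intro nn_integral_cong) (auto simp: indicator_def)
  then show "(\<integral>\<^sup>+x. ennreal (indicator {0<..} x * f x) \<partial>lborel) = ennreal (enn2real M)"
    using assms(1,2) by (simp add: less_top)
  show "AE x in lborel. 0 \<le> indicator {0<..} x * f x"
    using assms(3) by (intro AE_I2) (auto simp: indicator_def)
qed auto

lemma has_bochner_integral_theta_integral:
  assumes p: "p > 1"
  shows "has_bochner_integral lborel (\<lambda>\<theta>. indicator {0<..} \<theta> * (\<theta> powr ((real m + 1) / 2 - 1) *
     mom p (2 * p - 2) (2 * p - 2) \<theta> * mom p (2 * p - 2) (p - 2) \<theta> ^ m * mom p (2 * p - 2) 0 \<theta> ^ j))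
     (enn2real (theta_integral p m j))"
  using p by (intro has_bochner_integral_nn theta_integral_finite)
    (auto simp: theta_integral_def intro!: mult_nonneg_nonneg zero_le_power less_imp_le[OF mom_pos])

text \<open>The substitution \<open>\<theta> = x powr (- (2 * p - 2) / p)\<close> moves the left edge to \<open>x = 0\<close>.\<close>

lemma theta_integral_dual:
  assumes p: "p > 1"
  shows "theta_integral p m j = (\<integral>\<^sup>+x\<in>{0<..}. ennreal ((2 * p - 2) / p * (x powr (real j / p + 1 - 1) *
     (mom (2 * p - 2) p (2 * p - 2) x * mom (2 * p - 2) p 0 x ^ j) * mom (2 * p - 2) p (p - 2) x ^ m)) \<partial>lborel)"
proof -
  define q where "q = 2 * p - 2"
  have q: "q > 0" using p by (simp add: q_def)
  define c where "c = - q / p"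
  have c: "c \<noteq> 0" "\<bar>c\<bar> = q / p" using p q by (auto simp: c_def)
  have "theta_integral p m j = (\<integral>\<^sup>+\<theta>\<in>{0<..}. ennreal (\<theta> powr ((real m + 1) / 2 - 1) * mom p q q \<theta> * mom p q (p - 2) \<theta> ^ m * mom p q 0 \<theta> ^ j) \<partial>lborel)"
    by (simp add: theta_integral_def q_def)
  also have "\<dots> = (\<integral>\<^sup>+x\<in>{0<..}. ennreal (\<bar>c\<bar> * x powr (c - 1)) *
      ennreal ((x powr c) powr ((real m + 1) / 2 - 1) * mom p q q (x powr c) * mom p q (p - 2) (x powr c) ^ m * mom p q 0 (x powr c) ^ j) \<partial>lborel)"
    by (rule nn_integral_powr_substitution[OF c(1)]) measurable
  also have "\<dots> = (\<integral>\<^sup>+x\<in>{0<..}. ennreal (q / p * (x powr (real j / p + 1 - 1) *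
     (mom q p q x * mom q p 0 x ^ j) * mom q p (p - 2) x ^ m)) \<partial>lborel)"
  proof (rule nn_integral_cong)
    fix x :: real
    show "ennreal (\<bar>c\<bar> * x powr (c - 1)) *
      ennreal ((x powr c) powr ((real m + 1) / 2 - 1) * mom p q q (x powr c) * mom p q (p - 2) (x powr c) ^ m * mom p q 0 (x powr c) ^ j) * indicator {0<..} x =
      ennreal (q / p * (x powr (real j / p + 1 - 1) * (mom q p q x * mom q p 0 x ^ j) * mom q p (p - 2) x ^ m)) * indicator {0<..} x"
    proof (cases "x > 0")
      case True
      have inv: "(x powr c) powr (- p / q) = x" using True p q by (simp add: powr_powr c_def)
      have sc: "mom p q r (x powr c) = x powr ((r + 1) / p) * mom q p r x" if "r > -1" for r
      proof -
        have "c * (- (r + 1) / q) = (r + 1) / p" using p q by (simp add: c_def field_simps)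
        then have e: "(x powr c) powr (- (r + 1) / q) = x powr ((r + 1) / p)" by (simp only: powr_powr)
        have "mom p q r (x powr c) = (x powr c) powr (- (r + 1) / q) * mom q p r ((x powr c) powr (- p / q))"
          using that p q True by (intro mom_scaling) auto
        then show ?thesis unfolding inv e .
      qed
      \<comment> \<open>The exponents come from the Jacobian, the weight, K, J^m and I^j. The
        multiples of m cancel, so the large parameter survives only as the power of a single
        moment.\<close>
      have e: "(c - 1) + c * ((real m + 1) / 2 - 1) + (q + 1) / p + (p - 2 + 1) / p * real m + (0 + 1) / p * real j = real j / p + 1 - 1"
        using p by (simp add: c_def q_def field_simps)
      have "x powr (c - 1) * ((x powr c) powr ((real m + 1) / 2 - 1) * mom p q q (x powr c) * mom p q (p - 2) (x powr c) ^ m * mom p q 0 (x powr c) ^ j) =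
        (x powr (c - 1) * x powr (c * ((real m + 1) / 2 - 1)) * x powr ((q + 1) / p) * x powr ((p - 2 + 1) / p * real m) * x powr ((0 + 1) / p * real j)) *
          (mom q p q x * mom q p 0 x ^ j * mom q p (p - 2) x ^ m)"
      proof -
        have pw: "(x powr a) ^ k = x powr (a * real k)" for a k
          using True by (simp add: powr_realpow[symmetric] powr_powr)
        show ?thesis
          using sc[of q] sc[of "p - 2"] sc[of 0] p q
          by (simp add: power_mult_distrib pw powr_powr mult_ac)
      qed
      also have "x powr (c - 1) * x powr (c * ((real m + 1) / 2 - 1)) * x powr ((q + 1) / p) * x powr ((p - 2 + 1) / p * real m) * x powr ((0 + 1) / p * real j) =
          x powr (real j / p + 1 - 1)"
        unfolding powr_add[symmetric] e ..
      finally have "\<bar>c\<bar> * x powr (c - 1) * ((x powr c) powr ((real m + 1) / 2 - 1) * mom p q q (x powr c) * mom p q (p - 2) (x powr c) ^ m * mom p q 0 (x powr c) ^ j) =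
        q / p * (x powr (real j / p + 1 - 1) * (mom q p q x * mom q p 0 x ^ j) * mom q p (p - 2) x ^ m)"
        unfolding c(2) by (simp only: mult.assoc)
      then show ?thesis by (simp add: ennreal_mult'[symmetric])
    qed simp
  qed
  finally show ?thesis by (simp add: q_def)
qed

text \<open>The growing power belongs to I, which is largest at \<theta> = 0 and has slope -K there;
  J occurs with a fixed power.\<close>

lemma theta_integral_right_edge:
  assumes p: "p > 1" and m: "m \<ge> 1"
  shows "(\<lambda>N. real N powr (real m / 2) * enn2real (theta_integral p (m - 1) N) / mom p (2 * p - 2) 0 0 ^ N) \<longlonglongrightarrow>
    mom p (2 * p - 2) (2 * p - 2) 0 * mom p (2 * p - 2) (p - 2) 0 ^ (m - 1) * Gamma (real m / 2) *
      (mom p (2 * p - 2) (2 * p - 2) 0 / mom p (2 * p - 2) 0 0) powr (- (real m / 2))"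
proof -
  define q where "q = 2 * p - 2"
  have q: "q > 0" using p by (simp add: q_def)
  define A where "A = (\<lambda>\<theta>. mom p q q \<theta> * mom p q (p - 2) \<theta> ^ (m - 1))"
  have [measurable]: "A \<in> borel_measurable borel" unfolding A_def by measurable
  have me: "(real (m - 1) + 1) / 2 = real m / 2" using m by (simp add: of_nat_diff)
  have hb: "has_bochner_integral lborel (\<lambda>\<theta>. indicator {0<..} \<theta> * (\<theta> powr (real m / 2 - 1) * A \<theta> * mom p q 0 \<theta> ^ N))
     (enn2real (theta_integral p (m - 1) N))" for N
    using has_bochner_integral_theta_integral[OF p, of "m - 1" N] unfolding me by (simp add: A_def q_def mult.assoc)
  have "(\<lambda>N. real N powr (real m / 2) * (\<integral>x. indicator {0<..} x * (x powr (real m / 2 - 1) * A x * mom p q 0 x ^ N) \<partial>lborel) / mom p q 0 0 ^ N)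
      \<longlonglongrightarrow> A 0 * Gamma (real m / 2) * (mom p q q 0 / mom p q 0 0) powr (- (real m / 2))"
  proof (rule watson_asymptotics)
    show "0 < real m / 2" using m by simp
    show "0 \<le> A x" if "x > 0" for x
      unfolding A_def using that p q by (intro mult_nonneg_nonneg zero_le_power less_imp_le[OF mom_pos]) auto
    show "(A \<longlongrightarrow> A 0) (at_right 0)"
      unfolding A_def using p q by (intro tendsto_intros mom_tendsto_at_right_0) auto
    show "0 < mom p q 0 x" if "x \<ge> 0" for x using that p by (intro mom_pos) auto
    show "mom p q 0 y \<le> mom p q 0 x" if "0 \<le> x" "x \<le> y" for x y using that p by (intro mom_antimono) auto
    show "(mom p q 0 has_real_derivative - mom p q q 0) (at 0 within {0..})"
      using has_field_derivative_mom[of p q 0 0] p q by simp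
    show "mom p q q 0 > 0" using p q by (intro mom_pos) auto
    show "integrable lborel (\<lambda>x. indicator {0<..} x * (x powr (real m / 2 - 1) * A x * mom p q 0 x ^ 0))"
      using hb[of 0] by (simp only: has_bochner_integral_iff)
  qed measurable
  then show ?thesis
    unfolding has_bochner_integral_integral_eq[OF hb] by (simp add: A_def q_def)
qed

text \<open>In the dual form the growing power belongs to J with exchanged exponents, largest at x =
  0, that is at \<theta> = \<infinity>. Its slope there is minus the exchanged K, because (p - 2) +
  p = 2p - 2.\<close>

lemma theta_integral_left_edge:
  assumes p: "p > 1"
  shows "(\<lambda>N. real N powr (real j / p + 1) * enn2real (theta_integral p N j) / mom (2 * p - 2) p (p - 2) 0 ^ N) \<longlonglongrightarrow>
    (2 * p - 2) / p * (mom (2 * p - 2) p (2 * p - 2) 0 * mom (2 * p - 2) p 0 0 ^ j * Gamma (real j / p + 1) *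
      (mom (2 * p - 2) p (2 * p - 2) 0 / mom (2 * p - 2) p (p - 2) 0) powr (- (real j / p + 1)))"
proof -
  define q where "q = 2 * p - 2"
  have q: "q > 0" using p by (simp add: q_def)
  define A where "A = (\<lambda>\<theta>. mom q p q \<theta> * mom q p 0 \<theta> ^ j)"
  define s where "s = real j / p + 1"
  have [measurable]: "A \<in> borel_measurable borel" unfolding A_def by measurable
  have A0: "0 \<le> A x" if "x > 0" for x
    unfolding A_def using that p q by (intro mult_nonneg_nonneg zero_le_power less_imp_le[OF mom_pos]) auto
  have "has_bochner_integral lborel (\<lambda>x. indicator {0<..} x * (q / p * (x powr (s - 1) * A x * mom q p (p - 2) x ^ N)))
     (enn2real (theta_integral p N j))" for N
  proof (rule has_bochner_integral_nn)
    show "(\<integral>\<^sup>+x\<in>{0<..}. ennreal (q / p * (x powr (s - 1) * A x * mom q p (p - 2) x ^ N)) \<partial>lborel) = theta_integral p N j"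
      unfolding theta_integral_dual[OF p] by (simp add: A_def q_def s_def)
    show "0 \<le> q / p * (x powr (s - 1) * A x * mom q p (p - 2) x ^ N)" if "x > 0" for x
      using that p q A0[OF that] by (intro mult_nonneg_nonneg zero_le_power less_imp_le[OF mom_pos]) auto
  qed (use theta_integral_finite[OF p] in auto)
  then have hb0: "has_bochner_integral lborel (\<lambda>x. p / q * (indicator {0<..} x * (q / p * (x powr (s - 1) * A x * mom q p (p - 2) x ^ N))))
     (p / q * enn2real (theta_integral p N j))" for N
    by (rule has_bochner_integral_mult_right)
  have fac: "p / q * (a * (q / p * b)) = a * b" for a b using p q by simp
  have hb: "has_bochner_integral lborel (\<lambda>x. indicator {0<..} x * (x powr (s - 1) * A x * mom q p (p - 2) x ^ N))
     (p / q * enn2real (theta_integral p N j))" for N using hb0[of N] unfolding fac .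
  have "(\<lambda>N. real N powr s * (\<integral>x. indicator {0<..} x * (x powr (s - 1) * A x * mom q p (p - 2) x ^ N) \<partial>lborel) / mom q p (p - 2) 0 ^ N)
      \<longlonglongrightarrow> A 0 * Gamma s * (mom q p q 0 / mom q p (p - 2) 0) powr (- s)"
  proof (rule watson_asymptotics)
    show "0 < s" using p by (simp add: s_def add_nonneg_pos)
    show "(A \<longlongrightarrow> A 0) (at_right 0)"
      unfolding A_def using p q by (intro tendsto_intros mom_tendsto_at_right_0) auto
    show "0 < mom q p (p - 2) x" if "x \<ge> 0" for x using that p q by (intro mom_pos) auto
    show "mom q p (p - 2) y \<le> mom q p (p - 2) x" if "0 \<le> x" "x \<le> y" for x y using that p q by (intro mom_antimono) auto
    have "p - 2 + p = q" by (simp add: q_def)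
    then show "(mom q p (p - 2) has_real_derivative - mom q p q 0) (at 0 within {0..})"
      using has_field_derivative_mom[of q p "p - 2" 0] p q by simp
    show "mom q p q 0 > 0" using p q by (intro mom_pos) auto
    show "integrable lborel (\<lambda>x. indicator {0<..} x * (x powr (s - 1) * A x * mom q p (p - 2) x ^ 0))"
      using hb[of 0] by (simp only: has_bochner_integral_iff)
  qed (use A0 in \<open>auto\<close>)
  then have lim: "(\<lambda>N. real N powr s * (p / q * enn2real (theta_integral p N j)) / mom q p (p - 2) 0 ^ N)
      \<longlonglongrightarrow> A 0 * Gamma s * (mom q p q 0 / mom q p (p - 2) 0) powr (- s)"
    unfolding has_bochner_integral_integral_eq[OF hb] .
  have "q / p * (a * (p / q * b) / c) = a * b / c" for a b c using p q by simp
  with tendsto_mult_left[OF lim, of "q / p"]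
  have "(\<lambda>N. real N powr s * enn2real (theta_integral p N j) / mom q p (p - 2) 0 ^ N)
      \<longlonglongrightarrow> q / p * (A 0 * Gamma s * (mom q p q 0 / mom q p (p - 2) 0) powr (- s))"
    by simp
  then show ?thesis by (simp add: A_def q_def s_def)
qed

section \<open>Intrinsic volumes at the two edges\<close>

lemma tendsto_choose_over_power:
  "(\<lambda>n. real ((n - 1) choose k) / real n ^ k) \<longlonglongrightarrow> 1 / fact k"
proof -
  have eq: "eventually (\<lambda>n. (\<Prod>i<k. (real n - 1 - real i) / real n) / fact k = real ((n - 1) choose k) / real n ^ k) sequentially"
    using eventually_gt_at_top[of k]
  proof eventually_elim
    case (elim n)
    have "real ((n - 1) choose k) = (\<Prod>i<k. (real n - 1 - real i)) / fact k"
      using elim by (simp add: binomial_gbinomial gbinomial_prod_rev atLeast0LessThan of_nat_diff)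
    then show ?case by (simp add: prod_dividef)
  qed
  have "(\<lambda>n. (\<Prod>i<k. (real n - 1 - real i) / real n) / fact k) \<longlonglongrightarrow> (\<Prod>i<k. 1) / fact k"
    by (intro tendsto_intros) (auto, real_asymp)
  then have "(\<lambda>n. (\<Prod>i<k. (real n - 1 - real i) / real n) / fact k) \<longlonglongrightarrow> 1 / fact k" by simp
  then show ?thesis using eq by (rule Lim_transform_eventually)
qed

text \<open>At \<theta> = 0 the moments are Gamma values with K0 = ((p-1)/p) J0. The constants
  collapse through pi X K0 / I0 = ((p-1) J0 / I0)^2, whose power m/2 is a natural power.\<close>

lemma intrinsic_volume_right_edge:
  assumes p: "p > 1" and m: "m \<ge> 1"
  shows "(\<lambda>n. intrinsic_volume n (lp_ball p n) (n - m)) \<sim>[sequentially]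
        (\<lambda>n. Gamma (real m / 2) / (2 * Gamma (real m))
             * (p * (p - 1) * Gamma (1 - 1 / p) / (pi * Gamma (1 / p))) powr (real m / 2)
             * ((2 / p * Gamma (1 / p)) ^ n * real n powr (real m / 2)
                / Gamma ((real n + p - real m) / p)))"
proof (rule asymp_equivI')
  define I0 where "I0 = mom p (2 * p - 2) 0 0"
  define J0 where "J0 = mom p (2 * p - 2) (p - 2) 0"
  define K0 where "K0 = mom p (2 * p - 2) (2 * p - 2) 0"
  define X where "X = p * (p - 1) * Gamma (1 - 1 / p) / (pi * Gamma (1 / p))"
  define g1 where "g1 = Gamma (1 / p)"
  define g2 where "g2 = Gamma (1 - 1 / p)"
  have g: "g1 > 0" "g2 > 0" using p by (auto simp: g1_def g2_def intro!: Gamma_real_pos)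
  have I0: "I0 = 2 / p * g1" using p by (simp add: I0_def mom_0 g1_def)
  have J0: "J0 = 2 / p * g2"
  proof -
    have "(p - 2 + 1) / p = 1 - 1 / p" using p by (simp add: field_simps)
    then show ?thesis using p by (simp add: J0_def mom_0 g2_def)
  qed
  have K0: "K0 = (p - 1) / p * J0"
  proof -
    have "(2 * p - 2 + 1) / p = (1 - 1 / p) + 1" using p by (simp add: field_simps)
    moreover have "Gamma ((1 - 1 / p) + 1) = (1 - 1 / p) * Gamma (1 - 1 / p)"
    proof (rule Gamma_plus1)
      have "1 - 1 / p > 0" using p by simp
      then show "1 - 1 / p \<notin> \<int>\<^sub>\<le>\<^sub>0" using nonpos_Ints_nonpos[of "1 - 1 / p"] by linarith
    qed
    ultimately show ?thesis using p by (simp add: K0_def mom_0 J0 g2_def field_simps)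
  qed
  have pos: "I0 > 0" "J0 > 0" "K0 > 0" "X > 0" using p g by (auto simp: I0 J0 K0 X_def simp flip: g1_def g2_def)
  define h where "h = real m / 2"
  define L where "L = K0 * J0 ^ (m - 1) * Gamma h * (K0 / I0) powr (- h)"
  have Mlim: "(\<lambda>N. real N powr h * enn2real (theta_integral p (m - 1) N) / I0 ^ N) \<longlonglongrightarrow> L"
    using theta_integral_right_edge[OF p m] by (simp add: L_def I0_def J0_def K0_def h_def)
  have fl: "filterlim (\<lambda>n. n - m) sequentially sequentially" by (rule filterlim_minus_const_nat_at_top)
  note Mlim' = filterlim_compose[OF Mlim fl]
  \<comment> \<open>What is left of the quotient of the two sides after extracting the binomial
    coefficient, the normalised integral and (n / (n - m))^h. The last factor is there because
    Watson's lemma runs in N = n - m.\<close>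
  define c1 where "c1 = p * (p - 1) ^ (m - 1) * Gamma (real m) / (pi powr h * Gamma h * X powr h * I0 ^ m)"
  have "(\<lambda>n. c1 * (real ((n - 1) choose (m - 1)) / real n ^ (m - 1)) *
      (real (n - m) powr h * enn2real (theta_integral p (m - 1) (n - m)) / I0 ^ (n - m)) * (real n / real (n - m)) powr h)
      \<longlonglongrightarrow> c1 * (1 / fact (m - 1)) * L * 1 powr h"
  proof (intro tendsto_mult tendsto_const tendsto_choose_over_power Mlim' tendsto_powr)
    have "(\<lambda>n. real n / (real n - real m)) \<longlonglongrightarrow> 1" by real_asymp
    moreover have "eventually (\<lambda>n. real n / (real n - real m) = real n / real (n - m)) sequentially"
      using eventually_ge_at_top[of m] by eventually_elim (simp add: of_nat_diff)
    ultimately show "(\<lambda>n. real n / real (n - m)) \<longlonglongrightarrow> 1" by (rule Lim_transform_eventually)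
  qed auto
  moreover have "c1 * (1 / fact (m - 1)) * L * 1 powr h = 1"
  proof -
    have G: "Gamma (real m) = fact (m - 1)" using Gamma_fact[of "m - 1", where 'a = real] m by (simp add: of_nat_diff)
    have Gh: "Gamma h > 0" using m by (auto simp: h_def intro!: Gamma_real_pos)
    have "pi * X * (K0 / I0) = ((p - 1) * J0 / I0)\<^sup>2"
      using p g unfolding X_def g1_def[symmetric] g2_def[symmetric] K0 J0 I0 by (simp add: field_simps power2_eq_square)
    moreover have "z\<^sup>2 powr h = z ^ m" if "z > 0" for z :: real
    proof -
      have "z\<^sup>2 powr h = (z powr 2) powr h" using that by simp
      also have "\<dots> = z powr real m" by (simp only: powr_powr) (simp add: h_def)
      finally show ?thesis using that by (simp add: powr_realpow)
    qed
    ultimately have "(pi * X * (K0 / I0)) powr h = ((p - 1) * J0 / I0) ^ m"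
      using p pos by simp
    moreover have m3: "(a * b * c) powr h = a powr h * b powr h * c powr h" if "a > 0" "b > 0" "c > 0" for a b c :: real
      using that by (simp add: powr_mult)
    have "(pi * X * (K0 / I0)) powr h = pi powr h * X powr h * (K0 / I0) powr h"
      by (rule m3) (use pos in auto)
    ultimately have e: "pi powr h * X powr h * (K0 / I0) powr h = ((p - 1) * J0 / I0) ^ m" by simp
    have m1: "m = Suc (m - 1)" using m by simp
    have "c1 * (1 / fact (m - 1)) * L = p * (p - 1) ^ (m - 1) * K0 * J0 ^ (m - 1) / (pi powr h * X powr h * (K0 / I0) powr h * I0 ^ m)"
      unfolding c1_def L_def G using Gh pos by (simp add: powr_minus_divide mult_ac)
    also have "\<dots> = p * (p - 1) ^ (m - 1) * K0 * J0 ^ (m - 1) / (((p - 1) * J0) ^ m)"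
      unfolding e using pos by (simp add: power_divide)
    also have "\<dots> = 1"
      unfolding K0 using p pos by (subst (3) m1, subst power_Suc) (simp add: power_mult_distrib)
    finally show ?thesis by (simp only: powr_one_eq_one mult_1_right)
  qed
  ultimately have lim: "(\<lambda>n. c1 * (real ((n - 1) choose (m - 1)) / real n ^ (m - 1)) *
      (real (n - m) powr h * enn2real (theta_integral p (m - 1) (n - m)) / I0 ^ (n - m)) * (real n / real (n - m)) powr h)
      \<longlonglongrightarrow> 1" by (simp only:)
  have "eventually (\<lambda>n. c1 * (real ((n - 1) choose (m - 1)) / real n ^ (m - 1)) *
      (real (n - m) powr h * enn2real (theta_integral p (m - 1) (n - m)) / I0 ^ (n - m)) * (real n / real (n - m)) powr h =
      intrinsic_volume n (lp_ball p n) (n - m) /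
        (Gamma (real m / 2) / (2 * Gamma (real m))
             * (p * (p - 1) * Gamma (1 - 1 / p) / (pi * Gamma (1 / p))) powr (real m / 2)
             * ((2 / p * Gamma (1 / p)) ^ n * real n powr (real m / 2)
                / Gamma ((real n + p - real m) / p)))) sequentially"
    using eventually_gt_at_top[of m]
  proof eventually_elim
    case (elim n)
    define N where "N = n - m"
    have n: "n = N + m" "N > 0" using elim by (auto simp: N_def)
    define M where "M = enn2real (theta_integral p (m - 1) N)"
    define C where "C = real ((n - 1) choose (m - 1))"
    define G where "G = Gamma ((real N + p) / p)"
    have G: "G > 0" using p by (auto simp: G_def intro!: Gamma_real_pos divide_pos_pos add_nonneg_pos)
    have Gh: "Gamma h > 0" "Gamma (real m) > 0" using m by (auto simp: h_def intro!: Gamma_real_pos)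
    have ch: "(n - 1) choose (n - m) = (n - 1) choose (m - 1)"
      using binomial_symmetric[of "m - 1" "n - 1"] m elim by simp
    have V: "intrinsic_volume n (lp_ball p n) (n - m) =
        p * (p - 1) ^ (m - 1) * real n * C / (2 * pi powr h * G) * M"
    proof -
      have "N < n" "n - N - 1 = m - 1" "(real n - real N) / 2 = h"
        using m n by (auto simp: h_def)
      then show ?thesis using intrinsic_volume_lp_ball[OF p, of N n] ch
        unfolding N_def[symmetric] by (simp only: C_def G_def M_def)
    qed
    have rG: "Gamma ((real n + p - real m) / p) = G" by (simp add: G_def n add.commute)
    have p1: "real n ^ (m - 1) * real n = real n powr h * real n powr h"
    proof -
      have "real n ^ (m - 1) * real n = real n ^ m" using m by (cases m) auto
      also have "\<dots> = real n powr (h + h)" using n by (simp add: h_def powr_realpow)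
      finally show ?thesis by (simp only: powr_add)
    qed
    have nn: "real n > 0" "real N > 0" using n by auto
    have pp: "real n powr h > 0" "real N powr h > 0" "pi powr h > 0" "X powr h > 0" using nn pos by auto
    \<comment> \<open>Powers and Gamma values are abstracted to positive variables; the only
      relation kept among them is n^(m-1) n = n^h n^h, supplied by \<open>p1\<close>.\<close>
    have alg: "p * q * Gm / (P * Gh * Y * Im) * (C / nm) * (Nh * M / IN) * (nh / Nh) =
        (p * q * nr * C / (2 * P * G) * M) / (Gh / (2 * Gm) * Y * (IN * Im * nh / G))"
      if "P > 0" "Gh > 0" "Y > 0" "Im > 0" "nm > 0" "Nh > 0" "IN > 0" "nh > 0" "Gm > 0" "nm * nr = nh * nh" "nr > 0"
      for q Gm P Gh Y Im C nm Nh M IN nh nr :: real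
    proof -
      have nr: "nr = nh * nh / nm" using that by (simp add: field_simps)
      show ?thesis unfolding nr using that(1-9) G by (simp add: field_simps)
    qed
    have "c1 * (C / real n ^ (m - 1)) * (real N powr h * M / I0 ^ N) * (real n powr h / real N powr h) =
        (p * (p - 1) ^ (m - 1) * real n * C / (2 * pi powr h * G) * M) /
        (Gamma h / (2 * Gamma (real m)) * X powr h * (I0 ^ N * I0 ^ m * real n powr h / G))"
      unfolding c1_def by (rule alg) (use pp Gh nn pos p1 in auto)
    also have "I0 ^ N * I0 ^ m = (2 / p * Gamma (1 / p)) ^ n"
      unfolding I0 g1_def n by (simp add: power_add)
    finally show ?case
      unfolding V rG using nn by (simp add: N_def C_def M_def h_def X_def powr_divide)
  qed
  with lim show "(\<lambda>n. intrinsic_volume n (lp_ball p n) (n - m) /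
        (Gamma (real m / 2) / (2 * Gamma (real m))
             * (p * (p - 1) * Gamma (1 - 1 / p) / (pi * Gamma (1 / p))) powr (real m / 2)
             * ((2 / p * Gamma (1 / p)) ^ n * real n powr (real m / 2)
                / Gamma ((real n + p - real m) / p)))) \<longlonglongrightarrow> 1"
    by (rule Lim_transform_eventually)
qed

text \<open>sqrt pi is Gamma(1/2), since (p - 2 + 1) / (2p - 2) = 1/2, and the other Gamma value is
  the exchanged I at 0. The ratio d / E0 equals H0 / (2 sqrt pi); its power -(j/p + 1), together
  with H0^j, creates the exponents 1/p and 1 - 1/p.\<close>

lemma intrinsic_volume_left_edge:
  assumes p: "p > 1"
  shows "(\<lambda>n. intrinsic_volume n (lp_ball p n) j) \<sim>[sequentially]
        (\<lambda>n. 1 / fact j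
             * ((2 * sqrt pi) powr (1 / p)
                * (Gamma (1 / (2 * p - 2)) / (p - 1)) powr (1 - 1 / p)) ^ j
             * real n powr (real j * (1 - 1 / p)))"
proof (rule asymp_equivI')
  define q where "q = 2 * p - 2"
  have q: "q > 0" using p by (simp add: q_def)
  define E0 where "E0 = mom q p (p - 2) 0"
  define H0 where "H0 = mom q p 0 0"
  define d where "d = mom q p q 0"
  have E0: "E0 = sqrt pi / (p - 1)"
  proof -
    have half: "(p - 2 + 1) / q = 1 / 2" using p by (simp add: q_def field_simps)
    have "E0 = 2 / q * Gamma ((p - 2 + 1) / q)"
      unfolding E0_def using p q by (intro mom_0) auto
    also have "\<dots> = 2 / q * sqrt pi" unfolding half Gamma_one_half_real ..
    also have "2 / q = 1 / (p - 1)" using p by (simp add: q_def field_simps)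
    finally show ?thesis by simp
  qed
  have H0: "H0 = Gamma (1 / q) / (p - 1)"
    using p q by (simp add: H0_def mom_0) (simp add: q_def field_simps)
  have d: "d = H0 / q"
  proof -
    have "(q + 1) / q = 1 / q + 1" using q by (simp add: field_simps)
    moreover have "Gamma (1 / q + 1) = 1 / q * Gamma (1 / q)"
      using q by (intro Gamma_plus1) (auto dest: nonpos_Ints_nonpos)
    ultimately have "d = 2 / q * (1 / q * Gamma (1 / q))" using q by (simp add: d_def mom_0)
    also have "2 / q = 1 / (p - 1)" using p by (simp add: q_def field_simps)
    finally show ?thesis by (simp add: H0)
  qed
  have H0p: "H0 > 0" using p q unfolding H0_def by (intro mom_pos) auto
  have E0p: "E0 > 0" using p by (simp add: E0)
  have dp: "d > 0" using H0p q by (simp add: d)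
  define s where "s = real j / p + 1"
  have s: "s > 0" using p by (simp add: s_def add_nonneg_pos)
  have Gs: "Gamma s > 0" using s by (rule Gamma_real_pos)
  define B where "B = (2 * sqrt pi) powr (1 / p) * (Gamma (1 / (2 * p - 2)) / (p - 1)) powr (1 - 1 / p)"
  have B: "B = (2 * sqrt pi) powr (1 / p) * H0 powr (1 - 1 / p)"
    by (simp add: B_def H0 q_def)
  have Bp: "B > 0" using H0p by (simp add: B)
  define L where "L = q / p * (d * H0 ^ j * Gamma s * (d / E0) powr (- s))"
  have Mlim: "(\<lambda>N. real N powr s * enn2real (theta_integral p N j) / E0 ^ N) \<longlonglongrightarrow> L"
    using theta_integral_left_edge[OF p, of j] unfolding q_def[symmetric] E0_def[symmetric] H0_def[symmetric]
      d_def[symmetric] s_def[symmetric] L_def .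
  have fl: "filterlim (\<lambda>n. n - (j + 1)) sequentially sequentially" by (rule filterlim_minus_const_nat_at_top)
  note Mlim' = filterlim_compose[OF Mlim fl]
  define c1 where "c1 = p * fact j / (2 * sqrt pi * Gamma s * B ^ j)"
  have "(\<lambda>n. c1 * (real ((n - 1) choose j) / real n ^ j) *
      (real (n - (j + 1)) powr s * enn2real (theta_integral p (n - (j + 1)) j) / E0 ^ (n - (j + 1))) * (real n / real (n - (j + 1))) powr s)
      \<longlonglongrightarrow> c1 * (1 / fact j) * L * 1 powr s"
  proof (intro tendsto_mult tendsto_const tendsto_choose_over_power Mlim' tendsto_powr)
    have "(\<lambda>n. real n / (real n - real (j + 1))) \<longlonglongrightarrow> 1" by real_asymp
    moreover have "eventually (\<lambda>n. real n / (real n - real (j + 1)) = real n / real (n - (j + 1))) sequentially"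
      using eventually_ge_at_top[of "j + 1"] by eventually_elim (simp add: of_nat_diff)
    ultimately show "(\<lambda>n. real n / real (n - (j + 1))) \<longlonglongrightarrow> 1" by (rule Lim_transform_eventually)
  qed auto
  moreover have "c1 * (1 / fact j) * L * 1 powr s = 1"
  proof -
    have dE: "d / E0 = H0 / (2 * sqrt pi)"
      using p by (simp add: d E0 q_def field_simps)
    have "(d / E0) powr (- s) = 1 / ((d / E0) * (d / E0) powr (real j / p))"
    proof -
      have "z powr (- s) = 1 / (z * z powr (real j / p))" if "z > 0" for z
      proof -
        have "z powr s = z powr (real j / p) * z powr 1" unfolding s_def by (rule powr_add)
        then show ?thesis using that by (simp only: powr_minus_divide powr_one mult.commute)
      qed
      then show ?thesis using dp E0p by simp
    qed
    moreover have "H0 ^ j / (d / E0) powr (real j / p) = B ^ j"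
    proof -
      have "B ^ j = B powr real j" using Bp by (simp add: powr_realpow)
      also have "\<dots> = ((2 * sqrt pi) powr (1 / p)) powr real j * (H0 powr (1 - 1 / p)) powr real j"
        unfolding B by (rule powr_mult)
      also have "\<dots> = (2 * sqrt pi) powr (real j / p) * H0 powr (real j - real j / p)"
        by (simp add: powr_powr left_diff_distrib)
      also have "\<dots> = (2 * sqrt pi) powr (real j / p) * (H0 ^ j / H0 powr (real j / p))"
        using H0p by (simp add: powr_diff powr_realpow)
      finally show ?thesis unfolding dE using H0p by (simp add: powr_divide)
    qed
    moreover have "c1 * (1 / fact j) * L = p / (2 * sqrt pi * Gamma s * B ^ j) * (q / p * (d * Gamma s * (H0 ^ j * (d / E0) powr (- s))))"
      by (simp add: c1_def L_def)
    ultimately have "c1 * (1 / fact j) * L = p / (2 * sqrt pi * Gamma s * B ^ j) * (q / p * (d * Gamma s * (B ^ j / (d / E0))))"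
      by (metis (no_types, opaque_lifting) divide_divide_eq_left' mult.right_neutral times_divide_eq_right)
    also have "\<dots> = q * E0 / (2 * sqrt pi)"
      using p Gs Bp dp E0p by (simp add: field_simps)
    also have "\<dots> = 1" using p by (simp add: E0 q_def field_simps)
    finally show ?thesis by (simp only: powr_one_eq_one mult_1_right)
  qed
  ultimately have lim: "(\<lambda>n. c1 * (real ((n - 1) choose j) / real n ^ j) *
      (real (n - (j + 1)) powr s * enn2real (theta_integral p (n - (j + 1)) j) / E0 ^ (n - (j + 1))) * (real n / real (n - (j + 1))) powr s)
      \<longlonglongrightarrow> 1" by (simp only:)
  have "eventually (\<lambda>n. c1 * (real ((n - 1) choose j) / real n ^ j) *
      (real (n - (j + 1)) powr s * enn2real (theta_integral p (n - (j + 1)) j) / E0 ^ (n - (j + 1))) * (real n / real (n - (j + 1))) powr s =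
      intrinsic_volume n (lp_ball p n) j /
        (1 / fact j * B ^ j * real n powr (real j * (1 - 1 / p)))) sequentially"
    using eventually_gt_at_top[of "j + 1"]
  proof eventually_elim
    case (elim n)
    define N where "N = n - (j + 1)"
    have n: "n = N + j + 1" "N > 0" using elim by (auto simp: N_def)
    define M where "M = enn2real (theta_integral p N j)"
    define C where "C = real ((n - 1) choose j)"
    have nn: "real n > 0" "real N > 0" using n by auto
    have V: "intrinsic_volume n (lp_ball p n) j =
        p * (p - 1) ^ N * real n * C / (2 * pi powr ((real N + 1) / 2) * Gamma s) * M"
    proof -
      have "j < n" "n - j - 1 = N" "real n - real j = real N + 1" "(real j + p) / p = s"
        using n p by (auto simp: s_def field_simps)
      then show ?thesis using intrinsic_volume_lp_ball[OF p, of j n]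
        by (simp only: C_def M_def)
    qed
    \<comment> \<open>Up to one factor sqrt pi the prefactor is E0^(-N), which cancels the
      exponential growth of the integral exactly.\<close>
    have E0N: "(p - 1) ^ N / pi powr ((real N + 1) / 2) = 1 / (sqrt pi * E0 ^ N)"
    proof -
      have "pi powr ((real N + 1) / 2) = pi powr (1 / 2) * (pi powr (1 / 2)) ^ N"
        by (simp add: powr_realpow[symmetric] powr_powr powr_add[symmetric] add_divide_distrib add.commute)
      also have "pi powr (1 / 2) = sqrt pi" by (simp add: powr_half_sqrt)
      finally show ?thesis using p by (simp add: E0 power_divide)
    qed
    have pw: "real n * real n ^ j = real n powr (real j * (1 - 1 / p)) * real n powr s"
    proof -
      have "real j * (1 - 1 / p) + s = real (j + 1)" using p by (simp add: s_def field_simps)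
      then have "real n powr (real j * (1 - 1 / p)) * real n powr s = real n powr real (j + 1)"
        by (simp add: powr_add[symmetric])
      also have "\<dots> = real n ^ (j + 1)" by (rule powr_realpow[OF nn(1)])
      finally show ?thesis by simp
    qed
    have pp: "real n powr s > 0" "real N powr s > 0" "real n powr (real j * (1 - 1 / p)) > 0" using nn by auto
    have alg: "p * f / (2 * sp * Gs * Bj) * (C / nj) * (Ns * M / EN) * (ns / Ns) =
        (p * a * nr * C / (2 * P * Gs) * M) / (1 / f * Bj * nx)"
      if "a / P = 1 / (sp * EN)" "nr * nj = nx * ns" "sp > 0" "EN > 0" "P > 0" "Gs > 0" "Bj > 0" "nj > 0" "nx > 0" "Ns > 0" "f > 0"
      for f sp Gs Bj C nj Ns M EN ns a nr P nx :: real
    proof -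
      have a: "a = P / (sp * EN)" and nr: "nr = nx * ns / nj"
        using that by (simp_all add: field_simps)
      show ?thesis unfolding a nr using that(3-) by (simp add: field_simps)
    qed
    have "c1 * (C / real n ^ j) * (real N powr s * M / E0 ^ N) * (real n powr s / real N powr s) =
      (p * (p - 1) ^ N * real n * C / (2 * pi powr ((real N + 1) / 2) * Gamma s) * M) /
        (1 / fact j * B ^ j * real n powr (real j * (1 - 1 / p)))"
      unfolding c1_def by (rule alg) (use E0N pw pp nn Gs Bp E0p in auto)
    then show ?case
      unfolding V using nn by (simp add: N_def C_def M_def powr_divide)
  qed
  with lim have "(\<lambda>n. intrinsic_volume n (lp_ball p n) j /
        (1 / fact j * B ^ j * real n powr (real j * (1 - 1 / p)))) \<longlonglongrightarrow> 1"
    by (rule Lim_transform_eventually)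
  then show "(\<lambda>n. intrinsic_volume n (lp_ball p n) j /
        (1 / fact j
             * ((2 * sqrt pi) powr (1 / p)
                * (Gamma (1 / (2 * p - 2)) / (p - 1)) powr (1 - 1 / p)) ^ j
             * real n powr (real j * (1 - 1 / p)))) \<longlonglongrightarrow> 1"
    by (simp only: B_def)
qed

section \<open>The phase function\<close>

lemma J_int_eq_mom: "J_int p = mom p (2 * p - 2) (p - 2)"
  and K_int_eq_mom: "K_int p = mom p (2 * p - 2) (2 * p - 2)"
  by (simp_all add: fun_eq_iff J_int_def K_int_def mom_def)

text \<open>The integrands differ at the single point 0, where 0 powr 0 = 0.\<close>

lemma I_int_eq_mom: "I_int p = mom p (2 * p - 2) 0"
proof
  fix \<theta>
  have "AE x in lborel. exp (- (\<bar>x\<bar> powr p) - \<theta> * \<bar>x\<bar> powr (2 * p - 2)) =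
      \<bar>x\<bar> powr 0 * exp (- (\<bar>x\<bar> powr p) - \<theta> * \<bar>x\<bar> powr (2 * p - 2))"
    using AE_lborel_singleton[of "0::real"] by eventually_elim simp
  then show "I_int p \<theta> = mom p (2 * p - 2) 0 \<theta>"
    unfolding I_int_def mom_def by (intro integral_cong_AE) auto
qed

section \<open>Derivatives of the three integrals\<close>

lemma int_pos:
  assumes "p > 1" "\<theta> \<ge> 0"
  shows "I_int p \<theta> > 0" "J_int p \<theta> > 0" "K_int p \<theta> > 0"
  unfolding I_int_eq_mom J_int_eq_mom K_int_eq_mom using assms by (auto intro!: mom_pos)

lemma has_real_derivative_mom_interior:
  fixes P Q r \<theta> :: real
  assumes "P > 0" "Q > 0" "r > -1" "\<theta> > 0"
  shows "(mom P Q r has_real_derivative - mom P Q (r + Q) \<theta>) (at \<theta>)"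
proof -
  have "(mom P Q r has_real_derivative - mom P Q (r + Q) \<theta>) (at \<theta> within {0<..})"
    by (rule DERIV_subset[OF has_field_derivative_mom]) (use assms in auto)
  then show ?thesis using at_within_open[of \<theta> "{0<..}"] assms by simp
qed

lemma I_int_deriv:
  assumes "p > 1" "\<theta> > 0"
  shows "(I_int p has_real_derivative - K_int p \<theta>) (at \<theta>)"
  using has_real_derivative_mom_interior[of p "2 * p - 2" 0 \<theta>] assms
  by (simp add: I_int_eq_mom K_int_eq_mom)

lemma K_int_deriv:
  assumes "p > 1" "\<theta> > 0"
  shows "(K_int p has_real_derivative - mom p (2 * p - 2) (2 * p - 2 + (2 * p - 2)) \<theta>) (at \<theta>)"
  using has_real_derivative_mom_interior[of p "2 * p - 2" "2 * p - 2" \<theta>] assms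
  by (simp add: K_int_eq_mom)

text \<open>The outer exponent is -1/2 for every p. Hence sqrt \<theta> J is an exchanged moment at
  a negative power of \<theta>, and so both increasing in \<theta> and bounded.\<close>

lemma J_int_scaling:
  assumes p: "p > 1" and \<theta>: "\<theta> > 0"
  shows "J_int p \<theta> = \<theta> powr (- 1 / 2) * mom (2 * p - 2) p (p - 2) (\<theta> powr (- p / (2 * p - 2)))"
proof -
  have "- (p - 2 + 1) / (2 * p - 2) = - 1 / 2" using p by (simp add: field_simps)
  then show ?thesis using mom_scaling[of p "2 * p - 2" "p - 2" \<theta>] p \<theta> by (simp only: J_int_eq_mom)
qed

text \<open>Differentiating the scaled form of \<open>J\<close> gives its derivative in terms of \<open>J\<close> and \<open>K\<close>
  without an integration by parts.\<close>

lemma J_int_deriv: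
  assumes p: "p > 1" and \<theta>: "\<theta> > 0"
  shows "(J_int p has_real_derivative - J_int p \<theta> / (2 * \<theta>) + p / (2 * p - 2) * K_int p \<theta> / \<theta>) (at \<theta>)"
proof -
  define q where "q = 2 * p - 2"
  have q: "q > 0" using p by (simp add: q_def)
  define c where "c = p / q"
  have c: "- p / q = - c" by (simp add: c_def)
  define x where "x = \<theta> powr (- c)"
  have x: "x > 0" using \<theta> by (simp add: x_def)
  have "p = q / 2 + 1" by (simp add: q_def field_simps)
  then have c': "c = 1 / 2 + 1 / q" using q unfolding c_def by (simp add: field_simps)
  have e: "- 1 - c + (- 1 / 2) + (q + 1) / q = - 1"
    unfolding c' using q by (simp add: add_divide_distrib)
  have "p - 2 + p = q" by (simp add: q_def)
  then have dH: "(mom q p (p - 2) has_real_derivative - mom q p q x) (at x)"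
    using has_real_derivative_mom_interior[of q p "p - 2" x] p q x by simp
  have dx: "((\<lambda>\<theta>. \<theta> powr (- c)) has_real_derivative - c * \<theta> powr (- c - 1)) (at \<theta>)"
    using \<theta> by (auto intro!: derivative_eq_intros)
  have dHx: "((\<lambda>\<theta>. mom q p (p - 2) (\<theta> powr (- c))) has_real_derivative - mom q p q x * (- c * \<theta> powr (- c - 1))) (at \<theta>)"
    using dH dx unfolding x_def by (rule DERIV_chain2)
  have ds: "((\<lambda>\<theta>. \<theta> powr (- 1 / 2)) has_real_derivative - 1 / 2 * \<theta> powr (- 1 / 2 - 1)) (at \<theta>)"
    using \<theta> by (auto intro!: derivative_eq_intros)
  have main: "((\<lambda>\<theta>. \<theta> powr (- 1 / 2) * mom q p (p - 2) (\<theta> powr (- c))) has_real_derivative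
      - 1 / 2 * \<theta> powr (- 1 / 2 - 1) * mom q p (p - 2) x + (- mom q p q x * (- c * \<theta> powr (- c - 1))) * \<theta> powr (- 1 / 2)) (at \<theta>)"
    unfolding x_def by (rule DERIV_mult[OF ds dHx[unfolded x_def]])
  have e1: "- 1 / 2 * \<theta> powr (- 1 / 2 - 1) * mom q p (p - 2) x = - J_int p \<theta> / (2 * \<theta>)"
  proof -
    have "\<theta> powr (- 1 / 2 - 1) = \<theta> powr (- 1 / 2) / \<theta> powr 1" by (rule powr_diff)
    then have "\<theta> powr (- 1 / 2 - 1) = \<theta> powr (- 1 / 2) / \<theta>" using \<theta> by (simp only: powr_one)
    then show ?thesis unfolding J_int_scaling[OF p \<theta>] q_def[symmetric] c x_def[symmetric] by simp
  qed
  have e2: "(- mom q p q x * (- c * \<theta> powr (- c - 1))) * \<theta> powr (- 1 / 2) = p / (2 * p - 2) * K_int p \<theta> / \<theta>"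
  proof -
    have "mom p q q \<theta> = \<theta> powr (- (q + 1) / q) * mom q p q (\<theta> powr (- p / q))"
      using p q \<theta> by (intro mom_scaling) auto
    then have K: "K_int p \<theta> = \<theta> powr (- (q + 1) / q) * mom q p q x"
      unfolding K_int_eq_mom q_def[symmetric] c x_def[symmetric] .
    have "\<theta> powr (- c - 1) * \<theta> powr (- 1 / 2) = \<theta> powr (- (q + 1) / q) * \<theta> powr (- 1)"
    proof -
      have "(- c - 1) + (- 1 / 2) = - (q + 1) / q + (- 1)"
        using e unfolding minus_divide_left[symmetric] by linarith
      then show ?thesis by (simp only: powr_add[symmetric])
    qed
    also have "\<theta> powr (- 1) = 1 / \<theta>" using \<theta> by (simp add: powr_minus_divide)
    finally have P: "\<theta> powr (- c - 1) * \<theta> powr (- 1 / 2) = \<theta> powr (- (q + 1) / q) * (1 / \<theta>)" .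
    have "(- mom q p q x * (- c * \<theta> powr (- c - 1))) * \<theta> powr (- 1 / 2) =
        c * mom q p q x * (\<theta> powr (- c - 1) * \<theta> powr (- 1 / 2))"
      by (simp only: mult.assoc mult_minus_left mult_minus_right minus_minus mult.left_commute)
    also have "\<dots> = c * K_int p \<theta> / \<theta>" unfolding P K by simp
    finally show ?thesis by (simp only: c_def q_def)
  qed
  have "((\<lambda>\<theta>. \<theta> powr (- 1 / 2) * mom q p (p - 2) (\<theta> powr (- c))) has_real_derivative
      - J_int p \<theta> / (2 * \<theta>) + p / (2 * p - 2) * K_int p \<theta> / \<theta>) (at \<theta>)"
    using main unfolding e1 e2 .
  then show ?thesis
  proof (rule has_field_derivative_transform_within_open[of _ _ _ "{0<..}"])
    fix y :: real assume "y \<in> {0<..}"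
    then show "y powr (- 1 / 2) * mom q p (p - 2) (y powr (- c)) = J_int p y"
      using J_int_scaling[OF p, of y] unfolding q_def[symmetric] c by simp
  qed (use \<theta> in auto)
qed

text \<open>The critical points of \<open>phase p \<beta>\<close> are the solutions of \<open>\<beta> * crit p \<theta> = (1 - \<beta>) * (p / (2 * p - 2))\<close>.\<close>

definition crit :: "real \<Rightarrow> real \<Rightarrow> real" where
  "crit p \<theta> = \<theta> * J_int p \<theta> / I_int p \<theta>"

text \<open>Plays two parts: the positive factor of the phase derivative, and the amplitude in front
  of the exponential of the phase in \<open>theta_integral\<close>.\<close>

definition qfun :: "real \<Rightarrow> real \<Rightarrow> real" where
  "qfun p \<theta> = K_int p \<theta> / (\<theta> * J_int p \<theta>)"

text \<open>The derivative of \<open>crit\<close> once the formula for J' has absorbed the factor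
  \<theta>. All terms are positive, which makes \<open>crit\<close> increasing.\<close>

definition dcrit :: "real \<Rightarrow> real \<Rightarrow> real" where
  "dcrit p \<theta> = (J_int p \<theta> / 2 + p / (2 * p - 2) * K_int p \<theta>) / I_int p \<theta> +
     \<theta> * J_int p \<theta> * K_int p \<theta> / (I_int p \<theta>)\<^sup>2"

lemma qfun_pos: "p > 1 \<Longrightarrow> \<theta> > 0 \<Longrightarrow> qfun p \<theta> > 0"
  using int_pos[of p \<theta>] by (simp add: qfun_def)

lemma dcrit_pos: "p > 1 \<Longrightarrow> \<theta> > 0 \<Longrightarrow> dcrit p \<theta> > 0"
  unfolding dcrit_def using int_pos[of p \<theta>] by (intro add_pos_pos divide_pos_pos mult_pos_pos) auto

lemma crit_deriv:
  assumes p: "p > 1" and \<theta>: "\<theta> > 0"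
  shows "(crit p has_real_derivative dcrit p \<theta>) (at \<theta>)"
proof -
  note pos = int_pos[OF p less_imp_le[OF \<theta>]]
  have "((\<lambda>\<theta>. \<theta> * J_int p \<theta> / I_int p \<theta>) has_real_derivative
     ((1 * J_int p \<theta> + (- J_int p \<theta> / (2 * \<theta>) + p / (2 * p - 2) * K_int p \<theta> / \<theta>) * \<theta>) * I_int p \<theta> -
       \<theta> * J_int p \<theta> * (- K_int p \<theta>)) / (I_int p \<theta> * I_int p \<theta>)) (at \<theta>)"
    using pos by (intro DERIV_divide DERIV_mult DERIV_ident J_int_deriv I_int_deriv p \<theta>) auto
  moreover have "((1 * J + (- J / (2 * \<theta>) + C * K / \<theta>) * \<theta>) * I - \<theta> * J * (- K)) / (I * I) =
      (J / 2 + C * K) / I + \<theta> * J * K / I\<^sup>2" if "I > 0" for I J K C :: real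
    using that \<theta> by (simp add: field_simps power2_eq_square)
  ultimately show ?thesis using pos(1) by (simp only: crit_def[abs_def] dcrit_def)
qed

lemma continuous_on_ints:
  assumes p: "p > 1"
  shows "continuous_on {0<..} (I_int p)" "continuous_on {0<..} (J_int p)" "continuous_on {0<..} (K_int p)"
  using DERIV_isCont[OF I_int_deriv[OF p]] DERIV_isCont[OF J_int_deriv[OF p]] DERIV_isCont[OF K_int_deriv[OF p]]
  by (auto intro!: continuous_at_imp_continuous_on)

lemma continuous_on_qfun:
  assumes p: "p > 1" shows "continuous_on {0<..} (qfun p)"
proof -
  have "\<theta> * J_int p \<theta> \<noteq> 0" if "\<theta> \<in> {0<..}" for \<theta>
    using int_pos(2)[OF p, of \<theta>] that by simp
  then show ?thesis
    unfolding qfun_def[abs_def] by (intro continuous_intros continuous_on_ints p) auto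
qed

lemma continuous_on_dcrit:
  assumes p: "p > 1" shows "continuous_on {0<..} (dcrit p)"
proof -
  have "I_int p \<theta> \<noteq> 0" if "\<theta> \<in> {0<..}" for \<theta>
    using int_pos(1)[OF p, of \<theta>] that by simp
  then show ?thesis
    unfolding dcrit_def[abs_def] by (intro continuous_intros continuous_on_ints p) auto
qed

lemma crit_strict_mono:
  assumes p: "p > 1" and "0 < x" "x < y"
  shows "crit p x < crit p y"
proof (rule DERIV_pos_imp_increasing[OF \<open>x < y\<close>])
  fix z assume "x \<le> z" "z \<le> y"
  then have "z > 0" using assms by simp
  then show "\<exists>l. (crit p has_real_derivative l) (at z) \<and> l > 0"
    using crit_deriv[OF p] dcrit_pos[OF p] by blast
qed

text \<open>\<open>crit\<close> tends to 0 at 0 and is at least a multiple of sqrt \<theta> for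
  \<theta> \<ge> 1, because sqrt \<theta> J increases and I decreases.\<close>

lemma crit_surj:
  assumes p: "p > 1" and y: "y > 0"
  obtains \<theta> where "\<theta> > 0" "crit p \<theta> = y"
proof -
  have cont: "continuous_on {0<..} (crit p)"
    using DERIV_isCont[OF crit_deriv[OF p]] by (auto intro!: continuous_at_imp_continuous_on)
  have "((\<lambda>\<theta>. \<theta> * J_int p \<theta> / I_int p \<theta>) \<longlongrightarrow> 0 * J_int p 0 / I_int p 0) (at_right 0)"
    using p int_pos[OF p, of 0] unfolding I_int_eq_mom J_int_eq_mom
    by (intro tendsto_intros mom_tendsto_at_right_0) auto
  then have "(crit p \<longlongrightarrow> 0) (at_right 0)" by (simp add: crit_def[abs_def])
  then have "eventually (\<lambda>\<theta>. crit p \<theta> < y) (at_right 0)" using y by (rule order_tendstoD)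
  then obtain b where b: "b > 0" "\<And>\<theta>. 0 < \<theta> \<Longrightarrow> \<theta> < b \<Longrightarrow> crit p \<theta> < y"
    unfolding eventually_at_right_field by blast
  define x1 where "x1 = min (b / 2) (1 / 2)"
  have x1: "x1 > 0" "x1 < 1" "crit p x1 < y" using b by (auto simp: x1_def)
  define C where "C = J_int p 1 / I_int p 1"
  have C: "C > 0" using int_pos[OF p, of 1] by (simp add: C_def)
  have big: "sqrt \<theta> * C \<le> crit p \<theta>" if "\<theta> \<ge> 1" for \<theta>
  proof -
    have t: "\<theta> > 0" using that by simp
    have "mom (2 * p - 2) p (p - 2) (1 powr (- p / (2 * p - 2))) \<le> mom (2 * p - 2) p (p - 2) (\<theta> powr (- p / (2 * p - 2)))"
      using that p by (intro mom_antimono powr_mono2') auto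
    then have "J_int p 1 \<le> \<theta> powr (1 / 2) * J_int p \<theta>"
      using J_int_scaling[OF p, of 1] J_int_scaling[OF p t] t
      by (simp add: mult.assoc[symmetric] powr_add[symmetric])
    then have "J_int p 1 \<le> sqrt \<theta> * J_int p \<theta>" using t by (simp add: powr_half_sqrt)
    moreover have "I_int p \<theta> \<le> I_int p 1" unfolding I_int_eq_mom using that p by (intro mom_antimono) auto
    ultimately have "C \<le> sqrt \<theta> * J_int p \<theta> / I_int p \<theta>"
      unfolding C_def using int_pos[OF p, of \<theta>] int_pos[OF p, of 1] t by (intro frac_le) auto
    then have "sqrt \<theta> * C \<le> sqrt \<theta> * (sqrt \<theta> * J_int p \<theta> / I_int p \<theta>)"
      using t by (intro mult_left_mono) auto
    also have "\<dots> = crit p \<theta>" using t by (simp add: crit_def mult.assoc[symmetric])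
    finally show ?thesis .
  qed
  \<comment> \<open>The square makes sqrt x2 at least y / C; the summand 1 puts x2 into the range of
    the lower bound \<open>big\<close>.\<close>
  define x2 where "x2 = 1 + (y / C)\<^sup>2"
  have "y / C \<le> sqrt x2" unfolding x2_def using C y by (intro real_le_rsqrt) auto
  then have "y \<le> sqrt x2 * C" using C by (simp add: pos_divide_le_eq)
  also have "\<dots> \<le> crit p x2" by (rule big) (simp add: x2_def)
  finally have x2: "y \<le> crit p x2" "x1 \<le> x2" using x1 by (auto simp: x2_def intro: order_trans[of _ 1])
  have "\<exists>\<theta>\<ge>x1. \<theta> \<le> x2 \<and> crit p \<theta> = y"
    using x1 x2 by (intro IVT' continuous_on_subset[OF cont]) auto
  then obtain \<theta> where "x1 \<le> \<theta>" "crit p \<theta> = y" by blast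
  then show ?thesis using x1 by (intro that[of \<theta>]) auto
qed

section \<open>The phase and its maximizer\<close>

lemma phase_deriv:
  assumes p: "p > 1" and \<theta>: "\<theta> > 0"
  shows "(phase p \<beta> has_real_derivative qfun p \<theta> * ((1 - \<beta>) * (p / (2 * p - 2)) - \<beta> * crit p \<theta>)) (at \<theta>)"
proof -
  note pos = int_pos[OF p less_imp_le[OF \<theta>]]
  have "((\<lambda>\<theta>. (1 - \<beta>) / 2 * ln \<theta> + \<beta> * ln (I_int p \<theta>) + (1 - \<beta>) * ln (J_int p \<theta>)) has_real_derivative
     (1 - \<beta>) / 2 * (1 / \<theta>) + \<beta> * (1 / I_int p \<theta> * (- K_int p \<theta>)) +
       (1 - \<beta>) * (1 / J_int p \<theta> * (- J_int p \<theta> / (2 * \<theta>) + p / (2 * p - 2) * K_int p \<theta> / \<theta>))) (at \<theta>)"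
    using pos \<theta> by (intro DERIV_add DERIV_cmult DERIV_ln_divide DERIV_chain2[OF DERIV_ln_divide] J_int_deriv I_int_deriv p) auto
  moreover have "(1 - \<beta>) / 2 * (1 / \<theta>) + \<beta> * (1 / I * (- K)) + (1 - \<beta>) * (1 / J * (- J / (2 * \<theta>) + C * K / \<theta>)) =
      K / (\<theta> * J) * ((1 - \<beta>) * C - \<beta> * (\<theta> * J / I))" if "I > 0" "J > 0" for I J K C :: real
    using that \<theta> by (simp add: field_simps)
  ultimately show ?thesis using pos by (simp only: phase_def[abs_def] qfun_def crit_def)
qed

text \<open>At z the phase derivative has the sign of crit t - crit z, where t is the critical
  point. The phase rises before t and falls after it, so t is the only point that the description in
  \<open>phase_maximizer\<close> can denote.\<close>

lemma phase_maximizer_properties: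
  assumes p: "p > 1" and \<beta>: "0 < \<beta>" "\<beta> < 1"
  shows phase_maximizer_pos: "phase_maximizer p \<beta> > 0"
    and crit_phase_maximizer: "\<beta> * crit p (phase_maximizer p \<beta>) = (1 - \<beta>) * (p / (2 * p - 2))"
    and phase_mono_left: "\<And>x y. 0 < x \<Longrightarrow> x < y \<Longrightarrow> y \<le> phase_maximizer p \<beta> \<Longrightarrow> phase p \<beta> x < phase p \<beta> y"
    and phase_mono_right: "\<And>x y. phase_maximizer p \<beta> \<le> x \<Longrightarrow> x < y \<Longrightarrow> phase p \<beta> y < phase p \<beta> x"
proof -
  define C where "C = p / (2 * p - 2)"
  have C: "C > 0" using p by (simp add: C_def)
  obtain t where t: "t > 0" "crit p t = (1 - \<beta>) * C / \<beta>"
    using crit_surj[OF p, of "(1 - \<beta>) * C / \<beta>"] \<beta> C by auto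
  have th: "\<beta> * crit p t = (1 - \<beta>) * C" using t \<beta> by simp
  have der: "\<exists>D. (phase p \<beta> has_real_derivative D) (at z) \<and> (z < t \<longrightarrow> D > 0) \<and> (z > t \<longrightarrow> D < 0)" if z: "z > 0" for z
  proof (intro exI conjI impI)
    show "(phase p \<beta> has_real_derivative qfun p z * ((1 - \<beta>) * (p / (2 * p - 2)) - \<beta> * crit p z)) (at z)"
      by (rule phase_deriv[OF p z])
    show "qfun p z * ((1 - \<beta>) * (p / (2 * p - 2)) - \<beta> * crit p z) > 0" if "z < t"
      using crit_strict_mono[OF p z that] qfun_pos[OF p z] \<beta> th by (simp add: C_def[symmetric] flip: th)
    show "qfun p z * ((1 - \<beta>) * (p / (2 * p - 2)) - \<beta> * crit p z) < 0" if "z > t"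
      using crit_strict_mono[OF p t(1) that] qfun_pos[OF p z] \<beta> th
      by (simp add: C_def[symmetric] mult_less_0_iff flip: th)
  qed
  have cont: "continuous_on {0<..} (phase p \<beta>)"
    using DERIV_isCont[OF phase_deriv[OF p]] by (auto intro!: continuous_at_imp_continuous_on)
  have left: "phase p \<beta> x < phase p \<beta> y" if "0 < x" "x < y" "y \<le> t" for x y
  proof (rule DERIV_pos_imp_increasing_open[OF that(2)])
    fix z assume "x < z" "z < y"
    then show "\<exists>D. (phase p \<beta> has_real_derivative D) (at z) \<and> D > 0" using der[of z] that by auto
  qed (use that in \<open>auto intro: continuous_on_subset[OF cont]\<close>)
  have right: "phase p \<beta> y < phase p \<beta> x" if "t \<le> x" "x < y" for x y
  proof (rule DERIV_neg_imp_decreasing_open[OF that(2)])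
    fix z assume "x < z" "z < y"
    then show "\<exists>D. (phase p \<beta> has_real_derivative D) (at z) \<and> D < 0" using der[of z] that t(1) by auto
  qed (use that t(1) in \<open>auto intro: continuous_on_subset[OF cont]\<close>)
  have less: "phase p \<beta> x < phase p \<beta> t" if "x > 0" "x \<noteq> t" for x
    using left[of x t] right[of t x] that by (cases "x < t") auto
  have "phase_maximizer p \<beta> = t"
    unfolding phase_maximizer_def
  proof (rule the_equality)
    show "is_arg_max (phase p \<beta>) (\<lambda>\<theta>. \<theta> > 0) t"
      unfolding is_arg_max_def using t(1) less by (metis less_asym' order_less_irrefl)
    fix x assume "is_arg_max (phase p \<beta>) (\<lambda>\<theta>. \<theta> > 0) x"
    then show "x = t" unfolding is_arg_max_def using t(1) less by blast
  qed
  then show "phase_maximizer p \<beta> > 0" "\<beta> * crit p (phase_maximizer p \<beta>) = (1 - \<beta>) * (p / (2 * p - 2))"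
    "\<And>x y. 0 < x \<Longrightarrow> x < y \<Longrightarrow> y \<le> phase_maximizer p \<beta> \<Longrightarrow> phase p \<beta> x < phase p \<beta> y"
    "\<And>x y. phase_maximizer p \<beta> \<le> x \<Longrightarrow> x < y \<Longrightarrow> phase p \<beta> y < phase p \<beta> x"
    using t th left right by (simp_all add: C_def)
qed

lemma phase_le_maximizer:
  assumes p: "p > 1" and \<beta>: "0 < \<beta>" "\<beta> < 1" and "\<theta> > 0"
  shows "phase p \<beta> \<theta> \<le> phase p \<beta> (phase_maximizer p \<beta>)"
  using phase_mono_left[OF p \<beta>, of \<theta> "phase_maximizer p \<beta>"] phase_mono_right[OF p \<beta>, of "phase_maximizer p \<beta>" \<theta>] assms
  by (cases \<theta> "phase_maximizer p \<beta>" rule: linorder_cases) auto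

text \<open>The phase derivative is \<open>qfun\<close> times a factor that vanishes at the
  maximizer, so the product rule leaves only \<open>qfun\<close> times the derivative of that
  factor.\<close>

lemma phase_second_deriv:
  assumes p: "p > 1" and \<beta>: "0 < \<beta>" "\<beta> < 1"
  defines "t \<equiv> phase_maximizer p \<beta>"
  shows "(deriv ^^ 2) (phase p \<beta>) t = - (\<beta> * qfun p t * dcrit p t)"
proof -
  define C where "C = p / (2 * p - 2)"
  have t: "t > 0" and th: "\<beta> * crit p t = (1 - \<beta>) * C"
    using phase_maximizer_properties[OF p \<beta>] by (simp_all add: t_def C_def)
  note pos = int_pos[OF p less_imp_le[OF t]]
  have "\<exists>Dq. (qfun p has_real_derivative Dq) (at t)"
    unfolding qfun_def[abs_def]
    by (rule exI, rule DERIV_divide[OF K_int_deriv[OF p t] DERIV_mult[OF DERIV_ident J_int_deriv[OF p t]]])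
      (use pos t in auto)
  then obtain Dq where Dq: "(qfun p has_real_derivative Dq) (at t)" by blast
  have "((\<lambda>z. (1 - \<beta>) * C - \<beta> * crit p z) has_real_derivative 0 - \<beta> * dcrit p t) (at t)"
    by (intro DERIV_diff DERIV_const DERIV_cmult crit_deriv p t)
  from DERIV_mult[OF Dq this]
  have "((\<lambda>z. qfun p z * ((1 - \<beta>) * C - \<beta> * crit p z)) has_real_derivative - (\<beta> * qfun p t * dcrit p t)) (at t)"
    by (simp add: th mult_ac)
  then have "(deriv (phase p \<beta>) has_real_derivative - (\<beta> * qfun p t * dcrit p t)) (at t)"
  proof (rule has_field_derivative_transform_within_open[of _ _ _ "{0<..}"])
    fix z :: real assume "z \<in> {0<..}"
    then show "qfun p z * ((1 - \<beta>) * C - \<beta> * crit p z) = deriv (phase p \<beta>) z"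
      using DERIV_imp_deriv[OF phase_deriv[OF p, of z \<beta>]] by (simp add: C_def)
  qed (use t in auto)
  then have "deriv (deriv (phase p \<beta>)) t = - (\<beta> * qfun p t * dcrit p t)" by (rule DERIV_imp_deriv)
  then show ?thesis by (simp add: numeral_2_eq_2)
qed

text \<open>Cauchy's mean value theorem compares the phase with the squared increment of \<open>crit\<close>, so that no derivative of \<open>qfun\<close> is needed.\<close>

lemma phase_quadratic:
  assumes p: "p > 1" and \<beta>: "0 < \<beta>" "\<beta> < 1" and \<theta>: "\<theta> > 0"
  defines "t \<equiv> phase_maximizer p \<beta>"
  shows "\<exists>x\<in>{min \<theta> t..max \<theta> t}. \<exists>y\<in>{min \<theta> t..max \<theta> t}.
    phase p \<beta> \<theta> - phase p \<beta> t = - (\<beta> / 2 * (qfun p x / dcrit p x) * (dcrit p y)\<^sup>2 * (\<theta> - t)\<^sup>2)"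
proof -
  define C where "C = p / (2 * p - 2)"
  have t: "t > 0" and th: "\<beta> * crit p t = (1 - \<beta>) * C"
    using phase_maximizer_properties[OF p \<beta>] by (simp_all add: t_def C_def)
  define a where "a = min \<theta> t"
  define b where "b = max \<theta> t"
  have ab0: "a > 0" using \<theta> t by (simp add: a_def)
  show ?thesis
  proof (cases "\<theta> = t")
    case True
    then show ?thesis by auto
  next
    case False
    then have ab: "a < b" by (auto simp: a_def b_def)
    \<comment> \<open>Its derivative 2 (crit z - crit t) dcrit z shares the factor crit z - crit t
      with the phase derivative, so the ratio is -\<beta> qfun / (2 dcrit), regular at t.\<close>
    define w where "w = (\<lambda>z. (crit p z - crit p t)\<^sup>2)"
    have dw: "(w has_real_derivative 2 * (crit p z - crit p t) * dcrit p z) (at z)" if "z > 0" for z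
      unfolding w_def using crit_deriv[OF p that] by (auto intro!: derivative_eq_intros)
    have "\<exists>x. a < x \<and> x < b \<and> (phase p \<beta> b - phase p \<beta> a) * (2 * (crit p x - crit p t) * dcrit p x) =
        (w b - w a) * (qfun p x * ((1 - \<beta>) * (p / (2 * p - 2)) - \<beta> * crit p x))"
    proof (rule GMVT'[OF ab])
      fix z assume "a \<le> z" "z \<le> b"
      then have z: "z > 0" using ab0 by simp
      show "isCont (phase p \<beta>) z" by (rule DERIV_isCont[OF phase_deriv[OF p z]])
      show "isCont w z" by (rule DERIV_isCont[OF dw[OF z]])
    next
      fix z assume "a < z" "z < b"
      then have z: "z > 0" using ab0 by simp
      show "(w has_real_derivative 2 * (crit p z - crit p t) * dcrit p z) (at z)" by (rule dw[OF z])
      show "(phase p \<beta> has_real_derivative qfun p z * ((1 - \<beta>) * (p / (2 * p - 2)) - \<beta> * crit p z)) (at z)"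
        by (rule phase_deriv[OF p z])
    qed
    then obtain x where x: "a < x" "x < b"
      "(phase p \<beta> b - phase p \<beta> a) * (2 * (crit p x - crit p t) * dcrit p x) =
        (w b - w a) * (qfun p x * ((1 - \<beta>) * (p / (2 * p - 2)) - \<beta> * crit p x))"
      by blast
    have x0: "x > 0" using x ab0 by simp
    have D2: "qfun p x * ((1 - \<beta>) * (p / (2 * p - 2)) - \<beta> * crit p x) = - (\<beta> * qfun p x * (crit p x - crit p t))"
      unfolding C_def[symmetric] th[symmetric] by (simp add: algebra_simps)
    have xt: "x \<noteq> t" using x by (auto simp: a_def b_def min_def max_def split: if_splits)
    then have hx: "crit p x - crit p t \<noteq> 0"
      using crit_strict_mono[OF p, of x t] crit_strict_mono[OF p, of t x] x0 t by (cases "x < t") auto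
    have dpos: "dcrit p x > 0" by (rule dcrit_pos[OF p x0])
    have main: "phase p \<beta> b - phase p \<beta> a = - (\<beta> / 2 * (qfun p x / dcrit p x) * (w b - w a))"
    proof -
      have alg: "P = - (\<beta> / 2 * (Q / d) * W)" if "P * (2 * h * d) = W * (- (\<beta> * Q * h))" "h \<noteq> 0" "d > 0" for P Q W h d :: real
      proof -
        have "h * (P * 2 * d + W * \<beta> * Q) = 0" using that(1) by (simp add: algebra_simps)
        then have "P * 2 * d = - (W * \<beta> * Q)" using that(2) by simp
        then show ?thesis using that(3) by (simp add: field_simps)
      qed
      show ?thesis by (rule alg[OF x(3)[unfolded D2] hx dpos])
    qed
    have eq: "phase p \<beta> \<theta> - phase p \<beta> t = - (\<beta> / 2 * (qfun p x / dcrit p x) * w \<theta>)"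
    proof (cases "\<theta> < t")
      case True
      then have "a = \<theta>" "b = t" "w b = 0" by (auto simp: a_def b_def w_def)
      then show ?thesis using main by (simp add: algebra_simps)
    next
      case F: False
      then have "a = t" "b = \<theta>" "w a = 0" by (auto simp: a_def b_def w_def)
      then show ?thesis using main by (simp add: algebra_simps)
    qed
    obtain y where y: "a < y" "y < b" "crit p b - crit p a = (b - a) * dcrit p y"
      using MVT2[OF ab, of "crit p" "dcrit p"] crit_deriv[OF p] ab0 by auto
    have "w \<theta> = (crit p b - crit p a)\<^sup>2"
      by (auto simp: w_def a_def b_def min_def max_def power2_commute)
    also have "\<dots> = (dcrit p y)\<^sup>2 * (b - a)\<^sup>2" unfolding y(3) by (simp add: power_mult_distrib)
    also have "(b - a)\<^sup>2 = (\<theta> - t)\<^sup>2" by (auto simp: a_def b_def min_def max_def power2_commute)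
    finally have "phase p \<beta> \<theta> - phase p \<beta> t = - (\<beta> / 2 * (qfun p x / dcrit p x) * (dcrit p y)\<^sup>2 * (\<theta> - t)\<^sup>2)"
      using eq by (simp add: mult.assoc)
    then show ?thesis using x y unfolding a_def[symmetric] b_def[symmetric] by force
  qed
qed

text \<open>The value of \<open>crit\<close> at the maximizer is an explicit continuous function of
  \<beta>. As \<open>crit\<close> increases strictly, convergence of the values confines the
  maximizers to any bracket around t.\<close>

lemma phase_maximizer_tendsto:
  assumes p: "p > 1" and \<alpha>: "0 < \<alpha>" "\<alpha> < 1" and lim: "\<beta> \<longlonglongrightarrow> \<alpha>"
  shows "(\<lambda>n. phase_maximizer p (\<beta> n)) \<longlonglongrightarrow> phase_maximizer p \<alpha>"
proof -
  define C where "C = p / (2 * p - 2)"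
  define t where "t = phase_maximizer p \<alpha>"
  have t: "t > 0" and th: "\<alpha> * crit p t = (1 - \<alpha>) * C"
    using phase_maximizer_properties[OF p \<alpha>] by (simp_all add: t_def C_def)
  have ht: "crit p t = (1 - \<alpha>) * C / \<alpha>" using th \<alpha> by (simp add: field_simps)
  have ev: "eventually (\<lambda>n. 0 < \<beta> n \<and> \<beta> n < 1) sequentially"
    using order_tendstoD[OF lim] \<alpha> by (auto intro: eventually_conj)
  have hlim: "(\<lambda>n. (1 - \<beta> n) * C / \<beta> n) \<longlonglongrightarrow> crit p t"
    unfolding ht using \<alpha> by (intro tendsto_intros lim) auto
  show ?thesis
    unfolding t_def[symmetric]
  proof (rule order_tendstoI)
    fix a assume a: "a < t"
    \<comment> \<open>The given a may be negative, whereas \<open>crit\<close> is compared at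
      positive points only.\<close>
    define a' where "a' = max a (t / 2)"
    have a': "a' > 0" "a' < t" "a \<le> a'" using a t by (auto simp: a'_def)
    have "eventually (\<lambda>n. crit p a' < (1 - \<beta> n) * C / \<beta> n) sequentially"
      using crit_strict_mono[OF p a'(1,2)] hlim by (rule order_tendstoD(1)[rotated])
    with ev show "eventually (\<lambda>n. a < phase_maximizer p (\<beta> n)) sequentially"
    proof eventually_elim
      case (elim n)
      define s where "s = phase_maximizer p (\<beta> n)"
      have s: "s > 0" "\<beta> n * crit p s = (1 - \<beta> n) * C"
        using phase_maximizer_properties[OF p, of "\<beta> n"] elim by (auto simp: s_def C_def)
      then have hs: "crit p s = (1 - \<beta> n) * C / \<beta> n" using elim by (simp add: field_simps)
      have "a' < s"
      proof (rule ccontr)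
        assume "\<not> a' < s"
        then have "crit p s \<le> crit p a'"
          using crit_strict_mono[OF p s(1), of a'] by (cases "s = a'") auto
        then show False using elim hs by simp
      qed
      then show ?case using a' by (simp add: s_def)
    qed
  next
    fix a assume a: "t < a"
    have "eventually (\<lambda>n. (1 - \<beta> n) * C / \<beta> n < crit p a) sequentially"
      using crit_strict_mono[OF p t a] hlim by (rule order_tendstoD(2)[rotated])
    with ev show "eventually (\<lambda>n. phase_maximizer p (\<beta> n) < a) sequentially"
    proof eventually_elim
      case (elim n)
      define s where "s = phase_maximizer p (\<beta> n)"
      have s: "s > 0" "\<beta> n * crit p s = (1 - \<beta> n) * C"
        using phase_maximizer_properties[OF p, of "\<beta> n"] elim by (auto simp: s_def C_def)
      then have hs: "crit p s = (1 - \<beta> n) * C / \<beta> n" using elim by (simp add: field_simps)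
      have "s < a"
      proof (rule ccontr)
        assume "\<not> s < a"
        then have "crit p a \<le> crit p s"
          using crit_strict_mono[OF p _, of a s] a t by (cases "s = a") auto
        then show False using elim hs by simp
      qed
      then show ?case by (simp add: s_def)
    qed
  qed
qed

section \<open>Laplace's method and the bulk regime\<close>

text \<open>The moment with exponent 2 and weight 1 equals Gamma(1/2) = sqrt pi; scaling by sqrt a
  does the rest.\<close>

lemma has_bochner_integral_gaussian:
  fixes a :: real
  assumes a: "a > 0"
  shows "has_bochner_integral lborel (\<lambda>v. exp (- (a * v\<^sup>2))) (sqrt (pi / a))"
proof (rule has_bochner_integral_nn_integral)
  have "ennreal (sqrt pi) = (\<integral>\<^sup>+x. ennreal (\<bar>x\<bar> powr 0 * exp (- (\<bar>x\<bar> powr 2))) \<partial>lborel)"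
    using nn_integral_mom_0[of 2 0] by (simp add: Gamma_one_half_real)
  also have "\<dots> = (\<integral>\<^sup>+x. ennreal (exp (- x\<^sup>2)) \<partial>lborel)"
    using AE_lborel_singleton[of "0::real"] by (intro nn_integral_cong_AE, eventually_elim) simp
  also have "\<dots> = \<bar>sqrt a\<bar> * (\<integral>\<^sup>+v. ennreal (exp (- (0 + sqrt a * v)\<^sup>2)) \<partial>lborel)"
    by (rule nn_integral_real_affine) (use a in auto)
  also have "(\<integral>\<^sup>+v. ennreal (exp (- (0 + sqrt a * v)\<^sup>2)) \<partial>lborel) = (\<integral>\<^sup>+v. ennreal (exp (- (a * v\<^sup>2))) \<partial>lborel)"
    using a by (simp add: power_mult_distrib)
  finally have *: "ennreal (sqrt pi) = ennreal (sqrt a) * (\<integral>\<^sup>+v. ennreal (exp (- (a * v\<^sup>2))) \<partial>lborel)"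
    using a by simp
  have "ennreal (sqrt (pi / a)) = ennreal (1 / sqrt a) * ennreal (sqrt pi)"
    using a by (simp add: ennreal_mult'[symmetric] real_sqrt_divide)
  also have "\<dots> = (ennreal (1 / sqrt a) * ennreal (sqrt a)) * (\<integral>\<^sup>+v. ennreal (exp (- (a * v\<^sup>2))) \<partial>lborel)"
    unfolding * by (simp only: mult.assoc)
  also have "ennreal (1 / sqrt a) * ennreal (sqrt a) = 1"
    using a by (simp add: ennreal_mult'[symmetric])
  finally show "(\<integral>\<^sup>+v. ennreal (exp (- (a * v\<^sup>2))) \<partial>lborel) = ennreal (sqrt (pi / a))" by simp
qed (use a in auto)

lemma measurable_ints [measurable]:
  "I_int p \<in> borel_measurable borel" "J_int p \<in> borel_measurable borel" "K_int p \<in> borel_measurable borel"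
  unfolding I_int_eq_mom J_int_eq_mom K_int_eq_mom by measurable

lemma measurable_phase [measurable]: "phase p \<beta> \<in> borel_measurable borel"
  unfolding phase_def[abs_def] by measurable

lemma measurable_qfun [measurable]: "qfun p \<in> borel_measurable borel"
  unfolding qfun_def[abs_def] by measurable

text \<open>With \<beta> = j / n the exponential has j factors I, n - j factors J and
  \<theta>^((n-j)/2). The integrand has one J and one \<theta> less and one K more, which is
  \<open>qfun\<close>. The identity is exact for every n.\<close>

lemma theta_integral_integrand_eq_exp_phase:
  assumes p: "p > 1" and j: "j < n" and \<theta>: "\<theta> > 0"
  shows "\<theta> powr ((real (n - j - 1) + 1) / 2 - 1) * K_int p \<theta> * J_int p \<theta> ^ (n - j - 1) * I_int p \<theta> ^ j =
    qfun p \<theta> * exp (real n * phase p (real j / real n) \<theta>)"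
proof -
  note pos = int_pos[OF p less_imp_le[OF \<theta>]]
  define m where "m = n - j - 1"
  have n: "real n = real m + 1 + real j" "real n > 0" using j by (auto simp: m_def of_nat_diff)
  have "real n * phase p (real j / real n) \<theta> =
      (real m + 1) / 2 * ln \<theta> + real j * ln (I_int p \<theta>) + real (Suc m) * ln (J_int p \<theta>)"
  proof -
    have a: "real n * (real j / real n) = real j" using n(2) by simp
    then have b: "real n * (1 - real j / real n) = real m + 1" using n by (simp add: right_diff_distrib)
    have "real n * phase p (real j / real n) \<theta> = (real n * (1 - real j / real n)) / 2 * ln \<theta> +
        (real n * (real j / real n)) * ln (I_int p \<theta>) + (real n * (1 - real j / real n)) * ln (J_int p \<theta>)"
    proof -
      have "x * ((1 - y) / 2 * A + y * B + (1 - y) * C) = (x * (1 - y)) / 2 * A + (x * y) * B + (x * (1 - y)) * C"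
        for x y A B C :: real by (simp add: algebra_simps)
      then show ?thesis unfolding phase_def .
    qed
    then show ?thesis unfolding a b by simp
  qed
  then have "exp (real n * phase p (real j / real n) \<theta>) = \<theta> powr ((real m + 1) / 2) * I_int p \<theta> ^ j * J_int p \<theta> ^ Suc m"
    using pos \<theta> by (simp only: exp_add exp_of_nat_mult exp_ln powr_def if_False less_irrefl) simp
  also have "\<theta> powr ((real m + 1) / 2) = \<theta> powr ((real m + 1) / 2 - 1) * \<theta>"
  proof -
    have "\<theta> powr (((real m + 1) / 2 - 1) + 1) = \<theta> powr ((real m + 1) / 2 - 1) * \<theta> powr 1" by (rule powr_add)
    then show ?thesis using \<theta> by (simp only: powr_one diff_add_cancel)
  qed
  finally show ?thesis using pos \<theta> unfolding m_def[symmetric] by (simp add: qfun_def)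
qed

lemma has_bochner_integral_theta_integral_phase:
  assumes p: "p > 1" and j: "j < n"
  shows "has_bochner_integral lborel (\<lambda>\<theta>. indicator {0<..} \<theta> * (qfun p \<theta> * exp (real n * phase p (real j / real n) \<theta>)))
    (enn2real (theta_integral p (n - j - 1) j))"
proof -
  have "(\<lambda>\<theta>. indicator {0<..} \<theta> * (qfun p \<theta> * exp (real n * phase p (real j / real n) \<theta>))) =
    (\<lambda>\<theta>. indicator {0<..} \<theta> * (\<theta> powr ((real (n - j - 1) + 1) / 2 - 1) *
     mom p (2 * p - 2) (2 * p - 2) \<theta> * mom p (2 * p - 2) (p - 2) \<theta> ^ (n - j - 1) * mom p (2 * p - 2) 0 \<theta> ^ j))"
  proof
    fix \<theta>
    show "indicator {0<..} \<theta> * (qfun p \<theta> * exp (real n * phase p (real j / real n) \<theta>)) =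
      indicator {0<..} \<theta> * (\<theta> powr ((real (n - j - 1) + 1) / 2 - 1) *
     mom p (2 * p - 2) (2 * p - 2) \<theta> * mom p (2 * p - 2) (p - 2) \<theta> ^ (n - j - 1) * mom p (2 * p - 2) 0 \<theta> ^ j)"
      using theta_integral_integrand_eq_exp_phase[OF p j, of \<theta>] unfolding I_int_eq_mom J_int_eq_mom K_int_eq_mom
      by (cases "\<theta> > 0") auto
  qed
  then show ?thesis using has_bochner_integral_theta_integral[OF p] by presburger
qed

section \<open>A majorant uniform in the proportion j / n\<close>

lemma powr_le_linear:
  fixes x X e N :: real
  assumes "0 < x" "x \<le> X" "1 \<le> e" "e \<le> N"
  shows "x powr e \<le> x * max 1 X powr N"
proof -
  have "x powr (1 + (e - 1)) = x powr 1 * x powr (e - 1)" by (rule powr_add)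
  then have "x powr e = x powr 1 * x powr (e - 1)" by simp
  also have "\<dots> = x * x powr (e - 1)" using assms by simp
  also have "x powr (e - 1) \<le> max 1 X powr (e - 1)" using assms by (intro powr_mono2) auto
  also have "max 1 X powr (e - 1) \<le> max 1 X powr N" using assms by (intro powr_mono) auto
  finally show ?thesis using assms by (simp add: mult_left_mono)
qed

text \<open>sqrt \<theta> J and I are bounded, so powers of them with exponents between 1 and N
  reduce to first powers times a constant independent of \<beta> and \<theta>. Against
  \<open>qfun\<close> these first powers are integrable.\<close>

lemma exp_phase_bound:
  assumes p: "p > 1"
  obtains C where "\<And>\<beta> \<theta>. 1 \<le> N * \<beta> \<Longrightarrow> 1 \<le> N * (1 - \<beta>) \<Longrightarrow> \<theta> > 0 \<Longrightarrow>
    exp (N * phase p \<beta> \<theta>) \<le> C * (\<theta> powr (1 / 2) * J_int p \<theta> * I_int p \<theta>)" "C > 0"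
proof -
  define A where "A = mom (2 * p - 2) p (p - 2) 0"
  define I0 where "I0 = I_int p 0"
  define C where "C = max 1 A powr N * max 1 I0 powr N"
  have "exp (N * phase p \<beta> \<theta>) \<le> C * (\<theta> powr (1 / 2) * J_int p \<theta> * I_int p \<theta>)"
    if N: "1 \<le> N * \<beta>" "1 \<le> N * (1 - \<beta>)" and \<theta>: "\<theta> > 0" for \<beta> \<theta>
  proof -
    note pos = int_pos[OF p less_imp_le[OF \<theta>]]
    define a where "a = \<theta> powr (1 / 2) * J_int p \<theta>"
    have a: "a > 0" using pos \<theta> by (simp add: a_def)
    have "a = mom (2 * p - 2) p (p - 2) (\<theta> powr (- p / (2 * p - 2)))"
      unfolding a_def J_int_scaling[OF p \<theta>] using \<theta> by (simp add: mult.assoc[symmetric] powr_add[symmetric])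
    also have "\<dots> \<le> A" unfolding A_def using p by (intro mom_antimono) auto
    finally have aA: "a \<le> A" .
    have II: "I_int p \<theta> \<le> I0" unfolding I0_def I_int_eq_mom using p \<theta> by (intro mom_antimono) auto
    have "N * (1 - \<beta>) = N - N * \<beta>" by (simp add: algebra_simps)
    then have N2: "N * \<beta> \<le> N" "N * (1 - \<beta>) \<le> N" using N by linarith+
    have lna: "ln a = 1 / 2 * ln \<theta> + ln (J_int p \<theta>)"
      unfolding a_def using pos \<theta> by (simp add: ln_mult ln_powr)
    have "N * phase p \<beta> \<theta> = N * (1 - \<beta>) * ln a + N * \<beta> * ln (I_int p \<theta>)"
      unfolding lna phase_def by (simp add: algebra_simps)
    then have "exp (N * phase p \<beta> \<theta>) = a powr (N * (1 - \<beta>)) * I_int p \<theta> powr (N * \<beta>)"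
      using a pos by (simp add: powr_def exp_add)
    also have "\<dots> \<le> (a * max 1 A powr N) * (I_int p \<theta> * max 1 I0 powr N)"
      using a pos aA II N N2 by (intro mult_mono powr_le_linear) auto
    also have "\<dots> = C * (a * I_int p \<theta>)" by (simp add: C_def mult_ac)
    finally show ?thesis by (simp add: a_def)
  qed
  moreover have "C > 0" by (simp add: C_def)
  ultimately show ?thesis using that by blast
qed

lemma phase_tendsto:
  assumes "\<beta> \<longlonglongrightarrow> \<alpha>"
  shows "(\<lambda>n. phase p (\<beta> n) \<theta>) \<longlonglongrightarrow> phase p \<alpha> \<theta>"
  unfolding phase_def by (intro tendsto_intros assms) auto

text \<open>The maximizer s n for the proportion j n / n moves with n, so the integral is centred
  there by \<theta> = s n + v / sqrt n. The exact quadratic expression for the phase gives both the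
  Gaussian majorant and the pointwise limit; far from t a uniform gap of the phase produces
  exponential decay.\<close>

lemma theta_integral_laplace:
  fixes j :: "nat \<Rightarrow> nat"
  assumes p: "p > 1" and \<alpha>: "0 < \<alpha>" "\<alpha> < 1" and lim: "(\<lambda>n. real (j n) / real n) \<longlonglongrightarrow> \<alpha>"
  defines "t \<equiv> phase_maximizer p \<alpha>"
  shows "(\<lambda>n. sqrt (real n) * (enn2real (theta_integral p (n - j n - 1) (j n)) *
      exp (- (real n * phase p (real (j n) / real n) (phase_maximizer p (real (j n) / real n))))))
    \<longlonglongrightarrow> qfun p t * sqrt (2 * pi / (\<alpha> * qfun p t * dcrit p t))"
proof -
  define b where "b = (\<lambda>n. real (j n) / real n)"
  have blim: "b \<longlonglongrightarrow> \<alpha>" using lim by (simp add: b_def)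
  define s where "s = (\<lambda>n. phase_maximizer p (b n))"
  have slim: "s \<longlonglongrightarrow> t" unfolding s_def t_def by (rule phase_maximizer_tendsto[OF p \<alpha> blim])
  have t: "t > 0" unfolding t_def by (rule phase_maximizer_pos[OF p \<alpha>])
  define R where "R = (\<lambda>n \<theta>. phase p (b n) \<theta> - phase p (b n) (s n))"
  have [measurable]: "R n \<in> borel_measurable borel" for n unfolding R_def by measurable
  let ?g = "\<lambda>n \<theta>. qfun p \<theta> * exp (real n * R n \<theta>)"
  \<comment> \<open>Keeps the compact neighbourhood \<open>N\<close> of t inside the positive
    reals.\<close>
  define \<delta> where "\<delta> = t / 2"
  have \<delta>: "\<delta> > 0" "t - \<delta> > 0" using t by (auto simp: \<delta>_def)
  define N where "N = {t - \<delta>..t + \<delta>}"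
  have N_pos: "\<theta> > 0" if "\<theta> \<in> N" for \<theta> using that \<delta> by (auto simp: N_def)
  have N_sub: "N \<subseteq> {0<..}" using N_pos by auto
  have N_cpt: "compact N" "N \<noteq> {}" "t \<in> N" using \<delta> by (auto simp: N_def)
  have [measurable]: "N \<in> sets borel" by (simp add: N_def)
  have cq: "continuous_on N (qfun p)" by (rule continuous_on_subset[OF continuous_on_qfun[OF p] N_sub])
  have cd: "continuous_on N (dcrit p)" by (rule continuous_on_subset[OF continuous_on_dcrit[OF p] N_sub])
  have cqd: "continuous_on N (\<lambda>x. qfun p x / dcrit p x)"
    using cq cd dcrit_pos[OF p] N_pos by (intro continuous_intros) (auto simp: less_imp_neq[symmetric])
  obtain Q where Q: "\<And>\<theta>. \<theta> \<in> N \<Longrightarrow> qfun p \<theta> \<le> Q"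
    using continuous_attains_sup[OF N_cpt(1,2) cq] by blast
  obtain m1 where m1: "m1 > 0" "\<And>\<theta>. \<theta> \<in> N \<Longrightarrow> m1 \<le> qfun p \<theta> / dcrit p \<theta>"
    using continuous_attains_inf[OF N_cpt(1,2) cqd] qfun_pos[OF p N_pos] dcrit_pos[OF p N_pos] divide_pos_pos by metis
  obtain m2 where m2: "m2 > 0" "\<And>\<theta>. \<theta> \<in> N \<Longrightarrow> m2 \<le> dcrit p \<theta>"
    using continuous_attains_inf[OF N_cpt(1,2) cd] dcrit_pos[OF p N_pos] by metis
  have Q0: "Q > 0" using Q[OF N_cpt(3)] qfun_pos[OF p t] by simp
  \<comment> \<open>A lower bound over \<open>N\<close> for the quadratic coefficient (b n / 2)
    (qfun / dcrit) dcrit^2, with b n \<ge> \<alpha> / 2.\<close>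
  define k where "k = \<alpha> / 4 * m1 * m2\<^sup>2"
  have k: "k > 0" using \<alpha> m1 m2 by (simp add: k_def)
  define good where "good = (\<lambda>n. n > 0 \<and> j n < n \<and> \<alpha> / 2 \<le> b n \<and> 0 < b n \<and> b n < 1 \<and> s n \<in> N)"
  have ev_b: "eventually (\<lambda>n. \<alpha> / 2 < b n \<and> b n < 1) sequentially"
    using order_tendstoD(1)[OF blim, of "\<alpha> / 2"] order_tendstoD(2)[OF blim, of 1] \<alpha>
    by (intro eventually_conj) auto
  have ev_s: "eventually (\<lambda>n. t - \<delta> < s n \<and> s n < t + \<delta>) sequentially"
    using order_tendstoD(1)[OF slim, of "t - \<delta>"] order_tendstoD(2)[OF slim, of "t + \<delta>"] \<delta>
    by (intro eventually_conj) auto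
  have ev_good: "eventually good sequentially"
    using ev_b ev_s eventually_gt_at_top[of 0]
  proof eventually_elim
    case (elim n)
    then have "j n < n" unfolding b_def by (simp add: pos_divide_less_eq)
    then show ?case using elim \<alpha> by (auto simp: good_def N_def)
  qed
  have quad: "\<exists>x\<in>{min \<theta> (s n)..max \<theta> (s n)}. \<exists>y\<in>{min \<theta> (s n)..max \<theta> (s n)}.
      R n \<theta> = - (b n / 2 * (qfun p x / dcrit p x) * (dcrit p y)\<^sup>2 * (\<theta> - s n)\<^sup>2)" if "good n" "\<theta> > 0" for n \<theta>
    using phase_quadratic[OF p, of "b n" \<theta>] that unfolding good_def R_def s_def by blast
  have R_le: "R n \<theta> \<le> - (k * (\<theta> - s n)\<^sup>2)" if g: "good n" and \<theta>: "\<theta> \<in> N" for n \<theta>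
  proof -
    obtain x y where xy: "x \<in> {min \<theta> (s n)..max \<theta> (s n)}" "y \<in> {min \<theta> (s n)..max \<theta> (s n)}"
        "R n \<theta> = - (b n / 2 * (qfun p x / dcrit p x) * (dcrit p y)\<^sup>2 * (\<theta> - s n)\<^sup>2)"
      using quad[OF g N_pos[OF \<theta>]] by blast
    have "x \<in> N" "y \<in> N" using xy(1,2) \<theta> g unfolding good_def N_def by auto
    then have "m1 \<le> qfun p x / dcrit p x" "m2\<^sup>2 \<le> (dcrit p y)\<^sup>2"
      using m1 m2 by (auto intro!: power_mono)
    moreover have "0 \<le> qfun p x / dcrit p x" using calculation(1) m1(1) by linarith
    moreover have "\<alpha> / 4 \<le> b n / 2" "0 \<le> b n / 2" using g by (auto simp: good_def)
    ultimately have "\<alpha> / 4 * m1 * m2\<^sup>2 \<le> b n / 2 * (qfun p x / dcrit p x) * (dcrit p y)\<^sup>2"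
      using \<alpha> m1(1) by (intro mult_mono mult_nonneg_nonneg) auto
    then have "k * (\<theta> - s n)\<^sup>2 \<le> b n / 2 * (qfun p x / dcrit p x) * (dcrit p y)\<^sup>2 * (\<theta> - s n)\<^sup>2"
      unfolding k_def by (intro mult_right_mono) auto
    then show ?thesis unfolding xy(3) by simp
  qed
  \<comment> \<open>Half the modulus of the second derivative of the limiting phase at t.\<close>
  define a where "a = \<alpha> / 2 * (qfun p t * dcrit p t)"
  have a: "a > 0" using \<alpha> qfun_pos[OF p t] dcrit_pos[OF p t] by (simp add: a_def)
  \<comment> \<open>Set to 0 at the finitely many bad indices, so that the majorant holds for every
    n.\<close>
  define f where "f = (\<lambda>n v. if good n then indicator N (s n + v / sqrt (real n)) *
      (qfun p (s n + v / sqrt (real n)) * exp (real n * R n (s n + v / sqrt (real n)))) else 0)"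
  have near_dom: "(\<lambda>n. \<integral>v. f n v \<partial>lborel) \<longlonglongrightarrow> (\<integral>v. qfun p t * exp (- (a * v\<^sup>2)) \<partial>lborel)"
  proof (rule integral_dominated_convergence)
    show "integrable lborel (\<lambda>v. Q * exp (- (k * v\<^sup>2)))"
      using has_bochner_integral_gaussian[OF k] by (intro integrable_mult_right) (simp add: has_bochner_integral_iff)
    show "f n \<in> borel_measurable lborel" for n
      unfolding f_def by measurable
    fix n
    show "AE v in lborel. norm (f n v) \<le> Q * exp (- (k * v\<^sup>2))"
    proof (rule AE_I2)
      fix v :: real
      define \<theta> where "\<theta> = s n + v / sqrt (real n)"
      show "norm (f n v) \<le> Q * exp (- (k * v\<^sup>2))"
      proof (cases "good n \<and> \<theta> \<in> N")
        case True
        then have n: "n > 0" by (simp add: good_def)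
        have "real n * R n \<theta> \<le> real n * (- (k * (\<theta> - s n)\<^sup>2))"
          using R_le True by (intro mult_left_mono) auto
        also have "\<dots> = - (k * v\<^sup>2)" using n by (simp add: \<theta>_def power_divide)
        finally have "?g n \<theta> \<le> Q * exp (- (k * v\<^sup>2))"
          using Q True Q0 by (intro mult_mono) auto
        moreover have "norm (f n v) = ?g n \<theta>"
          using True qfun_pos[OF p N_pos, of \<theta>] by (simp add: f_def \<theta>_def abs_mult)
        ultimately show ?thesis by simp
      next
        case False
        then have "f n v = 0" by (auto simp: f_def \<theta>_def)
        then show ?thesis using Q0 by simp
      qed
    qed
  next
    show "AE v in lborel. (\<lambda>n. f n v) \<longlonglongrightarrow> qfun p t * exp (- (a * v\<^sup>2))"
    proof (rule AE_I2)
      fix v :: real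
      define \<theta> where "\<theta> = (\<lambda>n. s n + v / sqrt (real n))"
      have "(\<lambda>n. v / sqrt (real n)) \<longlonglongrightarrow> 0" by real_asymp
      from tendsto_add[OF slim this] have \<theta>lim: "\<theta> \<longlonglongrightarrow> t" by (simp add: \<theta>_def)
      have ev_\<theta>: "eventually (\<lambda>n. t - \<delta> < \<theta> n \<and> \<theta> n < t + \<delta>) sequentially"
        using order_tendstoD(1)[OF \<theta>lim, of "t - \<delta>"] order_tendstoD(2)[OF \<theta>lim, of "t + \<delta>"] \<delta>
        by (intro eventually_conj) auto
      \<comment> \<open>For fixed v the intermediate points vary with n; lying between \<theta> n
        and s n, they converge to t.\<close>
      have "\<forall>n. \<exists>x y. good n \<and> \<theta> n > 0 \<longrightarrow> x \<in> {min (\<theta> n) (s n)..max (\<theta> n) (s n)} \<and> y \<in> {min (\<theta> n) (s n)..max (\<theta> n) (s n)} \<and>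
        R n (\<theta> n) = - (b n / 2 * (qfun p x / dcrit p x) * (dcrit p y)\<^sup>2 * (\<theta> n - s n)\<^sup>2)"
        using quad by blast
      then obtain X Y where XY: "\<And>n. good n \<Longrightarrow> \<theta> n > 0 \<Longrightarrow> X n \<in> {min (\<theta> n) (s n)..max (\<theta> n) (s n)} \<and> Y n \<in> {min (\<theta> n) (s n)..max (\<theta> n) (s n)} \<and>
        R n (\<theta> n) = - (b n / 2 * (qfun p (X n) / dcrit p (X n)) * (dcrit p (Y n))\<^sup>2 * (\<theta> n - s n)\<^sup>2)"
        by metis
      have ev: "eventually (\<lambda>n. good n \<and> \<theta> n \<in> N \<and> \<theta> n > 0) sequentially"
        using ev_good ev_\<theta> by eventually_elim (use \<delta> in \<open>auto simp: N_def\<close>)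
      have minlim: "(\<lambda>n. min (\<theta> n) (s n)) \<longlonglongrightarrow> t" using tendsto_min[OF \<theta>lim slim] by simp
      have maxlim: "(\<lambda>n. max (\<theta> n) (s n)) \<longlonglongrightarrow> t" using tendsto_max[OF \<theta>lim slim] by simp
      have Xlim: "X \<longlonglongrightarrow> t"
      proof (rule tendsto_sandwich[OF _ _ minlim maxlim])
        show "\<forall>\<^sub>F n in sequentially. min (\<theta> n) (s n) \<le> X n" using ev by eventually_elim (use XY in auto)
        show "\<forall>\<^sub>F n in sequentially. X n \<le> max (\<theta> n) (s n)" using ev by eventually_elim (use XY in auto)
      qed
      have Ylim: "Y \<longlonglongrightarrow> t"
      proof (rule tendsto_sandwich[OF _ _ minlim maxlim])
        show "\<forall>\<^sub>F n in sequentially. min (\<theta> n) (s n) \<le> Y n" using ev by eventually_elim (use XY in auto)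
        show "\<forall>\<^sub>F n in sequentially. Y n \<le> max (\<theta> n) (s n)" using ev by eventually_elim (use XY in auto)
      qed
      have icq: "isCont (qfun p) t" "isCont (dcrit p) t"
        using continuous_on_interior[OF continuous_on_qfun[OF p], of t] continuous_on_interior[OF continuous_on_dcrit[OF p], of t] t
        by (simp_all add: interior_open)
      note L = isCont_tendsto_compose[OF icq(1)] isCont_tendsto_compose[OF icq(2)]
      have "(\<lambda>n. qfun p (\<theta> n) * exp (- (b n / 2 * (qfun p (X n) / dcrit p (X n)) * (dcrit p (Y n))\<^sup>2 * v\<^sup>2)))
          \<longlonglongrightarrow> qfun p t * exp (- (\<alpha> / 2 * (qfun p t / dcrit p t) * (dcrit p t)\<^sup>2 * v\<^sup>2))"
        using dcrit_pos[OF p t] by (intro tendsto_intros L \<theta>lim Xlim Ylim blim) auto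
      moreover have "\<alpha> / 2 * (qfun p t / dcrit p t) * (dcrit p t)\<^sup>2 = a"
        using dcrit_pos[OF p t] by (simp add: a_def power2_eq_square)
      moreover have "eventually (\<lambda>n. qfun p (\<theta> n) * exp (- (b n / 2 * (qfun p (X n) / dcrit p (X n)) * (dcrit p (Y n))\<^sup>2 * v\<^sup>2)) = f n v) sequentially"
        using ev
      proof eventually_elim
        case (elim n)
        then have n: "n > 0" by (simp add: good_def)
        have "real n * (\<theta> n - s n)\<^sup>2 = v\<^sup>2" using n by (simp add: \<theta>_def power_divide)
        then have "real n * R n (\<theta> n) = - (b n / 2 * (qfun p (X n) / dcrit p (X n)) * (dcrit p (Y n))\<^sup>2 * v\<^sup>2)"
          using XY[of n] elim by (metis (no_types, lifting) mult.left_commute mult_minus_right)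
        then show ?case using elim by (simp add: f_def \<theta>_def)
      qed
      ultimately show "(\<lambda>n. f n v) \<longlonglongrightarrow> qfun p t * exp (- (a * v\<^sup>2))"
        using Lim_transform_eventually by force
    qed
  qed measurable
  have near: "(\<lambda>n. sqrt (real n) * (\<integral>\<theta>. indicator N \<theta> * ?g n \<theta> \<partial>lborel)) \<longlonglongrightarrow>
      qfun p t * sqrt (2 * pi / (\<alpha> * qfun p t * dcrit p t))"
  proof -
    have "(\<integral>v. qfun p t * exp (- (a * v\<^sup>2)) \<partial>lborel) = qfun p t * sqrt (pi / a)"
      using has_bochner_integral_gaussian[OF a] by (simp add: has_bochner_integral_integral_eq)
    also have "pi / a = 2 * pi / (\<alpha> * qfun p t * dcrit p t)" by (simp add: a_def mult_ac)
    finally have eq: "(\<integral>v. qfun p t * exp (- (a * v\<^sup>2)) \<partial>lborel) = qfun p t * sqrt (2 * pi / (\<alpha> * qfun p t * dcrit p t))" .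
    have "eventually (\<lambda>n. (\<integral>v. f n v \<partial>lborel) = sqrt (real n) * (\<integral>\<theta>. indicator N \<theta> * ?g n \<theta> \<partial>lborel)) sequentially"
      using ev_good
    proof eventually_elim
      case (elim n)
      then have n: "sqrt (real n) > 0" by (simp add: good_def)
      have "(\<integral>\<theta>. indicator N \<theta> * ?g n \<theta> \<partial>lborel) = \<bar>1 / sqrt (real n)\<bar> *\<^sub>R
        (\<integral>v. indicator N (s n + 1 / sqrt (real n) * v) * (qfun p (s n + 1 / sqrt (real n) * v) * exp (real n * R n (s n + 1 / sqrt (real n) * v))) \<partial>lborel)"
        using n by (intro lborel_integral_real_affine) auto
      also have "\<dots> = 1 / sqrt (real n) * (\<integral>v. f n v \<partial>lborel)"
        using elim n by (simp add: f_def)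
      finally show ?case using n by simp
    qed
    with near_dom[unfolded eq] show ?thesis by (rule Lim_transform_eventually)
  qed
  have far: "(\<lambda>n. sqrt (real n) * (\<integral>\<theta>. indicator ({0<..} - N) \<theta> * ?g n \<theta> \<partial>lborel)) \<longlonglongrightarrow> 0"
  proof -
    \<comment> \<open>Half the smaller drop of the limiting phase from t to the ends of
      \<open>N\<close>. Halving leaves room for replacing \<alpha> by b n.\<close>
    define \<eta> where "\<eta> = min (phase p \<alpha> t - phase p \<alpha> (t + \<delta>)) (phase p \<alpha> t - phase p \<alpha> (t - \<delta>)) / 2"
    have \<eta>: "\<eta> > 0"
      using phase_mono_left[OF p \<alpha>, of "t - \<delta>" t] phase_mono_right[OF p \<alpha>, of t "t + \<delta>"] \<delta>
      by (simp add: \<eta>_def t_def)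
    have d1: "(\<lambda>n. phase p (b n) t - phase p (b n) (t + \<delta>)) \<longlonglongrightarrow> phase p \<alpha> t - phase p \<alpha> (t + \<delta>)"
      by (intro tendsto_diff phase_tendsto blim)
    have d2: "(\<lambda>n. phase p (b n) t - phase p (b n) (t - \<delta>)) \<longlonglongrightarrow> phase p \<alpha> t - phase p \<alpha> (t - \<delta>)"
      by (intro tendsto_diff phase_tendsto blim)
    have e1: "eventually (\<lambda>n. \<eta> < phase p (b n) t - phase p (b n) (t + \<delta>)) sequentially"
      using d1 by (rule order_tendstoD(1)) (use \<eta> in \<open>auto simp: \<eta>_def min_def split: if_splits\<close>)
    have e2: "eventually (\<lambda>n. \<eta> < phase p (b n) t - phase p (b n) (t - \<delta>)) sequentially"
      using d2 by (rule order_tendstoD(1)) (use \<eta> in \<open>auto simp: \<eta>_def min_def split: if_splits\<close>)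
    \<comment> \<open>A fixed number of factors is reserved for integrability: eventually n0 b n and
      n0 (1 - b n) exceed 1, as \<open>exp_phase_bound\<close> requires. The other n - n0 factors
      supply the decay.\<close>
    define n0 where "n0 = nat \<lceil>2 / min \<alpha> (1 - \<alpha>)\<rceil> + 1"
    have n0: "2 / min \<alpha> (1 - \<alpha>) < real n0" unfolding n0_def by linarith
    have "2 < real n0 * min \<alpha> (1 - \<alpha>)"
      using n0 \<alpha> by (simp add: pos_divide_less_eq)
    also have "real n0 * min \<alpha> (1 - \<alpha>) \<le> real n0 * \<alpha>" by (intro mult_left_mono) auto
    finally have n01: "1 < real n0 * \<alpha>" by simp
    have "2 < real n0 * min \<alpha> (1 - \<alpha>)"
      using n0 \<alpha> by (simp add: pos_divide_less_eq)
    also have "real n0 * min \<alpha> (1 - \<alpha>) \<le> real n0 * (1 - \<alpha>)" by (intro mult_left_mono) auto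
    finally have n02: "1 < real n0 * (1 - \<alpha>)" by simp
    have e3: "eventually (\<lambda>n. 1 < real n0 * b n) sequentially"
      by (rule order_tendstoD(1)[OF _ n01]) (intro tendsto_intros blim)
    have e4: "eventually (\<lambda>n. 1 < real n0 * (1 - b n)) sequentially"
      by (rule order_tendstoD(1)[OF _ n02]) (intro tendsto_intros blim)
    have e5: "eventually (\<lambda>n. phase p \<alpha> t - 1 < phase p (b n) t) sequentially"
      by (rule order_tendstoD(1)[OF phase_tendsto[OF blim]]) simp
    obtain C where C: "C > 0" "\<And>\<beta> \<theta>. 1 \<le> real n0 * \<beta> \<Longrightarrow> 1 \<le> real n0 * (1 - \<beta>) \<Longrightarrow> \<theta> > 0 \<Longrightarrow>
      exp (real n0 * phase p \<beta> \<theta>) \<le> C * (\<theta> powr (1 / 2) * J_int p \<theta> * I_int p \<theta>)"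
      using exp_phase_bound[OF p, of "real n0"] by metis
    define C2 where "C2 = exp (- (real n0 * (phase p \<alpha> t - 1)))"
    \<comment> \<open>The integrand of \<open>theta_integral p 0 1\<close>, hence integrable; it
      equals \<open>qfun\<close> times the majorant of the reserved factors, up to the
      constant.\<close>
    define h where "h = (\<lambda>\<theta>. indicator {0<..} \<theta> * (\<theta> powr (- 1 / 2) * K_int p \<theta> * I_int p \<theta>))"
    have h_int: "integrable lborel h"
      using has_bochner_integral_theta_integral[OF p, of 0 1] unfolding h_def I_int_eq_mom K_int_eq_mom
      by (simp add: has_bochner_integral_iff)
    have h_nonneg: "h \<theta> \<ge> 0" for \<theta>
      using int_pos[OF p, of \<theta>] unfolding h_def by (cases "\<theta> > 0") auto
    define H where "H = (\<integral>\<theta>. h \<theta> \<partial>lborel)"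
    show ?thesis
    proof (rule tendsto_sandwich[where f = "\<lambda>_. 0"])
      have "(\<lambda>n. real n powr (1 / 2) * exp (- \<eta>) ^ n) \<longlonglongrightarrow> 0"
        using \<eta> by (intro tendsto_powr_times_power_0) auto
      then show "(\<lambda>n. (real n powr (1 / 2) * exp (- \<eta>) ^ n) * (exp (real n0 * \<eta>) * C2 * C * H)) \<longlonglongrightarrow> 0"
        by (rule tendsto_mult_left_zero)
      show "\<forall>\<^sub>F n in sequentially. 0 \<le> sqrt (real n) * (\<integral>\<theta>. indicator ({0<..} - N) \<theta> * ?g n \<theta> \<partial>lborel)"
      proof (intro always_eventually allI mult_nonneg_nonneg)
        fix n
        have "0 \<le> indicator ({0<..} - N) \<theta> * ?g n \<theta>" for \<theta>
          using qfun_pos[OF p, of \<theta>] by (cases "\<theta> > 0") (auto simp: indicator_def)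
        then show "0 \<le> (\<integral>\<theta>. indicator ({0<..} - N) \<theta> * ?g n \<theta> \<partial>lborel)"
          by (intro integral_nonneg_AE AE_I2)
      qed simp
      show "\<forall>\<^sub>F n in sequentially. sqrt (real n) * (\<integral>\<theta>. indicator ({0<..} - N) \<theta> * ?g n \<theta> \<partial>lborel)
          \<le> (real n powr (1 / 2) * exp (- \<eta>) ^ n) * (exp (real n0 * \<eta>) * C2 * C * H)"
        using ev_good e1 e2 e3 e4 e5 eventually_ge_at_top[of n0]
      proof eventually_elim
        case (elim n)
        have b: "0 < b n" "b n < 1" and sN: "s n \<in> N" using elim(1) by (auto simp: good_def)
        \<comment> \<open>The gap \<eta> is measured from the fixed point t, while \<open>R\<close>
          is normalised at s n; optimality of s n links the two.\<close>
        have st: "phase p (b n) t \<le> phase p (b n) (s n)"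
          unfolding s_def by (rule phase_le_maximizer[OF p b t])
        have Rle: "R n \<theta> \<le> - \<eta>" if "\<theta> > 0" "\<theta> \<notin> N" for \<theta>
        proof -
          have "\<theta> < t - \<delta> \<or> \<theta> > t + \<delta>" using that(2) unfolding N_def atLeastAtMost_iff by linarith
          then consider "\<theta> < t - \<delta>" | "\<theta> > t + \<delta>" by blast
          then show ?thesis
          proof cases
            case 1
            have "phase p (b n) \<theta> < phase p (b n) (t - \<delta>)"
              using 1 that sN by (intro phase_mono_left[OF p b]) (auto simp: N_def s_def)
            then show ?thesis using elim(3) st by (simp add: R_def)
          next
            case 2
            have "phase p (b n) \<theta> < phase p (b n) (t + \<delta>)"
              using 2 that sN by (intro phase_mono_right[OF p b]) (auto simp: N_def s_def)
            then show ?thesis using elim(2) st by (simp add: R_def)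
          qed
        qed
        have bound: "indicator ({0<..} - N) \<theta> * ?g n \<theta> \<le>
            (exp (- \<eta>) ^ n * (exp (real n0 * \<eta>) * C2 * C)) * h \<theta>" for \<theta>
        proof (cases "\<theta> \<in> {0<..} - N")
          case True
          then have \<theta>: "\<theta> > 0" "\<theta> \<notin> N" by auto
          note pos = int_pos[OF p less_imp_le[OF \<theta>(1)]]
          have "exp (real n * R n \<theta>) = exp ((real n - real n0) * R n \<theta>) * exp (- (real n0 * phase p (b n) (s n))) * exp (real n0 * phase p (b n) \<theta>)"
            by (simp add: exp_add[symmetric] R_def algebra_simps)
          also have "\<dots> \<le> exp ((real n - real n0) * (- \<eta>)) * C2 * (C * (\<theta> powr (1 / 2) * J_int p \<theta> * I_int p \<theta>))"
          proof (intro mult_mono)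
            show "exp ((real n - real n0) * R n \<theta>) \<le> exp ((real n - real n0) * (- \<eta>))"
              unfolding exp_le_cancel_iff using elim(7) Rle[OF \<theta>] by (intro mult_left_mono) auto
            show "exp (- (real n0 * phase p (b n) (s n))) \<le> C2"
              unfolding C2_def exp_le_cancel_iff neg_le_iff_le using elim(6) st by (intro mult_left_mono) auto
            show "exp (real n0 * phase p (b n) \<theta>) \<le> C * (\<theta> powr (1 / 2) * J_int p \<theta> * I_int p \<theta>)"
              using elim \<theta> by (intro C(2)) auto
          qed (use pos C in \<open>auto simp: C2_def\<close>)
          also have "exp ((real n - real n0) * (- \<eta>)) = exp (- \<eta>) ^ n * exp (real n0 * \<eta>)"
            by (simp add: exp_of_nat_mult[symmetric] exp_add[symmetric] algebra_simps)
          finally have "?g n \<theta> \<le> qfun p \<theta> * (exp (- \<eta>) ^ n * exp (real n0 * \<eta>) * C2 * (C * (\<theta> powr (1 / 2) * J_int p \<theta> * I_int p \<theta>)))"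
            using qfun_pos[OF p \<theta>(1)] by (intro mult_left_mono) auto
          also have "\<dots> = (exp (- \<eta>) ^ n * (exp (real n0 * \<eta>) * C2 * C)) * h \<theta>"
          proof -
            have "\<theta> powr (1 / 2) / \<theta> = \<theta> powr (1 / 2 - 1)" using \<theta> by (simp only: powr_diff powr_one)
            also have "1 / 2 - 1 = (- 1 / 2 :: real)" by simp
            finally have z: "\<theta> powr (1 / 2) / \<theta> = \<theta> powr (- 1 / 2)" .
            have "qfun p \<theta> * (\<theta> powr (1 / 2) * J_int p \<theta> * I_int p \<theta>) = (\<theta> powr (1 / 2) / \<theta>) * K_int p \<theta> * I_int p \<theta>"
              using pos by (simp add: qfun_def)
            also have "\<dots> = h \<theta>" unfolding z h_def using \<theta>(1) by simp
            finally have q: "qfun p \<theta> * (\<theta> powr (1 / 2) * J_int p \<theta> * I_int p \<theta>) = h \<theta>" .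
            show ?thesis unfolding q[symmetric] by (simp only: mult_ac)
          qed
          finally show ?thesis using True by simp
        next
          case False
          then show ?thesis using h_nonneg[of \<theta>] C by (simp add: C2_def)
        qed
        have "(\<integral>\<theta>. indicator ({0<..} - N) \<theta> * ?g n \<theta> \<partial>lborel) \<le>
            (\<integral>\<theta>. (exp (- \<eta>) ^ n * (exp (real n0 * \<eta>) * C2 * C)) * h \<theta> \<partial>lborel)"
        proof (rule integral_mono_AE')
          show "integrable lborel (\<lambda>\<theta>. (exp (- \<eta>) ^ n * (exp (real n0 * \<eta>) * C2 * C)) * h \<theta>)"
            using h_int by (rule integrable_mult_right)
          show "AE \<theta> in lborel. 0 \<le> (exp (- \<eta>) ^ n * (exp (real n0 * \<eta>) * C2 * C)) * h \<theta>"
            using h_nonneg C by (intro AE_I2 mult_nonneg_nonneg) (auto simp: C2_def)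
        qed (use bound in auto)
        also have "\<dots> = exp (- \<eta>) ^ n * (exp (real n0 * \<eta>) * C2 * C * H)"
          by (simp add: H_def mult.assoc)
        finally have "sqrt (real n) * (\<integral>\<theta>. indicator ({0<..} - N) \<theta> * ?g n \<theta> \<partial>lborel) \<le>
            sqrt (real n) * (exp (- \<eta>) ^ n * (exp (real n0 * \<eta>) * C2 * C * H))"
          by (rule mult_left_mono) simp
        then show ?case by (simp add: powr_half_sqrt mult.assoc)
      qed
    qed simp
  qed
  have "eventually (\<lambda>n. sqrt (real n) * (\<integral>\<theta>. indicator N \<theta> * ?g n \<theta> \<partial>lborel) +
      sqrt (real n) * (\<integral>\<theta>. indicator ({0<..} - N) \<theta> * ?g n \<theta> \<partial>lborel) =
      sqrt (real n) * (enn2real (theta_integral p (n - j n - 1) (j n)) * exp (- (real n * phase p (real (j n) / real n) (phase_maximizer p (real (j n) / real n)))))) sequentially"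
    using ev_good
  proof eventually_elim
    case (elim n)
    then have jn: "j n < n" by (simp add: good_def)
    define E where "E = exp (- (real n * phase p (b n) (s n)))"
    have hb: "has_bochner_integral lborel (\<lambda>\<theta>. indicator {0<..} \<theta> * (qfun p \<theta> * exp (real n * phase p (b n) \<theta>)) * E)
        (enn2real (theta_integral p (n - j n - 1) (j n)) * E)"
      unfolding b_def by (rule has_bochner_integral_mult_left[OF has_bochner_integral_theta_integral_phase[OF p jn]])
    have "indicator {0<..} \<theta> * (qfun p \<theta> * exp (real n * phase p (b n) \<theta>)) * E = indicator {0<..} \<theta> * ?g n \<theta>" for \<theta>
      by (simp add: E_def R_def right_diff_distrib exp_diff exp_minus field_simps)
    with hb have hb': "has_bochner_integral lborel (\<lambda>\<theta>. indicator {0<..} \<theta> * ?g n \<theta>)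
        (enn2real (theta_integral p (n - j n - 1) (j n)) * E)" by simp
    then have int: "integrable lborel (\<lambda>\<theta>. indicator {0<..} \<theta> * ?g n \<theta>)"
      by (simp add: has_bochner_integral_iff)
    have i1: "integrable lborel (\<lambda>\<theta>. indicator N \<theta> * ?g n \<theta>)"
      by (rule Bochner_Integration.integrable_bound[OF int]) (use N_sub in \<open>auto simp: indicator_def\<close>)
    have i2: "integrable lborel (\<lambda>\<theta>. indicator ({0<..} - N) \<theta> * ?g n \<theta>)"
      by (rule Bochner_Integration.integrable_bound[OF int]) (auto simp: indicator_def)
    have "(\<integral>\<theta>. indicator N \<theta> * ?g n \<theta> \<partial>lborel) +
        (\<integral>\<theta>. indicator ({0<..} - N) \<theta> * ?g n \<theta> \<partial>lborel) =
        (\<integral>\<theta>. indicator N \<theta> * ?g n \<theta> + indicator ({0<..} - N) \<theta> * ?g n \<theta> \<partial>lborel)"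
      by (rule Bochner_Integration.integral_add[symmetric, OF i1 i2])
    also have "\<dots> = (\<integral>\<theta>. indicator {0<..} \<theta> * ?g n \<theta> \<partial>lborel)"
      using N_sub by (intro Bochner_Integration.integral_cong) (auto simp: indicator_def)
    also have "\<dots> = enn2real (theta_integral p (n - j n - 1) (j n)) * E"
      by (rule has_bochner_integral_integral_eq[OF hb'])
    finally show ?case by (simp add: E_def b_def s_def distrib_left[symmetric])
  qed
  with tendsto_add[OF near far] show ?thesis
    unfolding add_0_right by (rule Lim_transform_eventually)
qed

text \<open>The exact formula leaves only the integral to be estimated. Its limit qfun t sqrt(2 pi /
  D) contains the factor K / (t J) as qfun t, and D is the modulus of the second phase
  derivative.\<close>

lemma intrinsic_volume_bulk:
  fixes j :: "nat \<Rightarrow> nat"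
  assumes p: "p > 1" and \<alpha>: "0 < \<alpha>" "\<alpha> < 1" and lim: "(\<lambda>n. real (j n) / real n) \<longlonglongrightarrow> \<alpha>"
  shows "(\<lambda>n. intrinsic_volume n (lp_ball p n) (j n)) \<sim>[sequentially]
        (\<lambda>n. p * (p - 1) powr (real n - real (j n) - 1) * real n * real ((n - 1) choose j n)
               / (2 * pi powr ((real n - real (j n)) / 2) * Gamma ((real (j n) + p) / p))
             * (K_int p (phase_maximizer p \<alpha>)
                / (phase_maximizer p \<alpha> * J_int p (phase_maximizer p \<alpha>)))
             * exp (real n * phase p (real (j n) / real n)
                               (phase_maximizer p (real (j n) / real n)))
             * sqrt (2 * pi / (real n * \<bar>(deriv ^^ 2) (phase p \<alpha>) (phase_maximizer p \<alpha>)\<bar>)))"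
proof (rule asymp_equivI')
  define t where "t = phase_maximizer p \<alpha>"
  have t: "t > 0" unfolding t_def by (rule phase_maximizer_pos[OF p \<alpha>])
  define D where "D = \<alpha> * qfun p t * dcrit p t"
  have D: "D > 0" using \<alpha> qfun_pos[OF p t] dcrit_pos[OF p t] by (simp add: D_def)
  have D2: "\<bar>(deriv ^^ 2) (phase p \<alpha>) t\<bar> = D"
    using phase_second_deriv[OF p \<alpha>] D by (simp add: t_def[symmetric] D_def)
  define L where "L = qfun p t * sqrt (2 * pi / D)"
  have L: "L > 0" using D qfun_pos[OF p t] by (simp add: L_def)
  define E where "E = (\<lambda>n. exp (real n * phase p (real (j n) / real n) (phase_maximizer p (real (j n) / real n))))"
  define M where "M = (\<lambda>n. enn2real (theta_integral p (n - j n - 1) (j n)))"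
  have "(\<lambda>n. sqrt (real n) * (M n / E n)) \<longlonglongrightarrow> L"
    using theta_integral_laplace[OF p \<alpha> lim] by (simp add: M_def E_def L_def D_def t_def exp_minus field_simps)
  from tendsto_divide[OF this tendsto_const[of L]]
  have lim1: "(\<lambda>n. sqrt (real n) * (M n / E n) / L) \<longlonglongrightarrow> 1" using L by simp
  have "eventually (\<lambda>n. real (j n) / real n < 1) sequentially"
    using lim \<alpha>(2) by (rule order_tendstoD)
  then have "eventually (\<lambda>n. sqrt (real n) * (M n / E n) / L =
      intrinsic_volume n (lp_ball p n) (j n) /
        (p * (p - 1) powr (real n - real (j n) - 1) * real n * real ((n - 1) choose j n)
               / (2 * pi powr ((real n - real (j n)) / 2) * Gamma ((real (j n) + p) / p))
             * (K_int p t / (t * J_int p t)) * E n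
             * sqrt (2 * pi / (real n * \<bar>(deriv ^^ 2) (phase p \<alpha>) t\<bar>)))) sequentially"
    using eventually_gt_at_top[of 0]
  proof eventually_elim
    case (elim n)
    then have jn: "j n < n" by (simp add: pos_divide_less_eq)
    define c where "c = p * (p - 1) ^ (n - j n - 1) * real n * real ((n - 1) choose j n) /
      (2 * pi powr ((real n - real (j n)) / 2) * Gamma ((real (j n) + p) / p))"
    \<comment> \<open>j n < n holds eventually because \<alpha> < 1, so the real exponent is a
      natural number.\<close>
    have "real n - real (j n) - 1 = real (n - j n - 1)" using jn by (simp add: of_nat_diff)
    then have pw: "(p - 1) powr (real n - real (j n) - 1) = (p - 1) ^ (n - j n - 1)"
      using p by (simp only: powr_realpow diff_gt_0_iff_gt)
    have "Gamma ((real (j n) + p) / p) > 0"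
      using p by (intro Gamma_real_pos divide_pos_pos add_nonneg_pos) auto
    then have "Gamma ((real (j n) + p) / p) \<noteq> 0" by (rule less_imp_neq[symmetric])
    moreover have "(n - 1) choose j n > 0" using jn by (simp add: zero_less_binomial_iff)
    ultimately have c: "c \<noteq> 0" using p elim(2) by (simp add: c_def)
    have V: "intrinsic_volume n (lp_ball p n) (j n) = c * M n"
      unfolding c_def M_def by (rule intrinsic_volume_lp_ball[OF p jn])
    have sq: "sqrt (2 * pi / (real n * D)) = sqrt (2 * pi / D) / sqrt (real n)"
      by (simp add: real_sqrt_divide real_sqrt_mult)
    have E: "E n > 0" by (simp add: E_def)
    have alg: "r * (m / e) / (q * w) = c * m / (c * q * e * (w / r))"
      if "c \<noteq> 0" "e > 0" "r > 0" "q > 0" "w > 0" for r m e q w c :: real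
      using that by (simp add: field_simps)
    have "sqrt (real n) * (M n / E n) / (qfun p t * sqrt (2 * pi / D)) =
        c * M n / (c * qfun p t * E n * (sqrt (2 * pi / D) / sqrt (real n)))"
      by (rule alg) (use c E elim(2) qfun_pos[OF p t] D in auto)
    then show ?case
      unfolding V pw c_def[symmetric] D2 sq L_def qfun_def .
  qed
  with lim1 have "(\<lambda>n. intrinsic_volume n (lp_ball p n) (j n) /
        (p * (p - 1) powr (real n - real (j n) - 1) * real n * real ((n - 1) choose j n)
               / (2 * pi powr ((real n - real (j n)) / 2) * Gamma ((real (j n) + p) / p))
             * (K_int p t / (t * J_int p t)) * E n
             * sqrt (2 * pi / (real n * \<bar>(deriv ^^ 2) (phase p \<alpha>) t\<bar>)))) \<longlonglongrightarrow> 1"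
    by (rule Lim_transform_eventually)
  then show "(\<lambda>n. intrinsic_volume n (lp_ball p n) (j n) /
        (p * (p - 1) powr (real n - real (j n) - 1) * real n * real ((n - 1) choose j n)
               / (2 * pi powr ((real n - real (j n)) / 2) * Gamma ((real (j n) + p) / p))
             * (K_int p (phase_maximizer p \<alpha>)
                / (phase_maximizer p \<alpha> * J_int p (phase_maximizer p \<alpha>)))
             * exp (real n * phase p (real (j n) / real n)
                               (phase_maximizer p (real (j n) / real n)))
             * sqrt (2 * pi / (real n * \<bar>(deriv ^^ 2) (phase p \<alpha>) (phase_maximizer p \<alpha>)\<bar>)))) \<longlonglongrightarrow> 1"
    by (simp only: E_def t_def)
qed

theorem theorem2p13:
  fixes p :: real
  assumes "1 < p"
  shows
    "(\<forall>(j :: nat \<Rightarrow> nat) (\<alpha> :: real).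
        (\<forall>n\<ge>1. j n \<le> n) \<and> 0 < \<alpha> \<and> \<alpha> < 1 \<and> (\<lambda>n. real (j n) / real n) \<longlonglongrightarrow> \<alpha> \<longrightarrow>
        (\<lambda>n. intrinsic_volume n (lp_ball p n) (j n)) \<sim>[sequentially]
        (\<lambda>n. p * (p - 1) powr (real n - real (j n) - 1) * real n * real ((n - 1) choose j n)
               / (2 * pi powr ((real n - real (j n)) / 2) * Gamma ((real (j n) + p) / p))
             * (K_int p (phase_maximizer p \<alpha>)
                / (phase_maximizer p \<alpha> * J_int p (phase_maximizer p \<alpha>)))
             * exp (real n * phase p (real (j n) / real n)
                               (phase_maximizer p (real (j n) / real n)))
             * sqrt (2 * pi / (real n * \<bar>(deriv ^^ 2) (phase p \<alpha>) (phase_maximizer p \<alpha>)\<bar>))))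
   \<and> (\<forall>j :: nat.
        (\<lambda>n. intrinsic_volume n (lp_ball p n) j) \<sim>[sequentially]
        (\<lambda>n. 1 / fact j
             * ((2 * sqrt pi) powr (1 / p)
                * (Gamma (1 / (2 * p - 2)) / (p - 1)) powr (1 - 1 / p)) ^ j
             * real n powr (real j * (1 - 1 / p))))
   \<and> (\<forall>m :: nat. m \<ge> 1 \<longrightarrow>
        (\<lambda>n. intrinsic_volume n (lp_ball p n) (n - m)) \<sim>[sequentially]
        (\<lambda>n. Gamma (real m / 2) / (2 * Gamma (real m))
             * (p * (p - 1) * Gamma (1 - 1 / p) / (pi * Gamma (1 / p))) powr (real m / 2)
             * ((2 / p * Gamma (1 / p)) ^ n * real n powr (real m / 2)
                / Gamma ((real n + p - real m) / p))))"
proof (intro conjI allI impI)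
  fix j :: "nat \<Rightarrow> nat" and \<alpha> :: real
  assume *: "(\<forall>n\<ge>1. j n \<le> n) \<and> 0 < \<alpha> \<and> \<alpha> < 1 \<and> (\<lambda>n. real (j n) / real n) \<longlonglongrightarrow> \<alpha>"
  then have \<alpha>: "0 < \<alpha>" "\<alpha> < 1" and lim: "(\<lambda>n. real (j n) / real n) \<longlonglongrightarrow> \<alpha>" by blast+
  show "(\<lambda>n. intrinsic_volume n (lp_ball p n) (j n)) \<sim>[sequentially]
        (\<lambda>n. p * (p - 1) powr (real n - real (j n) - 1) * real n * real ((n - 1) choose j n)
               / (2 * pi powr ((real n - real (j n)) / 2) * Gamma ((real (j n) + p) / p))
             * (K_int p (phase_maximizer p \<alpha>)
                / (phase_maximizer p \<alpha> * J_int p (phase_maximizer p \<alpha>)))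
             * exp (real n * phase p (real (j n) / real n)
                               (phase_maximizer p (real (j n) / real n)))
             * sqrt (2 * pi / (real n * \<bar>(deriv ^^ 2) (phase p \<alpha>) (phase_maximizer p \<alpha>)\<bar>)))"
    by (rule intrinsic_volume_bulk[OF assms \<alpha> lim])
qed (rule intrinsic_volume_left_edge[OF assms] | rule intrinsic_volume_right_edge[OF assms], assumption)+

end
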